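(* Let $\Omega\subset\mathbb{R}^N$ be a domain of class $C^2$ (not necessarily bounded) with boundary $\Gamma$, and let $x\in\Omega$, $R>0$ and $z_x\in\Gamma$ be such that $B_R(x)\subset\Omega$, $\overline{B_R(x)}\cap\left(\mathbb{R}^N\setminus\Omega\right)=\{z_x\}$ and $\kappa_j(z_x)<\frac1R$ for $j=1,\dots,N-1$. Set $\Pi_0(z_x)=\prod_{j=1}^{N-1}\left[1-R\,\kappa_j(z_x)\right]$. Let $v^\pm$ be the solution of $$v_t-\mathcal{M}^{\pm}(\nabla^2v)=0\ \text{ in }\ \Omega\times(0,\infty),\quad v=0\ \text{ on }\ \Omega\times\{0\},\quad v=1\ \text{ on }\ \Gamma\times(0,\infty),$$ and for $1<q\le\infty$ let $\mu^\pm_q(x,t)$ be the $q$-mean of $v^\pm(\cdot,t)$ on $B_R(x)$. Then, for $1<q<\infty$, $$\lim_{t\to0^+}\left(\frac{R^2}{t}\right)^{\frac{N+1}{4(q-1)}}\mu^-_q(x,t)=C_{N,q}\left\{\frac{\Pi_0(z_x)}{\lambda^{\frac{N+1}{2}}}\right\}^{-\frac{1}{2(q-1)}},\qquad \lim_{t\to0^+}\left(\frac{R^2}{t}\right)^{\frac{N+1}{4(q-1)}}\mu^+_q(x,t)=C_{N,q}\left\{\frac{\Pi_0(z_x)}{\Lambda^{\frac{N+1}{2}}}\right\}^{-\frac{1}{2(q-1)}},$$ where $$C_{N,q}=\left[\frac{N!\int_0^\infty \mathrm{Erfc}(\sigma)^{q-1}\sigma^{\frac{N-1}{2}}\,d\sigma}{\Gamma\left(\frac{N+1}{2}\right)^2}\right]^{\frac{1}{q-1}},\qquad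 \mathrm{Erfc}(\sigma)=\frac{2}{\sqrt{\pi}}\int_\sigma^\infty e^{-s^2}\,ds,$$ and $\Gamma\left(\frac{N+1}{2}\right)$ denotes Euler's gamma function at $\frac{N+1}{2}$. In the case $q=\infty$, $$\lim_{t\to0^+}\mu^\pm_\infty(x,t)=\frac12 .$$
   Context: Let $N\ge2$ be an integer and let $0<\lambda\le\Lambda$ be real numbers. For a symmetric real $N\times N$ matrix $X$ with eigenvalues $\lambda_1,\dots,\lambda_N$ (counted with multiplicity), the Pucci extremal operators are $$\mathcal{M}^-(X)=\Lambda\sum_{\lambda_i<0}\lambda_i+\lambda\sum_{\lambda_i>0}\lambda_i,\qquad \mathcal{M}^+(X)=\lambda\sum_{\lambda_i<0}\lambda_i+\Lambda\sum_{\lambda_i>0}\lambda_i .$$ The signs correspond: $v^-$ (and $\mu^-_q$) refer to $\mathcal{M}^-$, $v^+$ (and $\mu^+_q$) to $\mathcal{M}^+$. Equations hold in the viscosity sense; $\nabla^2v$ is the Hessian in the space variable. Solutions are continuous on $\left(\overline{\Omega}\times[0,\infty)\right)\setminus(\Gamma\times\{0\})$, attain the initial and boundary values pointwise, and take values in $[0,1]$ (in particular, if $\Omega$ is unbounded only the bounded solution is considered). $B_R(x)$ is the open ball of radius $R$ centered at $x$. $\kappa_1,\dots,\kappa_{N-1}$ are the principal curvatures of $\Gamma$ (with respect to the inward normal, so that they are positive when $\Omega$ is a ball). For $1\le q\le\infty$ and a continuous function $u:\overline{B}\to\mathbb{R}$ on the closure of a ball $B$, the $q$-mean of $u$ on $B$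 is the unique minimum point of the function $\mathbb{R}\ni\mu\mapsto\|u-\mu\|_{L^q(B)}$. *)

theory Defs
  imports
    "HOL-Analysis.Analysis"
    "HOL-Probability.Essential_Supremum"
    "HOL-Library.Multiset"
begin

(* The eigenvalues, repeated according to multiplicity, of a linear map f on the subspace T.
   The multiplicity is the dimension of the eigenspace; this agrees with the algebraic one
   because f is self-adjoint on T wherever this is used. *)
definition eigenvalues_on ::
  "'a::euclidean_space set \<Rightarrow> ('a \<Rightarrow> 'a) \<Rightarrow> real multiset" where
  "eigenvalues_on T f =
     (\<Sum>r \<in> {r. \<exists>w\<in>T. w \<noteq> 0 \<and> f w = r *\<^sub>R w}.
        replicate_mset (dim {w\<in>T. f w = r *\<^sub>R w}) r)"

definition eigenvalues :: "real^'n^'n \<Rightarrow> real multiset" where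
  "eigenvalues X = eigenvalues_on UNIV (\<lambda>w. X *v w)"

definition pucci_minus :: "real \<Rightarrow> real \<Rightarrow> real^'n^'n \<Rightarrow> real" where
  "pucci_minus lam Lam X =
     Lam * (\<Sum>r \<in># filter_mset (\<lambda>r. r < 0) (eigenvalues X). r)
     + lam * (\<Sum>r \<in># filter_mset (\<lambda>r. r > 0) (eigenvalues X). r)"

definition pucci_plus :: "real \<Rightarrow> real \<Rightarrow> real^'n^'n \<Rightarrow> real" where
  "pucci_plus lam Lam X =
     lam * (\<Sum>r \<in># filter_mset (\<lambda>r. r < 0) (eigenvalues X). r)
     + Lam * (\<Sum>r \<in># filter_mset (\<lambda>r. r > 0) (eigenvalues X). r)"

definition gradient :: "(real^'n \<Rightarrow> real) \<Rightarrow> real^'n \<Rightarrow> real^'n" where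
  "gradient f x = (\<chi> i. frechet_derivative f (at x) (axis i 1))"

definition hessian :: "(real^'n \<Rightarrow> real) \<Rightarrow> real^'n \<Rightarrow> real^'n^'n" where
  "hessian f x = matrix (frechet_derivative (gradient f) (at x))"

definition C2_function :: "(real^'n \<Rightarrow> real) \<Rightarrow> bool" where
  "C2_function f \<longleftrightarrow>
     (\<forall>x. f differentiable (at x)) \<and> (\<forall>x. gradient f differentiable (at x)) \<and>
     continuous_on UNIV (hessian f)"

(* Near every boundary point, the set lies strictly on one side of the graph of a C^2
   function over a hyperplane. The hyperplane is the orthogonal complement of the unit vector e;
   y - (y \<bullet> e) *\<^sub>R e is the projection of y to it, so only the values of h on the
   hyperplane matter. *)
definition C2_domain :: "(real^'n) set \<Rightarrow> bool" where
  "C2_domain S \<longleftrightarrow>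
     open S \<and> connected S \<and> S \<noteq> {} \<and>
     (\<forall>z \<in> frontier S. \<exists>r e h. r > 0 \<and> norm e = 1 \<and> C2_function h \<and>
        S \<inter> ball z r = {y \<in> ball z r. y \<bullet> e > h (y - (y \<bullet> e) *\<^sub>R e)})"

(* The unit vector that is orthogonal to the frontier at z and points into S. *)
definition inward_normal :: "(real^'n) set \<Rightarrow> real^'n \<Rightarrow> real^'n" where
  "inward_normal S z =
     (THE n. norm n = 1 \<and>
        ((\<lambda>y. (y - z) \<bullet> n / norm (y - z)) \<longlongrightarrow> 0) (at z within frontier S) \<and>
        (\<forall>\<^sub>F s in at_right 0. z + s *\<^sub>R n \<in> S))"

definition boundary_tangent_space :: "(real^'n) set \<Rightarrow> real^'n \<Rightarrow> (real^'n) set" where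
  "boundary_tangent_space S z = {w. w \<bullet> inward_normal S z = 0}"

(* The eigenvalues of the Weingarten map, i.e. of minus the differential of the inward unit
   normal along the frontier. With this sign a sphere bounding a ball of radius r has
   principal curvatures 1/r. The derivative is taken within the frontier; it is determined on
   the tangent space, and only its values there are used. *)
definition principal_curvatures :: "(real^'n) set \<Rightarrow> real^'n \<Rightarrow> real multiset" where
  "principal_curvatures S z =
     eigenvalues_on (boundary_tangent_space S z)
       (\<lambda>w. - frechet_derivative (inward_normal S) (at z within frontier S) w)"

definition Pi0 :: "real \<Rightarrow> (real^'n) set \<Rightarrow> real^'n \<Rightarrow> real" where
  "Pi0 R S z = (\<Prod>k \<in># principal_curvatures S z. 1 - R * k)"

definition space_gradient :: "((real^'n) \<times> real \<Rightarrow> real) \<Rightarrow> (real^'n) \<times> real \<Rightarrow> real^'n" where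
  "space_gradient f p = gradient (\<lambda>y. f (y, snd p)) (fst p)"

definition space_hessian :: "((real^'n) \<times> real \<Rightarrow> real) \<Rightarrow> (real^'n) \<times> real \<Rightarrow> real^'n^'n" where
  "space_hessian f p = hessian (\<lambda>y. f (y, snd p)) (fst p)"

definition time_deriv :: "((real^'n) \<times> real \<Rightarrow> real) \<Rightarrow> (real^'n) \<times> real \<Rightarrow> real" where
  "time_deriv f p = deriv (\<lambda>s. f (fst p, s)) (snd p)"

definition C21_on :: "((real^'n) \<times> real) set \<Rightarrow> ((real^'n) \<times> real \<Rightarrow> real) \<Rightarrow> bool" where
  "C21_on U f \<longleftrightarrow>
     (\<forall>(x, t) \<in> U.
        (\<lambda>y. f (y, t)) differentiable (at x) \<and>
        gradient (\<lambda>y. f (y, t)) differentiable (at x) \<and>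
        (\<lambda>s. f (x, s)) differentiable (at t)) \<and>
     continuous_on U f \<and> continuous_on U (space_gradient f) \<and>
     continuous_on U (space_hessian f) \<and> continuous_on U (time_deriv f)"

(* Viscosity sub- and supersolutions of v_t - F(D^2 v) = 0 in the open set Q. *)
definition viscosity_subsolution ::
  "(real^'n^'n \<Rightarrow> real) \<Rightarrow> ((real^'n) \<times> real) set \<Rightarrow> ((real^'n) \<times> real \<Rightarrow> real) \<Rightarrow> bool" where
  "viscosity_subsolution F Q v \<longleftrightarrow>
     (\<forall>U f p. open U \<and> U \<subseteq> Q \<and> p \<in> U \<and> C21_on U f \<and>
        (\<forall>p' \<in> U. v p' - f p' \<le> v p - f p) \<longrightarrow>
        time_deriv f p - F (space_hessian f p) \<le> 0)"

definition viscosity_supersolution ::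
  "(real^'n^'n \<Rightarrow> real) \<Rightarrow> ((real^'n) \<times> real) set \<Rightarrow> ((real^'n) \<times> real \<Rightarrow> real) \<Rightarrow> bool" where
  "viscosity_supersolution F Q v \<longleftrightarrow>
     (\<forall>U f p. open U \<and> U \<subseteq> Q \<and> p \<in> U \<and> C21_on U f \<and>
        (\<forall>p' \<in> U. v p' - f p' \<ge> v p - f p) \<longrightarrow>
        time_deriv f p - F (space_hessian f p) \<ge> 0)"

definition viscosity_solution ::
  "(real^'n^'n \<Rightarrow> real) \<Rightarrow> ((real^'n) \<times> real) set \<Rightarrow> ((real^'n) \<times> real \<Rightarrow> real) \<Rightarrow> bool" where
  "viscosity_solution F Q v \<longleftrightarrow>
     continuous_on Q v \<and> viscosity_subsolution F Q v \<and> viscosity_supersolution F Q v"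

(* Nothing is required of v on frontier S \<times> {0}, where the data are incompatible. *)
definition is_solution ::
  "(real^'n^'n \<Rightarrow> real) \<Rightarrow> (real^'n) set \<Rightarrow> ((real^'n) \<times> real \<Rightarrow> real) \<Rightarrow> bool" where
  "is_solution F S v \<longleftrightarrow>
     viscosity_solution F (S \<times> {0<..}) v \<and>
     continuous_on (closure S \<times> {0..} - frontier S \<times> {0}) v \<and>
     (\<forall>p \<in> closure S \<times> {0..} - frontier S \<times> {0}. 0 \<le> v p \<and> v p \<le> 1) \<and>
     (\<forall>y \<in> S. v (y, 0) = 0) \<and>
     (\<forall>y \<in> frontier S. \<forall>t > 0. v (y, t) = 1)"

definition Lq_norm :: "ereal \<Rightarrow> 'a::euclidean_space set \<Rightarrow> ('a \<Rightarrow> real) \<Rightarrow> ereal" where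
  "Lq_norm q B f =
     (if q = \<infinity> then esssup (restrict_space lborel B) (\<lambda>y. ereal \<bar>f y\<bar>)
      else ereal ((LINT y:B|lborel. \<bar>f y\<bar> powr real_of_ereal q) powr (1 / real_of_ereal q)))"

definition q_mean :: "ereal \<Rightarrow> 'a::euclidean_space set \<Rightarrow> ('a \<Rightarrow> real) \<Rightarrow> real" where
  "q_mean q B u =
     (THE m. is_arg_min (\<lambda>m. Lq_norm q B (\<lambda>y. u y - m)) (\<lambda>_. True) m)"

definition Erfc :: "real \<Rightarrow> real" where
  "Erfc \<sigma> = 2 / sqrt pi * (LINT s:{\<sigma><..}|lborel. exp (- (s\<^sup>2)))"

definition C_const :: "nat \<Rightarrow> real \<Rightarrow> real" where
  "C_const N q =
     (fact N * (LINT \<sigma>:{0<..}|lborel. Erfc \<sigma> powr (q - 1) * \<sigma> powr ((real N - 1) / 2))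
       / (Gamma ((real N + 1) / 2))\<^sup>2) powr (1 / (q - 1))"

end

theory Submission
  imports Defs "HOL-Probability.Distributions" "HOL-Real_Asymp.Real_Asymp"
begin

text \<open>
  For a function with values in \<open>[0, 1]\<close> whose total mass is small compared with the volume of the ball
  \<open>B\<close>, the \<open>q\<close>-mean \<open>\<mu>\<close> satisfies \<open>\<mu> ^ (q - 1) \<bar>B\<bar> ~ \<integral> v ^ (q - 1)\<close>, so everything reduces to the
  asymptotics of this integral. Put \<open>t = h ^ 4\<close> and blow up at the contact point \<open>z\<close>, by \<open>h ^ 2\<close> in the
  direction of the inward normal and by \<open>h\<close> in the tangential directions. At distances of order \<open>h ^ 2\<close> from a
  point of this scale the domain looks like a half-space, whose boundary is displaced by the second
  fundamental form at \<open>z\<close>. On balls of radius \<open>K h ^ 2\<close> the flat profile Erfc plus or minus a small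
  paraboloid in space-time is a strict classical super- or subsolution, so \<open>v\<close> converges pointwise to Erfc of
  the limiting height. No comparison principle between viscosity solutions is needed, only the
  definition of sub- and supersolutions. An exponential barrier on interior balls gives the Gaussian
  bound that dominates the integrand, and the limit integral over the paraboloid region is computed by
  Fubini.
\<close>

subsection \<open>Eigenvalues and Pucci operators\<close>

text \<open>The exponents come from a balance of lengths. At time \<open>t = h^4\<close> the
  solution is visible only within a distance of order \<open>sqrt t = h^2\<close> of the frontier.
  The gap between sphere and frontier grows quadratically from \<open>z\<close>, so the part of the
  ball that matters has tangential extent \<open>h\<close> and volume of order
  \<open>h^2 * h^(N-1) = h^(N+1)\<close>. A level \<open>m\<close> satisfies
  \<open>m^(q-1) |B|\<close> ~ \<open>h^(N+1)\<close> when \<open>m\<close> is of order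
  \<open>h^((N+1)/(q-1))\<close>. The strict curvature condition keeps the gap nondegenerate.

  The obstacle is that Erfc is an exact profile only for a half-space. On a ball of radius
  \<open>K h^2\<close> the frontier flattens as \<open>h\<close> tends to 0, but the paraboloid that
  closes the barrier on the rest of the boundary costs a multiple of
  \<open>t / (K h^2)^2 = 1 / K^2\<close>. So \<open>K\<close> is fixed by the tolerance first, and
  \<open>h\<close> tends to 0 afterwards.

  The mean is located without being computed: the sign of the integral of
  \<open>sgn (v - m) |v - m|^(q-1)\<close> at a trial level
  \<open>m = \<beta> h^((N+1)/(q-1))\<close> tells on which side of \<open>m\<close> it lies. For
  \<open>q = \<infinity>\<close> the mean is the midpoint of infimum and supremum, and contact with
  the frontier keeps the supremum equal to 1.\<close>

lemma selfadjoint_rayleigh_eigenvector: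
  fixes f :: "'a::euclidean_space \<Rightarrow> 'a"
  assumes S: "subspace S" and lin: "linear f" and inv: "\<And>w. w \<in> S \<Longrightarrow> f w \<in> S"
    and sa: "\<And>v w. v \<in> S \<Longrightarrow> w \<in> S \<Longrightarrow> f v \<bullet> w = v \<bullet> f w"
    and ne: "S \<noteq> {0}"
  obtains w r where "w \<in> S" "norm w = 1" "f w = r *\<^sub>R w"
proof -
  interpret linear f by fact
  obtain u where u: "u \<in> S" "u \<noteq> 0" using ne subspace_0[OF S] by blast
  let ?C = "S \<inter> sphere 0 1"
  have "u /\<^sub>R norm u \<in> ?C" using u S by (simp add: subspace_scale)
  then have ne': "?C \<noteq> {}" by blast
  have comp: "compact ?C"
    using closed_subspace[OF S] by (simp add: closed_Int_compact)
  have contf: "continuous_on ?C f"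
    using lin linear_continuous_on linear_conv_bounded_linear by blast
  have cont: "continuous_on ?C (\<lambda>w. f w \<bullet> w)"
    by (intro continuous_intros contf)
  obtain w where w: "w \<in> ?C" and max: "\<And>v. v \<in> ?C \<Longrightarrow> f v \<bullet> v \<le> f w \<bullet> w"
    using continuous_attains_sup[OF comp ne' cont] by blast
  define r where "r = f w \<bullet> w"
  have wS: "w \<in> S" and nw: "norm w = 1" using w by auto
  have ww: "w \<bullet> w = 1" using nw by (simp add: norm_eq_1)
  have q: "f v \<bullet> v \<le> r * (v \<bullet> v)" if "v \<in> S" for v
  proof (cases "v = 0")
    case False
    have "v /\<^sub>R norm v \<in> ?C" using that False S by (simp add: subspace_scale)
    from max[OF this] have "(f v \<bullet> v) / (norm v)\<^sup>2 \<le> r"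
      by (simp add: r_def scale power2_eq_square divide_simps)
    then show ?thesis using False by (simp add: divide_simps power2_norm_eq_inner mult.commute)
  qed (simp add: r_def)
  \<comment> \<open>A maximum point of the Rayleigh quotient is critical:
    \<open>r |y|^2 - f y \<bullet> y\<close> is nonnegative on \<open>S\<close> and vanishes at
    \<open>w\<close>, so its first variation at \<open>w\<close> is 0 in every direction of
    \<open>S\<close>.\<close>
  have b0: "(f w - r *\<^sub>R w) \<bullet> v = 0" if v: "v \<in> S" for v
  proof -
    define b where "b = r * (w \<bullet> v) - f w \<bullet> v"
    define c where "c = r * (v \<bullet> v) - f v \<bullet> v"
    have *: "0 \<le> 2 * e * b + e\<^sup>2 * c" for e
    proof -
      have "w + e *\<^sub>R v \<in> S" using wS v S by (simp add: subspace_add subspace_scale)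
      from q[OF this] have "f (w + e *\<^sub>R v) \<bullet> (w + e *\<^sub>R v) \<le> r * ((w + e *\<^sub>R v) \<bullet> (w + e *\<^sub>R v))" .
      moreover have "f v \<bullet> w = f w \<bullet> v" using sa[OF v wS] by (simp add: inner_commute)
      ultimately show ?thesis
        unfolding b_def c_def using ww r_def
        by (simp add: add scale inner_add_left inner_add_right algebra_simps power2_eq_square inner_commute)
    qed
    have c0: "c \<ge> 0" using q[OF v] by (simp add: c_def)
    have "b = 0"
    proof (rule ccontr)
      assume "b \<noteq> 0"
      \<comment> \<open>The quadratic is minimal at \<open>e = - b / c\<close>; adding 1 to the
        denominator covers \<open>c = 0\<close> and still gives a negative value.\<close>
      have "0 \<le> 2 * (- b / (c + 1)) * b + (- b / (c + 1))\<^sup>2 * c" by (rule *)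
      also have "\<dots> = - (b\<^sup>2 * (c + 2) / (c + 1)\<^sup>2)"
        using c0 by (simp add: divide_simps power2_eq_square) (simp add: algebra_simps)
      also have "\<dots> < 0" using c0 \<open>b \<noteq> 0\<close> by (simp add: divide_simps)
      finally show False by simp
    qed
    then show ?thesis by (simp add: b_def inner_diff_left)
  qed
  have "f w - r *\<^sub>R w \<in> S" using inv[OF wS] wS S by (simp add: subspace_diff subspace_scale)
  from b0[OF this] have "f w = r *\<^sub>R w" by simp
  then show thesis using that wS nw by blast
qed

text \<open>Induction on the dimension: split off one eigenvector; by self-adjointness its
  orthogonal complement in \<open>S\<close> is invariant again. The version on a subspace is needed
  because the Weingarten map is known to be self-adjoint only on the tangent space.\<close>

lemma selfadjoint_orthonormal_eigenbasis:
  fixes f :: "'a::euclidean_space \<Rightarrow> 'a"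
  assumes "subspace S" and lin: "linear f" and "\<And>w. w \<in> S \<Longrightarrow> f w \<in> S"
    and "\<And>v w. v \<in> S \<Longrightarrow> w \<in> S \<Longrightarrow> f v \<bullet> w = v \<bullet> f w"
  shows "\<exists>B k. B \<subseteq> S \<and> pairwise orthogonal B \<and> (\<forall>b\<in>B. norm b = 1) \<and> span B = S \<and> finite B
      \<and> card B = dim S \<and> (\<forall>b\<in>B. f b = k b *\<^sub>R b)"
    using assms
  proof (induction "dim S" arbitrary: S rule: less_induct)
    case less
    note S = less.prems(1) and inv = less.prems(3) and sa = less.prems(4)
    show ?case
    proof (cases "S = {0}")
      case True
      then show ?thesis by (intro exI[of _ "{}"]) (auto simp: pairwise_def)
    next
      case False
      obtain w r where w: "w \<in> S" "norm w = 1" "f w = r *\<^sub>R w"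
        using selfadjoint_rayleigh_eigenvector[OF S lin inv sa False] by metis
      define S' where "S' = {v \<in> S. v \<bullet> w = 0}"
      have ww: "w \<bullet> w = 1" using w by (simp add: norm_eq_1)
      have S': "subspace S'" using S
        unfolding S'_def subspace_def by (auto simp: inner_add_left)
      have wS': "w \<notin> S'" using ww by (simp add: S'_def)
      have "S' \<subset> S" using w(1) wS' unfolding S'_def by blast
      then have dl: "dim S' < dim S"
        using S S' by (metis dim_psubset span_eq_iff)
      have inv': "f v \<in> S'" if "v \<in> S'" for v
        using that inv[of v] sa[of v w] w by (auto simp: S'_def)
      have sa': "f v \<bullet> u = v \<bullet> f u" if "v \<in> S'" "u \<in> S'" for v u
        using that sa by (simp add: S'_def)
      obtain B k where B: "B \<subseteq> S'" "pairwise orthogonal B" "\<forall>b\<in>B. norm b = 1" "span B = S'"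
        "finite B" "card B = dim S'" "\<forall>b\<in>B. f b = k b *\<^sub>R b"
        using less.hyps[OF dl S' lin inv' sa'] by blast
      have wB: "w \<notin> B" using B(1) wS' by auto
      have po: "pairwise orthogonal (insert w B)"
        using B(1,2) by (auto simp: pairwise_insert orthogonal_def S'_def inner_commute)
      have sp: "span (insert w B) = S"
      proof
        have "insert w B \<subseteq> S" using B(1) w(1) by (auto simp: S'_def)
        then show "span (insert w B) \<subseteq> S" using S by (simp add: span_minimal)
        show "S \<subseteq> span (insert w B)"
        proof
          fix v assume v: "v \<in> S"
          have "v - (v \<bullet> w) *\<^sub>R w \<in> S'" using v w S ww
            by (simp add: S'_def subspace_diff subspace_scale inner_diff_left)
          then have "v - (v \<bullet> w) *\<^sub>R w \<in> span B" using B by simp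
          then show "v \<in> span (insert w B)"
            by (auto simp: span_insert)
        qed
      qed
      have no: "\<forall>b\<in>insert w B. norm b = 1" using B w by auto
      have "0 \<notin> insert w B" using no by force
      then have "independent (insert w B)" using po by (simp add: pairwise_orthogonal_independent)
      then have cd: "card (insert w B) = dim S" using sp
        by (metis dim_eq_card dim_span)
      show ?thesis
        by (rule exI[of _ "insert w B"], rule exI[of _ "k(w := r)"])
           (use po sp no cd B w wB in \<open>auto simp: S'_def\<close>)
    qed
  qed

text \<open>The bridge from \<open>eigenvalues_on\<close>, which counts dimensions of eigenspaces,
  to an eigenbasis: comparing coefficients shows that the eigenspace of \<open>r\<close> is spanned
  by the basis vectors with \<open>k b = r\<close>.\<close>

lemma eigenvalues_on_orthonormal_eigenbasis:
  fixes f :: "'a::euclidean_space \<Rightarrow> 'a"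
  assumes lin: "linear f" and po: "pairwise orthogonal B" and no: "\<And>b. b \<in> B \<Longrightarrow> norm b = 1"
    and fin: "finite B" and ev: "\<And>b. b \<in> B \<Longrightarrow> f b = k b *\<^sub>R b"
  shows "eigenvalues_on (span B) f = image_mset k (mset_set B)"
proof -
  interpret linear f by fact
  have "0 \<notin> B" using no by force
  then have ind: "independent B" using po by (simp add: pairwise_orthogonal_independent)
  have fexp: "f w = (\<Sum>b\<in>B. (k b * (w \<bullet> b)) *\<^sub>R b)" if w: "w \<in> span B" for w
  proof -
    have "f w = f (\<Sum>b\<in>B. (w \<bullet> b) *\<^sub>R b)" using orthonormal_basis_expand[OF po no w fin] by simp
    also have "\<dots> = (\<Sum>b\<in>B. (k b * (w \<bullet> b)) *\<^sub>R b)"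
      by (simp add: sum scale ev mult.commute)
    finally show ?thesis .
  qed
  have ib: "(\<Sum>b\<in>B. c b *\<^sub>R b) \<bullet> b' = c b'" if "b' \<in> B" for c b'
  proof -
    have "(\<Sum>b\<in>B. c b *\<^sub>R b) \<bullet> b' = (\<Sum>b\<in>B. if b = b' then c b else 0)"
      unfolding inner_sum_left
      by (rule sum.cong) (use po no that in \<open>auto simp: pairwise_def orthogonal_def norm_eq_1\<close>)
    then show ?thesis using that fin by simp
  qed
  have esp: "{w \<in> span B. f w = r *\<^sub>R w} = span {b \<in> B. k b = r}" for r
  proof
    show "span {b \<in> B. k b = r} \<subseteq> {w \<in> span B. f w = r *\<^sub>R w}"
    proof (rule span_minimal)
      show "{b \<in> B. k b = r} \<subseteq> {w \<in> span B. f w = r *\<^sub>R w}"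
        using ev by (auto simp: span_base)
      show "subspace {w \<in> span B. f w = r *\<^sub>R w}"
        unfolding subspace_def
        by (auto simp: span_0 span_add span_scale zero add scale scaleR_add_right mult.commute)
    qed
    show "{w \<in> span B. f w = r *\<^sub>R w} \<subseteq> span {b \<in> B. k b = r}"
    proof
      fix w assume "w \<in> {w \<in> span B. f w = r *\<^sub>R w}"
      then have w: "w \<in> span B" "f w = r *\<^sub>R w" by auto
      have "k b * (w \<bullet> b) = r * (w \<bullet> b)" if "b \<in> B" for b
        using fexp[OF w(1)] w(2) ib[OF that] by (metis inner_scaleR_left)
      then have 0: "w \<bullet> b = 0" if "b \<in> B" "k b \<noteq> r" for b using that by auto
      have "w = (\<Sum>b\<in>B. (w \<bullet> b) *\<^sub>R b)" using orthonormal_basis_expand[OF po no w(1) fin] by simp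
      also have "\<dots> \<in> span {b \<in> B. k b = r}"
        by (intro span_sum) (metis (mono_tags, lifting) 0 mem_Collect_eq scale_eq_0_iff span_0 span_base span_scale)
      finally show "w \<in> span {b \<in> B. k b = r}" .
    qed
  qed
  have dimr: "dim {w \<in> span B. f w = r *\<^sub>R w} = card {b \<in> B. k b = r}" for r
    unfolding esp dim_span using independent_mono[OF ind, of "{b \<in> B. k b = r}"]
    by (simp add: dim_eq_card_independent)
  have evs: "{r. \<exists>w\<in>span B. w \<noteq> 0 \<and> f w = r *\<^sub>R w} = k ` B"
  proof -
    have "(\<exists>w\<in>span B. w \<noteq> 0 \<and> f w = r *\<^sub>R w) \<longleftrightarrow> r \<in> k ` B" for r
    proof
      assume "\<exists>w\<in>span B. w \<noteq> 0 \<and> f w = r *\<^sub>R w"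
      then obtain w where "w \<in> span {b \<in> B. k b = r}" "w \<noteq> 0" using esp[of r] by blast
      then have "{b \<in> B. k b = r} \<noteq> {}" by (metis empty_iff insertE span_empty)
      then show "r \<in> k ` B" by blast
    next
      assume "r \<in> k ` B"
      then show "\<exists>w\<in>span B. w \<noteq> 0 \<and> f w = r *\<^sub>R w"
        using ev \<open>0 \<notin> B\<close> by (metis imageE span_base)
    qed
    then show ?thesis by blast
  qed
  have "eigenvalues_on (span B) f = (\<Sum>r\<in>k ` B. replicate_mset (card {b \<in> B. k b = r}) r)"
    unfolding eigenvalues_on_def evs dimr ..
  also have "\<dots> = image_mset k (mset_set B)"
  proof (rule multiset_eqI)
    fix x
    have "count (\<Sum>r\<in>k ` B. replicate_mset (card {b \<in> B. k b = r}) r) x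
        = (\<Sum>r\<in>k ` B. if r = x then card {b \<in> B. k b = x} else 0)"
      unfolding count_sum by (rule sum.cong) auto
    also have "\<dots> = card {b \<in> B. k b = x}"
    proof (cases "x \<in> k ` B")
      case False
      then have "{b \<in> B. k b = x} = {}" by auto
      then show ?thesis using False fin by simp
    qed (use fin in simp)
    also have "\<dots> = count (image_mset k (mset_set B)) x"
      using fin by (simp add: count_image_mset_eq_card_vimage)
    finally show "count (\<Sum>r\<in>k ` B. replicate_mset (card {b \<in> B. k b = r}) r) x
        = count (image_mset k (mset_set B)) x" .
  qed
  finally show ?thesis .
qed

lemma orthonormal_hyperplane_basis:
  fixes n :: "'a::euclidean_space"
  assumes n: "norm n = 1"
  obtains B where "pairwise orthogonal (insert n B)" "\<And>b. b \<in> insert n B \<Longrightarrow> norm b = 1"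
    "n \<notin> B" "finite B" "card B = DIM('a) - 1" "span (insert n B) = UNIV"
proof -
  have s: "subspace {w. w \<bullet> n = 0}" by (auto simp: subspace_def inner_add_left)
  \<comment> \<open>Every vector is an eigenvector of the identity, so an eigenbasis of it is just
    an orthonormal basis of the hyperplane.\<close>
  obtain B k where B: "B \<subseteq> {w. w \<bullet> n = 0}" "pairwise orthogonal B" "\<And>b. b \<in> B \<Longrightarrow> norm b = 1"
    "span B = {w. w \<bullet> n = 0}" "finite B" "card B = dim {w. w \<bullet> n = 0}"
    using selfadjoint_orthonormal_eigenbasis[OF s linear_id] by auto
  have nn: "n \<bullet> n = 1" using n by (simp add: norm_eq_1)
  have po: "pairwise orthogonal (insert n B)"
    using B(1,2) by (auto simp: pairwise_insert orthogonal_def inner_commute)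
  have "v \<in> span (insert n B)" for v
  proof -
    have "v - (v \<bullet> n) *\<^sub>R n \<in> span B" using nn by (simp add: B inner_diff_left)
    then show ?thesis by (auto simp: span_insert)
  qed
  then have sp: "span (insert n B) = UNIV" by auto
  have nB: "n \<notin> B" using B(1) nn by auto
  have "dim {w. w \<bullet> n = 0} = DIM('a) - 1"
    using dim_hyperplane[of n] n by (metis (no_types, lifting) Collect_cong inner_commute norm_zero zero_neq_one)
  then show thesis using that[of B] po B n nB sp by auto
qed

text \<open>The Hessians of all barriers are of this form up to normalizing \<open>n\<close>, so the
  Pucci operators are never evaluated on a general symmetric matrix.\<close>

lemma eigenvalues_rank_one:
  fixes X :: "real^'n^'n"
  assumes n: "norm n = 1" and X: "\<And>w. X *v w = a *\<^sub>R w + (b * (n \<bullet> w)) *\<^sub>R n"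
  shows "eigenvalues X = add_mset (a + b) (replicate_mset (CARD('n) - 1) a)"
proof -
  obtain B where B: "pairwise orthogonal (insert n B)" "\<And>b. b \<in> insert n B \<Longrightarrow> norm b = 1"
    "n \<notin> B" "finite B" "card B = CARD('n) - 1" "span (insert n B) = UNIV"
    using orthonormal_hyperplane_basis[OF n] by auto
  have nn: "n \<bullet> n = 1" using n by (simp add: norm_eq_1)
  have "eigenvalues X = image_mset (\<lambda>w. if w = n then a + b else a) (mset_set (insert n B))"
    unfolding eigenvalues_def B(6)[symmetric]
  proof (rule eigenvalues_on_orthonormal_eigenbasis)
    fix w assume w: "w \<in> insert n B"
    show "X *v w = (if w = n then a + b else a) *\<^sub>R w"
    proof (cases "w = n")
      case False
      then have "n \<bullet> w = 0" using w B(1) by (auto simp: pairwise_insert orthogonal_def)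
      then show ?thesis using False by (simp add: X)
    qed (simp add: X nn scaleR_add_left)
  qed (use B in auto)
  also have "\<dots> = add_mset (a + b) (image_mset (\<lambda>w. if w = n then a + b else a) (mset_set B))"
    using B by simp
  also have "image_mset (\<lambda>w. if w = n then a + b else a) (mset_set B) = image_mset (\<lambda>w. a) (mset_set B)"
    by (rule image_mset_cong) (use B in auto)
  finally show ?thesis using B by (simp add: image_mset_const_eq)
qed

lemma filter_mset_replicate_mset:
  "filter_mset P (replicate_mset m a) = (if P a then replicate_mset m a else {#})"
  by (induction m) auto

text \<open>A zero eigenvalue lies in neither sum of the operators; the conditionals treat it like a
  positive one, which contributes 0 as well.\<close>

lemma pucci_rank_one:
  fixes X :: "real^'n^'n"
  assumes "norm n = 1" and "\<And>w. X *v w = a *\<^sub>R w + (b * (n \<bullet> w)) *\<^sub>R n"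
  shows "pucci_minus lam Lam X =
      (if a + b < 0 then Lam else lam) * (a + b) + real (CARD('n) - 1) * ((if a < 0 then Lam else lam) * a)"
    and "pucci_plus lam Lam X =
      (if a + b < 0 then lam else Lam) * (a + b) + real (CARD('n) - 1) * ((if a < 0 then lam else Lam) * a)"
proof -
  note ev = eigenvalues_rank_one[OF assms]
  have *: "a * l + b * l = 0" "l * a + l * b = 0" if "a + b = 0" for l :: real
    using that by (simp_all flip: distrib_right distrib_left)
  show "pucci_minus lam Lam X =
      (if a + b < 0 then Lam else lam) * (a + b) + real (CARD('n) - 1) * ((if a < 0 then Lam else lam) * a)"
    "pucci_plus lam Lam X =
      (if a + b < 0 then lam else Lam) * (a + b) + real (CARD('n) - 1) * ((if a < 0 then lam else Lam) * a)"
    unfolding pucci_minus_def pucci_plus_def ev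
    by (auto simp: filter_mset_replicate_mset sum_mset_replicate_mset algebra_simps *)
qed

subsection \<open>The complementary error function\<close>

lemma set_integrable_exp_neg_square:
  assumes "A \<in> sets borel" shows "set_integrable lborel A (\<lambda>s::real. exp (- (s\<^sup>2)))"
proof -
  have "integrable lborel (\<lambda>x::real. normal_density 0 (1/sqrt 2) x * sqrt pi)"
    by (intro integrable_mult_left) simp
  moreover have "normal_density 0 (1/sqrt 2) x * sqrt pi = exp (- (x\<^sup>2))" for x
    by (simp add: normal_density_def power_divide)
  ultimately have "integrable lborel (\<lambda>x::real. exp (- (x\<^sup>2)))" by simp
  then have "set_integrable lborel UNIV (\<lambda>x::real. exp (- (x\<^sup>2)))"
    by (simp add: set_integrable_def)
  then show ?thesis by (rule set_integrable_subset) (use assms in auto)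
qed

lemma Erfc_nonneg: "0 \<le> Erfc \<sigma>"
proof -
  have "0 \<le> (LINT s:{\<sigma><..}|lborel. exp (- (s\<^sup>2)))"
    unfolding set_lebesgue_integral_def by (rule Bochner_Integration.integral_nonneg) simp
  then show ?thesis unfolding Erfc_def by simp
qed

text \<open>Replaces the improper integral by one over a compact interval, from which derivative,
  monotonicity and the limit at infinity are read off.\<close>

lemma Erfc_diff:
  assumes "a \<le> b"
  shows "Erfc a - Erfc b = 2 / sqrt pi * integral {a..b} (\<lambda>s. exp (- (s\<^sup>2)))"
proof -
  have u: "{a<..} = {a<..b} \<union> {b<..}" using assms by auto
  have "(LINT s:{a<..}|lborel. exp (- (s\<^sup>2)))
      = (LINT s:{a<..b}|lborel. exp (- (s\<^sup>2))) + (LINT s:{b<..}|lborel. exp (- (s\<^sup>2)))"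
    unfolding u by (rule set_integral_Un) (auto intro: set_integrable_exp_neg_square)
  also have "(LINT s:{a<..b}|lborel. exp (- (s\<^sup>2))) = integral {a<..b} (\<lambda>s. exp (- (s\<^sup>2)))"
    by (rule set_borel_integral_eq_integral) (simp add: set_integrable_exp_neg_square)
  also have "\<dots> = integral {a..b} (\<lambda>s. exp (- (s\<^sup>2)))"
    by (rule integral_spike_set; rule negligible_subset[of "{a}"]) auto
  finally show ?thesis unfolding Erfc_def by (simp add: algebra_simps)
qed

lemma Erfc_0 [simp]: "Erfc 0 = 1"
proof -
  have "(LINT s:{0<..}|lborel. exp (- (s\<^sup>2))) = (LINT s:{0..}|lborel. exp (- (s::real)\<^sup>2))"
    unfolding set_lebesgue_integral_def
  proof (rule integral_cong_AE)
    show "AE s::real in lborel. indicat_real {0<..} s *\<^sub>R exp (- (s\<^sup>2)) = indicat_real {0..} s *\<^sub>R exp (- (s\<^sup>2))"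
      using AE_lborel_singleton[of "0::real"] by eventually_elim (auto simp: indicator_def)
  qed simp_all
  also have "\<dots> = sqrt pi / 2"
    using gaussian_moment_0 unfolding set_lebesgue_integral_def
    by (simp add: has_bochner_integral_integral_eq)
  finally show ?thesis by (simp add: Erfc_def)
qed

lemma Erfc_has_real_derivative [derivative_intros]:
  assumes "(g has_field_derivative g') (at x within S)"
  shows "((\<lambda>x. Erfc (g x)) has_field_derivative (- 2 / sqrt pi * exp (- ((g x)\<^sup>2))) * g') (at x within S)"
proof -
  have D: "(Erfc has_real_derivative (- 2 / sqrt pi * exp (- (\<sigma>\<^sup>2)))) (at \<sigma>)" for \<sigma>
  proof -
    let ?a = "\<sigma> - 1" and ?b = "\<sigma> + 1"
    have Erfc_diff': "Erfc x = Erfc ?a - 2 / sqrt pi * integral {?a..x} (\<lambda>s. exp (- (s\<^sup>2)))" if "?a < x" for x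
      using Erfc_diff[of ?a x] that by linarith
    have "((\<lambda>s. integral {?a..s} (\<lambda>s. exp (- (s\<^sup>2)))) has_real_derivative exp (- (\<sigma>\<^sup>2))) (at \<sigma> within {?a..?b})"
      by (rule integral_has_real_derivative) (auto intro!: continuous_intros)
    then have "((\<lambda>s. integral {?a..s} (\<lambda>s. exp (- (s\<^sup>2)))) has_real_derivative exp (- (\<sigma>\<^sup>2))) (at \<sigma>)"
      by (simp add: at_within_Icc_at)
    then have "((\<lambda>s. Erfc ?a - 2 / sqrt pi * integral {?a..s} (\<lambda>s. exp (- (s\<^sup>2)))) has_real_derivative
         (0 - 2 / sqrt pi * exp (- (\<sigma>\<^sup>2)))) (at \<sigma>)"
      by (intro DERIV_diff DERIV_const DERIV_cmult)
    then have "((\<lambda>s. Erfc ?a - 2 / sqrt pi * integral {?a..s} (\<lambda>s. exp (- (s\<^sup>2)))) has_real_derivative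
         (- 2 / sqrt pi * exp (- (\<sigma>\<^sup>2)))) (at \<sigma>)" by simp
    then show ?thesis
      by (rule has_field_derivative_transform_within_open[of _ _ _ "{?a<..<?b}"])
         (use Erfc_diff' in auto)
  qed
  show ?thesis using DERIV_chain2[OF D assms] by simp
qed

lemma continuous_on_Erfc [continuous_intros]:
  "continuous_on S g \<Longrightarrow> continuous_on S (\<lambda>x. Erfc (g x))"
proof -
  have "continuous_on UNIV Erfc"
    by (rule DERIV_continuous_on) (rule Erfc_has_real_derivative[OF DERIV_ident])
  then show "continuous_on S g \<Longrightarrow> continuous_on S (\<lambda>x. Erfc (g x))"
    by (rule continuous_on_compose2) auto
qed

lemma Erfc_antimono: "a \<le> b \<Longrightarrow> Erfc b \<le> Erfc a"
proof -
  assume "a \<le> b"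
  have "(\<lambda>s::real. exp (- (s\<^sup>2))) integrable_on {a..b}"
    by (intro integrable_continuous_real continuous_intros)
  then have "0 \<le> integral {a..b} (\<lambda>s. exp (- (s\<^sup>2)))" by (rule integral_nonneg) simp
  then have "0 \<le> 2 / sqrt pi * integral {a..b} (\<lambda>s. exp (- (s\<^sup>2)))" by simp
  then show ?thesis using Erfc_diff[OF \<open>a \<le> b\<close>] by linarith
qed

lemma Erfc_le_1: "0 \<le> \<sigma> \<Longrightarrow> Erfc \<sigma> \<le> 1"
  using Erfc_antimono[of 0 \<sigma>] by simp

lemma Erfc_ge_1: "\<sigma> \<le> 0 \<Longrightarrow> 1 \<le> Erfc \<sigma>"
  using Erfc_antimono[of \<sigma> 0] by simp

lemma Erfc_tendsto_0: "(Erfc \<longlongrightarrow> 0) at_top"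
proof -
  have *: "set_integrable lborel {0..} (\<lambda>s::real. exp (- (s\<^sup>2)))"
    by (rule set_integrable_exp_neg_square) simp
  have lim: "((\<lambda>\<sigma>. LINT s:{0..\<sigma>}|lborel. exp (- (s::real)\<^sup>2)) \<longlongrightarrow> (LINT s:{0..}|lborel. exp (- (s::real)\<^sup>2))) at_top"
    by (rule tendsto_set_lebesgue_integral_at_top[OF _ *]) simp
  have tot: "(LINT s:{0..}|lborel. exp (- (s::real)\<^sup>2)) = sqrt pi / 2"
    using gaussian_moment_0 unfolding set_lebesgue_integral_def
    by (simp add: has_bochner_integral_integral_eq)
  have "eventually (\<lambda>\<sigma>. Erfc \<sigma> = 1 - 2 / sqrt pi * (LINT s:{0..\<sigma>}|lborel. exp (- (s::real)\<^sup>2))) at_top"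
    using eventually_ge_at_top[of 0]
  proof eventually_elim
    case (elim \<sigma>)
    have "(LINT s:{0..\<sigma>}|lborel. exp (- (s\<^sup>2))) = integral {0..\<sigma>} (\<lambda>s. exp (- (s\<^sup>2)))"
      by (rule set_borel_integral_eq_integral) (simp add: set_integrable_exp_neg_square)
    then show ?case using Erfc_diff[OF elim] by simp
  qed
  moreover have "((\<lambda>\<sigma>. 1 - 2 / sqrt pi * (LINT s:{0..\<sigma>}|lborel. exp (- (s::real)\<^sup>2))) \<longlongrightarrow> 1 - 2 / sqrt pi * (sqrt pi / 2)) at_top"
    using lim unfolding tot by (intro tendsto_intros)
  ultimately show ?thesis by (simp add: filterlim_cong)
qed

subsection \<open>Classical sub- and supersolutions\<close>

lemma gradient_eqI:
  assumes "(f has_derivative (\<lambda>h. g \<bullet> h)) (at x)"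
  shows "gradient f x = g"
  unfolding gradient_def frechet_derivative_at[OF assms, symmetric]
  by (simp add: vec_eq_iff inner_axis)

lemma hessian_eqI:
  assumes "\<And>y. (f has_derivative (\<lambda>h. G y \<bullet> h)) (at y)"
    and "(G has_derivative (\<lambda>h. X *v h)) (at x)"
  shows "hessian f x = X"
proof -
  have "gradient f = G" using gradient_eqI[OF assms(1)] by auto
  then show ?thesis unfolding hessian_def
    using frechet_derivative_at[OF assms(2)] by (metis matrix_of_matrix_vector_mul)
qed

text \<open>The spatial derivatives are required at every \<open>y\<close>, not only inside
  \<open>U\<close>: \<open>hessian\<close> differentiates the function \<open>gradient f\<close>, so
  the gradient has to be identified as a function before it is differentiated.\<close>

lemma C21_onI:
  fixes f :: "(real^'n) \<times> real \<Rightarrow> real"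
  assumes fG: "\<And>y t. t \<in> snd ` U \<Longrightarrow> ((\<lambda>y. f (y, t)) has_derivative (\<lambda>h. G (y, t) \<bullet> h)) (at y)"
    and GX: "\<And>y t. t \<in> snd ` U \<Longrightarrow> ((\<lambda>y. G (y, t)) has_derivative (\<lambda>h. X (y, t) *v h)) (at y)"
    and fD: "\<And>y t. t \<in> snd ` U \<Longrightarrow> ((\<lambda>s. f (y, s)) has_real_derivative D (y, t)) (at t)"
    and cont: "continuous_on U f" "continuous_on U G" "continuous_on U X" "continuous_on U D"
  shows "C21_on U f" and "\<And>p. p \<in> U \<Longrightarrow> space_hessian f p = X p" and "\<And>p. p \<in> U \<Longrightarrow> time_deriv f p = D p"
proof -
  have grad: "gradient (\<lambda>y. f (y, t)) = (\<lambda>y. G (y, t))" if "t \<in> snd ` U" for t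
    using gradient_eqI[OF fG[OF that]] by auto
  have g: "space_gradient f p = G p" if "p \<in> U" for p
    using grad[of "snd p"] that unfolding space_gradient_def by simp
  show h: "space_hessian f p = X p" if "p \<in> U" for p
    unfolding space_hessian_def
    using hessian_eqI[OF fG GX, of "snd p"] that by simp
  show d: "time_deriv f p = D p" if "p \<in> U" for p
    unfolding time_deriv_def using fD[of "snd p" "fst p"] that by (simp add: DERIV_imp_deriv)
  show "C21_on U f" unfolding C21_on_def
  proof (intro conjI ballI)
    fix p assume "p \<in> U"
    moreover obtain x t where p: "p = (x, t)" by (cases p)
    ultimately have t: "t \<in> snd ` U" by force
    have "(\<lambda>s. f (x, s)) differentiable at t" using fD[OF t] by (auto simp: real_differentiable_def)
    then show "case p of (x, t) \<Rightarrow> (\<lambda>y. f (y, t)) differentiable at x \<and>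
       gradient (\<lambda>y. f (y, t)) differentiable at x \<and> (\<lambda>s. f (x, s)) differentiable at t"
      unfolding p using fG[OF t] GX[OF t] grad[OF t] by (auto simp: differentiable_def)
  qed (use cont g h d in \<open>auto cong: continuous_on_cong\<close>)
qed

section \<open>Comparison of viscosity solutions with explicit barriers\<close>

definition rank_one_matrix :: "real \<Rightarrow> real \<Rightarrow> real^'n \<Rightarrow> real^'n^'n" where
  "rank_one_matrix a b n = (\<chi> i j. (if i = j then a else 0) + b * n $ i * n $ j)"

lemma rank_one_matrix_mult: "rank_one_matrix a b n *v w = a *\<^sub>R w + (b * (n \<bullet> w)) *\<^sub>R n"
proof -
  have "(\<Sum>j\<in>UNIV. ((if i = j then a else 0) + b * n $ i * n $ j) * w $ j)
      = (\<Sum>j\<in>UNIV. if i = j then a * w $ j else 0) + (\<Sum>j\<in>UNIV. b * n $ i * (n $ j * w $ j))" for i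
    unfolding sum.distrib[symmetric] by (rule sum.cong) (auto simp: algebra_simps)
  then show ?thesis
    by (simp add: rank_one_matrix_def matrix_vector_mult_def vec_eq_iff inner_vec_def sum_distrib_left mult_ac)
qed

lemma continuous_on_rank_one_matrix [continuous_intros]:
  assumes "continuous_on S a" "continuous_on S b" "continuous_on S n"
  shows "continuous_on S (\<lambda>p. rank_one_matrix (a p) (b p) (n p))"
proof -
  have "continuous_on S (\<lambda>p. if i = j then a p else 0)" for i j :: 'n
    using assms(1) by (cases "i = j") auto
  then show ?thesis
    unfolding rank_one_matrix_def using assms by (intro continuous_intros) auto
qed

text \<open>If \<open>v - f\<close> had a positive maximum over \<open>K\<close>, it would be
  attained in \<open>U\<close>, and there \<open>f\<close> itself is an admissible test function
  that contradicts strictness. Test functions touch on open sets of space-time, so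
  \<open>K - U\<close> has to contain the final time slice as well.\<close>

lemma viscosity_subsolution_le:
  assumes sub: "viscosity_subsolution F Q v" and K: "compact K" "continuous_on K v" "continuous_on K f"
    and U: "open U" "U \<subseteq> Q" "U \<subseteq> K" and bd: "\<And>p. p \<in> K - U \<Longrightarrow> v p \<le> f p"
    and C: "C21_on U f" and strict: "\<And>p. p \<in> U \<Longrightarrow> f p < v p \<Longrightarrow> time_deriv f p - F (space_hessian f p) > 0"
    and p: "p \<in> K"
  shows "v p \<le> f p"
proof (rule ccontr)
  assume "\<not> v p \<le> f p"
  have "continuous_on K (\<lambda>p. v p - f p)" using K by (intro continuous_intros)
  then obtain p0 where p0: "p0 \<in> K" "\<And>p'. p' \<in> K \<Longrightarrow> v p' - f p' \<le> v p0 - f p0"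
    using continuous_attains_sup[OF K(1)] p by blast
  have "f p0 < v p0" using p0(2)[OF p] \<open>\<not> v p \<le> f p\<close> by linarith
  then have "p0 \<in> U" using bd[of p0] p0(1) by force
  then have "time_deriv f p0 - F (space_hessian f p0) \<le> 0"
    using sub U C p0(2) unfolding viscosity_subsolution_def by blast
  with strict[OF \<open>p0 \<in> U\<close> \<open>f p0 < v p0\<close>] show False by simp
qed

lemma viscosity_supersolution_ge:
  assumes sub: "viscosity_supersolution F Q v" and K: "compact K" "continuous_on K v" "continuous_on K f"
    and U: "open U" "U \<subseteq> Q" "U \<subseteq> K" and bd: "\<And>p. p \<in> K - U \<Longrightarrow> f p \<le> v p"
    and C: "C21_on U f" and strict: "\<And>p. p \<in> U \<Longrightarrow> v p < f p \<Longrightarrow> time_deriv f p - F (space_hessian f p) < 0"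
    and p: "p \<in> K"
  shows "f p \<le> v p"
proof (rule ccontr)
  assume "\<not> f p \<le> v p"
  have "continuous_on K (\<lambda>p. v p - f p)" using K by (intro continuous_intros)
  then obtain p0 where p0: "p0 \<in> K" "\<And>p'. p' \<in> K \<Longrightarrow> v p' - f p' \<ge> v p0 - f p0"
    using continuous_attains_inf[OF K(1)] p by blast
  have "v p0 < f p0" using p0(2)[OF p] \<open>\<not> f p \<le> v p\<close> by linarith
  then have "p0 \<in> U" using bd[of p0] p0(1) by force
  then have "time_deriv f p0 - F (space_hessian f p0) \<ge> 0"
    using sub U C p0(2) unfolding viscosity_supersolution_def by blast
  with strict[OF \<open>p0 \<in> U\<close> \<open>v p0 < f p0\<close>] show False by simp
qed

text \<open>For positive \<open>k\<close> and \<open>C\<close> it is at least 1 on the sphere of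
  radius \<open>d\<close> around \<open>y0\<close> at all times \<open>\<ge> 0\<close>, and
  everywhere from time \<open>d^2 / C\<close> on, so \<open>v \<le> 1\<close> suffices there; at the
  centre it is exponentially small for small times.\<close>

definition exp_barrier :: "real \<Rightarrow> real \<Rightarrow> real \<Rightarrow> real^'n \<Rightarrow> (real^'n) \<times> real \<Rightarrow> real" where
  "exp_barrier k C d y0 p = exp (k * ((norm (fst p - y0))\<^sup>2 + C * snd p - d\<^sup>2))"

lemma exp_barrier_C21:
  fixes y0 :: "real^'n"
  shows "C21_on U (exp_barrier k C d y0)"
    and "p \<in> U \<Longrightarrow> space_hessian (exp_barrier k C d y0) p =
      rank_one_matrix (2 * k * exp_barrier k C d y0 p) (4 * k\<^sup>2 * exp_barrier k C d y0 p) (fst p - y0)"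
    and "p \<in> U \<Longrightarrow> time_deriv (exp_barrier k C d y0) p = k * C * exp_barrier k C d y0 p"
proof -
  let ?f = "exp_barrier k C d y0"
  let ?G = "\<lambda>p. (2 * k * ?f p) *\<^sub>R (fst p - y0)"
  let ?X = "\<lambda>p. rank_one_matrix (2 * k * ?f p) (4 * k\<^sup>2 * ?f p) (fst p - y0)"
  let ?D = "\<lambda>p. k * C * ?f p"
  have 1: "((\<lambda>y. ?f (y, t)) has_derivative (\<lambda>h. ?G (y, t) \<bullet> h)) (at y)" for y t
    unfolding exp_barrier_def power2_norm_eq_inner
    by (auto intro!: derivative_eq_intros simp: inner_commute algebra_simps)
  have 2: "((\<lambda>y. ?G (y, t)) has_derivative (\<lambda>h. ?X (y, t) *v h)) (at y)" for y t
  proof -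
    have "((\<lambda>y. (2 * k * ?f (y, t)) *\<^sub>R (y - y0)) has_derivative
       (\<lambda>h. (2 * k * ?f (y, t)) *\<^sub>R h + (2 * k * (?G (y, t) \<bullet> h)) *\<^sub>R (y - y0))) (at y)"
      by (auto intro!: derivative_eq_intros 1)
    then show ?thesis
      unfolding rank_one_matrix_mult by (simp add: power2_eq_square mult_ac)
  qed
  have 3: "((\<lambda>s. ?f (y, s)) has_real_derivative ?D (y, t)) (at t)" for y t
    unfolding exp_barrier_def by (auto intro!: derivative_eq_intros)
  have c: "continuous_on U ?f" unfolding exp_barrier_def by (intro continuous_intros)
  note * = C21_onI[of U ?f ?G ?X ?D, OF 1 2 3]
  have cc: "continuous_on U ?G" "continuous_on U ?X" "continuous_on U ?D"
    by (intro continuous_intros c)+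
  show "C21_on U ?f" using *(1) c cc by blast
  show "p \<in> U \<Longrightarrow> space_hessian ?f p = ?X p" using *(2) c cc by blast
  show "p \<in> U \<Longrightarrow> time_deriv ?f p = ?D p" using *(3) c cc by blast
qed

text \<open>The coefficient \<open>c\<close> is positive for supersolutions and negative for subsolutions.\<close>

definition flat_barrier :: "real \<Rightarrow> real^'n \<Rightarrow> real \<Rightarrow> real \<Rightarrow> real \<Rightarrow> real^'n \<Rightarrow> real \<Rightarrow> (real^'n) \<times> real \<Rightarrow> real" where
  "flat_barrier l n b c C y0 \<delta> p =
     Erfc ((fst p \<bullet> n - b) / (2 * sqrt (l * snd p))) + c * ((norm (fst p - y0))\<^sup>2 + C * snd p) + \<delta>"

text \<open>The second derivative in direction \<open>n\<close> of the Erfc part of the barrier.\<close>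

definition flat_curv :: "real \<Rightarrow> real^'n \<Rightarrow> real \<Rightarrow> (real^'n) \<times> real \<Rightarrow> real" where
  "flat_curv l n b p = exp (- (((fst p \<bullet> n - b) / (2 * sqrt (l * snd p)))\<^sup>2)) *
      ((fst p \<bullet> n - b) / (2 * sqrt (l * snd p))) / (sqrt pi * l * snd p)"

lemma flat_curv_nonneg:
  assumes "0 < l" "0 < snd p" "0 \<le> (fst p \<bullet> n - b) / (2 * sqrt (l * snd p))"
  shows "0 \<le> flat_curv l n b p"
  unfolding flat_curv_def
  by (intro divide_nonneg_nonneg mult_nonneg_nonneg assms(3)) (use assms(1,2) in auto)

text \<open>The Erfc part solves the heat equation with diffusivity \<open>l\<close> in the single
  direction \<open>n\<close>. Hence \<open>l * flat_curv\<close> cancels when \<open>F\<close> is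
  subtracted from the time derivative, and only the paraboloid decides the sign.\<close>

lemma flat_barrier_C21:
  fixes y0 :: "real^'n"
  assumes l: "l > 0" and U: "\<And>p. p \<in> U \<Longrightarrow> snd p > 0"
  shows "C21_on U (flat_barrier l n b c C y0 \<delta>)"
    and "p \<in> U \<Longrightarrow> space_hessian (flat_barrier l n b c C y0 \<delta>) p = rank_one_matrix (2 * c) (flat_curv l n b p) n"
    and "p \<in> U \<Longrightarrow> time_deriv (flat_barrier l n b c C y0 \<delta>) p = l * flat_curv l n b p + c * C"
proof -
  let ?f = "flat_barrier l n b c C y0 \<delta>"
  let ?\<xi> = "\<lambda>p. (fst p \<bullet> n - b) / (2 * sqrt (l * snd p))"
  let ?e = "\<lambda>p. exp (- ((?\<xi> p)\<^sup>2))"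
  let ?\<kappa> = "\<lambda>t. - 1 / (sqrt pi * sqrt (l * t))"
  let ?G = "\<lambda>p. (?e p * ?\<kappa> (snd p)) *\<^sub>R n + (2 * c) *\<^sub>R (fst p - y0)"
  let ?X = "\<lambda>p. rank_one_matrix (2 * c) (flat_curv l n b p) n"
  let ?D = "\<lambda>p. l * flat_curv l n b p + c * C"
  have xi: "((\<lambda>y. ?\<xi> (y, t)) has_derivative (\<lambda>h. (h \<bullet> n) / (2 * sqrt (l * t)))) (at y)" for y t
    unfolding divide_inverse fst_conv snd_conv by (auto intro!: derivative_eq_intros)
  have E: "((\<lambda>y. Erfc (?\<xi> (y, t))) has_derivative (\<lambda>h. (- 2 / sqrt pi * ?e (y, t)) * ((h \<bullet> n) / (2 * sqrt (l * t))))) (at y)" for y t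
  proof -
    have "(Erfc has_derivative (*) (- 2 / sqrt pi * ?e (y, t))) (at (?\<xi> (y, t)))"
      using Erfc_has_real_derivative[OF DERIV_ident, of "?\<xi> (y, t)" UNIV]
      unfolding has_field_derivative_def mult_1_right .
    from has_derivative_compose[OF xi this] show ?thesis .
  qed
  have 1: "((\<lambda>y. ?f (y, t)) has_derivative (\<lambda>h. ?G (y, t) \<bullet> h)) (at y)" if "t > 0" for y t
  proof -
    have q: "((\<lambda>y. c * ((norm (y - y0))\<^sup>2 + C * t) + \<delta>) has_derivative (\<lambda>h. c * (2 * ((y - y0) \<bullet> h)))) (at y)"
      unfolding power2_norm_eq_inner by (auto intro!: derivative_eq_intros simp: inner_commute)
    have "(\<lambda>h. (- 2 / sqrt pi * ?e (y, t)) * ((h \<bullet> n) / (2 * sqrt (l * t))) + c * (2 * ((y - y0) \<bullet> h)))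
        = (\<lambda>h. ?G (y, t) \<bullet> h)"
      by (simp add: fun_eq_iff inner_add_left inner_diff_left inner_diff_right inner_commute algebra_simps)
    with has_derivative_add[OF E[where t = t and y = y] q] show ?thesis
      by (simp only: flat_barrier_def add.assoc fst_conv snd_conv)
  qed
  have 2: "((\<lambda>y. ?G (y, t)) has_derivative (\<lambda>h. ?X (y, t) *v h)) (at y)" if t: "t > 0" for y t
  proof -
    have "((\<lambda>x::real. exp (- (x\<^sup>2))) has_real_derivative (exp (- (a\<^sup>2)) * - (2 * a))) (at a)" for a
      by (auto intro!: derivative_eq_intros)
    then have "((\<lambda>x::real. exp (- (x\<^sup>2))) has_derivative (*) (?e (y, t) * - (2 * ?\<xi> (y, t)))) (at (?\<xi> (y, t)))"
      unfolding has_field_derivative_def .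
    note e = has_derivative_mult_left[OF has_derivative_compose[OF xi this], of "?\<kappa> t"]
    have id: "((\<lambda>y. (2 * c) *\<^sub>R (y - y0)) has_derivative (\<lambda>h. (2 * c) *\<^sub>R h)) (at y)"
      by (auto intro!: derivative_eq_intros)
    have D: "((\<lambda>y. ?G (y, t)) has_derivative
       (\<lambda>h. (?e (y,t) * - (2 * ?\<xi> (y, t)) * ((h \<bullet> n) / (2 * sqrt (l * t))) * ?\<kappa> t) *\<^sub>R n + (2 * c) *\<^sub>R h)) (at y)"
      using has_derivative_add[OF has_derivative_scaleR_left[OF e, of n] id] unfolding fst_conv snd_conv .
    have "E * - (2 * \<xi>) * ((h \<bullet> n) / (2 * sqrt (l * t))) * ?\<kappa> t
        = E * \<xi> / (sqrt pi * l * t) * (n \<bullet> h)" for h E \<xi>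
    proof -
      have s: "sqrt (l * t) * sqrt (l * t) = l * t" using l t by simp
      have "E * - (2 * \<xi>) * ((h \<bullet> n) / (2 * sqrt (l * t))) * ?\<kappa> t
        = E * \<xi> * (n \<bullet> h) / (sqrt pi * (sqrt (l * t) * sqrt (l * t)))"
        by (simp only: inner_commute times_divide_eq_right times_divide_eq_left) (simp add: mult_ac)
      then show ?thesis unfolding s by (simp add: mult_ac)
    qed
    with D show ?thesis
      unfolding rank_one_matrix_mult flat_curv_def by (simp only: fst_conv snd_conv add.commute)
  qed
  have 3: "((\<lambda>s. ?f (y, s)) has_real_derivative ?D (y, t)) (at t)" if t: "t > 0" for y t
  proof -
    have lt: "l * t > 0" using l t by simp
    have "((\<lambda>s. ?\<xi> (y, s)) has_real_derivative (- ?\<xi> (y, t) / (2 * t))) (at t)"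
    proof -
      have "((\<lambda>s. sqrt (l * s)) has_real_derivative (inverse (sqrt (l * t)) / 2 * l)) (at t)"
        using DERIV_chain2[OF DERIV_real_sqrt[OF lt] DERIV_cmult[OF DERIV_ident, of l]] by simp
      note q = DERIV_divide[OF DERIV_const DERIV_cmult[OF this, of 2]]
      have nz: "2 * sqrt (l * t) \<noteq> 0" using l t by simp
      have D: "((\<lambda>s. (y \<bullet> n - b) / (2 * sqrt (l * s))) has_real_derivative
          (0 * (2 * sqrt (l * t)) - (y \<bullet> n - b) * (2 * (inverse (sqrt (l * t)) / 2 * l))) / (2 * sqrt (l * t) * (2 * sqrt (l * t)))) (at t)"
        by (rule q[OF nz])
      \<comment> \<open>With \<open>S\<close> in place of the square root and
        \<open>l * t = S * S\<close>, the claim becomes a rational identity.\<close>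
      have *: "(0 * (2 * S) - A * (2 * (inverse S / 2 * l))) / (2 * S * (2 * S)) = - (A / (2 * S)) / (2 * t)"
        if "l * t = S * S" "S > 0" for A S
      proof -
        have "l = (l * t) / t" using t by simp
        then have l': "l = S * S / t" unfolding that(1) .
        show ?thesis unfolding l' using that(2) t by (simp add: divide_simps)
      qed
      have "(0 * (2 * sqrt (l * t)) - (y \<bullet> n - b) * (2 * (inverse (sqrt (l * t)) / 2 * l))) / (2 * sqrt (l * t) * (2 * sqrt (l * t)))
          = - ((y \<bullet> n - b) / (2 * sqrt (l * t))) / (2 * t)"
        by (rule *) (use lt in auto)
      with D show ?thesis unfolding fst_conv snd_conv by simp
    qed
    from Erfc_has_real_derivative[OF this]
    have "((\<lambda>s. Erfc (?\<xi> (y, s))) has_real_derivative (- 2 / sqrt pi * ?e (y, t)) * (- ?\<xi> (y, t) / (2 * t))) (at t)" .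
    moreover have eq: "(- 2 / sqrt pi * e) * (- a / (2 * t)) = l * (e * a / (sqrt pi * l * t))" for e a
      using l t by (simp add: field_simps)
    ultimately have E: "((\<lambda>s. Erfc (?\<xi> (y, s))) has_real_derivative l * flat_curv l n b (y, t)) (at t)"
      unfolding flat_curv_def eq fst_conv snd_conv by blast
    have q: "((\<lambda>s. c * ((norm (y - y0))\<^sup>2 + C * s) + \<delta>) has_real_derivative c * C) (at t)"
      by (auto intro!: derivative_eq_intros)
    show ?thesis using DERIV_add[OF E q]
      by (simp only: flat_barrier_def add.assoc fst_conv snd_conv)
  qed
  have s0: "sqrt (l * snd p) \<noteq> 0" "sqrt pi * l * snd p \<noteq> 0" if "p \<in> U" for p using l U[OF that] by auto
  have c: "continuous_on U ?f" unfolding flat_barrier_def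
    by (intro continuous_intros) (use s0 in auto)
  have cr: "continuous_on U (flat_curv l n b)" unfolding flat_curv_def
    by (intro continuous_intros) (use s0 in auto)
  have cG: "continuous_on U ?G"
    by (intro continuous_intros) (use s0 in auto)
  have cc: "continuous_on U ?X" "continuous_on U ?D"
    by (intro continuous_intros cr)+
  have t: "t > 0" if "t \<in> snd ` U" for t using that U by auto
  have I1: "((\<lambda>y. ?f (y, t)) has_derivative (\<lambda>h. ?G (y, t) \<bullet> h)) (at y)" if "t \<in> snd ` U" for y t
    by (rule 1[OF t[OF that]])
  have I2: "((\<lambda>y. ?G (y, t)) has_derivative (\<lambda>h. ?X (y, t) *v h)) (at y)" if "t \<in> snd ` U" for y t
    by (rule 2[OF t[OF that]])
  have I3: "((\<lambda>s. ?f (y, s)) has_real_derivative ?D (y, t)) (at t)" if "t \<in> snd ` U" for y t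
    by (rule 3[OF t[OF that]])
  note * = C21_onI[of U ?f ?G ?X ?D, OF I1 I2 I3 c cG cc]
  show "C21_on U ?f" by (rule *(1))
  show "p \<in> U \<Longrightarrow> space_hessian ?f p = ?X p" by (rule *(2))
  show "p \<in> U \<Longrightarrow> time_deriv ?f p = ?D p" by (rule *(3))
qed

text \<open>
  Of a Pucci operator only its values on the Hessians of the barriers matter. Both barriers are convex
  in the relevant region up to the small paraboloid, hence only the ellipticity constant \<open>l\<close> that
  multiplies positive eigenvalues survives in the limit.
\<close>

locale pucci_solution =
  fixes F :: "real^'n^'n \<Rightarrow> real" and \<Omega> :: "(real^'n) set" and v :: "(real^'n) \<times> real \<Rightarrow> real"
    and l L :: real
  assumes sol: "is_solution F \<Omega> v" and op: "open \<Omega>" and l0: "0 < l" and lL: "l \<le> L"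
    and F_pos: "\<And>a b n. norm n = 1 \<Longrightarrow> 0 \<le> a \<Longrightarrow> 0 \<le> b \<Longrightarrow>
      F (rank_one_matrix a b n) = l * (real CARD('n) * a + b)"
    and F_ge: "\<And>a b n. norm n = 1 \<Longrightarrow> 0 \<le> a \<Longrightarrow> 0 \<le> b \<Longrightarrow>
      l * b - L * (real CARD('n) * a) \<le> F (rank_one_matrix (- a) b n)"

lemma pucci_minus_solution:
  assumes "is_solution (pucci_minus lam Lam) \<Omega> v" "open \<Omega>" "0 < lam" "lam \<le> Lam"
  shows "pucci_solution (pucci_minus lam Lam) \<Omega> v lam Lam"
proof
  fix a b :: real and n :: "real^'n"
  assume n: "norm n = 1" and a: "0 \<le> a" and b: "0 \<le> b"
  have N: "real (CARD('n) - 1) = real CARD('n) - 1" by (simp add: of_nat_diff)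
  show "pucci_minus lam Lam (rank_one_matrix a b n) = lam * (real CARD('n) * a + b)"
    unfolding pucci_rank_one(1)[OF n rank_one_matrix_mult] N using a b by (simp add: algebra_simps)
  \<comment> \<open>The eigenvalue \<open>- a + b\<close> may have either sign; because of
    \<open>lam \<le> Lam\<close> its contribution is at least \<open>lam * b - Lam * a\<close> in
    both cases.\<close>
  have "lam * b - Lam * a \<le> (if - a + b < 0 then Lam else lam) * (- a + b)"
    using mult_right_mono[OF assms(4) a] mult_right_mono[OF assms(4) b] by (auto simp: algebra_simps)
  moreover have eq: "(if - a < 0 then Lam else lam) * - a = - (Lam * a)" using a by auto
  moreover have "(real CARD('n) - 1) * - (Lam * a) = Lam * a - Lam * (real CARD('n) * a)" by (simp add: algebra_simps)
  ultimately show "lam * b - Lam * (real CARD('n) * a) \<le> pucci_minus lam Lam (rank_one_matrix (- a) b n)"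
    unfolding pucci_rank_one(1)[OF n rank_one_matrix_mult] N eq by linarith
qed (use assms in auto)

text \<open>Here both ellipticity constants are \<open>Lam\<close>: it multiplies the positive
  eigenvalues, and it is also a bound for the weight \<open>lam\<close> of the negative
  ones.\<close>

lemma pucci_plus_solution:
  assumes "is_solution (pucci_plus lam Lam) \<Omega> v" "open \<Omega>" "0 < lam" "lam \<le> Lam"
  shows "pucci_solution (pucci_plus lam Lam) \<Omega> v Lam Lam"
proof
  fix a b :: real and n :: "real^'n"
  assume n: "norm n = 1" and a: "0 \<le> a" and b: "0 \<le> b"
  have N: "real (CARD('n) - 1) = real CARD('n) - 1" by (simp add: of_nat_diff)
  show "pucci_plus lam Lam (rank_one_matrix a b n) = Lam * (real CARD('n) * a + b)"
    unfolding pucci_rank_one(2)[OF n rank_one_matrix_mult] N using a b by (simp add: algebra_simps)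
  have "Lam * b - Lam * a \<le> (if - a + b < 0 then lam else Lam) * (- a + b)"
  proof (cases "- a + b < 0")
    case True
    then have "Lam * (- a + b) \<le> lam * (- a + b)" using assms(4) by (simp add: mult_right_mono_neg)
    then show ?thesis using True by (simp add: algebra_simps)
  qed (simp add: algebra_simps)
  moreover have "- (Lam * a) \<le> (if - a < 0 then lam else Lam) * - a"
    using a assms(4) by (auto simp: mult_right_mono)
  moreover have "(real CARD('n) - 1) * (- (Lam * a)) \<le> (real CARD('n) - 1) * ((if - a < 0 then lam else Lam) * - a)"
    by (rule mult_left_mono) (use calculation(2) in auto)
  ultimately show "Lam * b - Lam * (real CARD('n) * a) \<le> pucci_plus lam Lam (rank_one_matrix (- a) b n)"
    unfolding pucci_rank_one(2)[OF n rank_one_matrix_mult] N by (simp add: algebra_simps)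
qed (use assms in auto)

section \<open>Bounds for the solution obtained from the barriers\<close>

context pucci_solution
begin

lemma N_pos: "0 < real CARD('n)" by simp

lemma L_pos: "0 < L" using l0 lL by simp

lemma v_range: "y \<in> closure \<Omega> \<Longrightarrow> 0 < t \<Longrightarrow> 0 \<le> v (y, t) \<and> v (y, t) \<le> 1"
  using sol unfolding is_solution_def by auto

lemma v_range_interior: "y \<in> \<Omega> \<Longrightarrow> 0 \<le> t \<Longrightarrow> 0 \<le> v (y, t) \<and> v (y, t) \<le> 1"
  using sol op closure_subset[of \<Omega>] unfolding is_solution_def by (auto simp: frontier_def interior_open)

lemma v_boundary: "y \<in> closure \<Omega> \<Longrightarrow> y \<notin> \<Omega> \<Longrightarrow> 0 < t \<Longrightarrow> v (y, t) = 1"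
  using sol op unfolding is_solution_def by (auto simp: frontier_def interior_open)

lemma v_initial: "y \<in> \<Omega> \<Longrightarrow> v (y, 0) = 0"
  using sol unfolding is_solution_def by auto

lemma v_continuous: "continuous_on (closure \<Omega> \<times> {0..} - frontier \<Omega> \<times> {0}) v"
  using sol unfolding is_solution_def by auto

lemma v_continuous_on: "S \<subseteq> closure \<Omega> \<times> {0<..} \<Longrightarrow> continuous_on S v"
  by (rule continuous_on_subset[OF v_continuous]) auto

text \<open>Boundary and initial values clash on the frontier at time 0, so comparisons start at a
  small positive time. On compact subsets of \<open>\<Omega>\<close>, which stay away from the
  clash, uniform continuity and the initial value 0 control \<open>v\<close> up to that
  time.\<close>

lemma v_small_initially:
  assumes M: "compact M" "M \<subseteq> \<Omega>" and \<epsilon>: "0 < \<epsilon>"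
  obtains \<tau> where "0 < \<tau>" "\<And>y s. y \<in> M \<Longrightarrow> 0 \<le> s \<Longrightarrow> s \<le> \<tau> \<Longrightarrow> v (y, s) \<le> \<epsilon>"
proof -
  have c: "compact (M \<times> {0..1::real})" using M by (simp add: compact_Times)
  have "continuous_on (M \<times> {0..1}) v"
    by (rule continuous_on_subset[OF v_continuous])
       (use M closure_subset[of \<Omega>] op in \<open>auto simp: frontier_def interior_open\<close>)
  then have "uniformly_continuous_on (M \<times> {0..1}) v" using c compact_uniformly_continuous by blast
  then obtain d where d: "d > 0" "\<And>p p'. p \<in> M \<times> {0..1} \<Longrightarrow> p' \<in> M \<times> {0..1} \<Longrightarrow> dist p' p < d \<Longrightarrow> dist (v p') (v p) < \<epsilon>"
    unfolding uniformly_continuous_on_def using \<epsilon> by metis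
  show thesis
  proof (rule that[of "min 1 (d / 2)"])
    fix y s assume y: "y \<in> M" and s: "0 \<le> s" "s \<le> min 1 (d / 2)"
    have "dist (v (y, s)) (v (y, 0)) < \<epsilon>"
      by (rule d(2)) (use y s d(1) in \<open>auto simp: dist_Pair_Pair dist_real_def\<close>)
    then show "v (y, s) \<le> \<epsilon>" using v_initial y M by (auto simp: dist_real_def)
  qed (use d in auto)
qed

text \<open>\<open>F_pos\<close> wants a unit vector, whereas the exponential barrier supplies
  \<open>y - y0\<close>; its length is moved into the coefficient. At \<open>w = 0\<close> any unit
  vector with coefficient 0 represents the same matrix.\<close>

lemma F_le: assumes "0 \<le> a" "0 \<le> b" shows "F (rank_one_matrix a b w) \<le> l * (real CARD('n) * a + b * (norm w)\<^sup>2)"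
proof (cases "w = 0")
  case True
  obtain e :: "real^'n" where "norm e = 1" using vector_choose_size[of 1] by auto
  moreover have "rank_one_matrix a b w = rank_one_matrix a 0 e" using True by (simp add: rank_one_matrix_def vec_eq_iff)
  ultimately show ?thesis using F_pos[of e a 0] assms True by simp
next
  case False
  have "rank_one_matrix a b w = rank_one_matrix a (b * (norm w)\<^sup>2) (w /\<^sub>R norm w)"
  proof -
    have "norm w * (norm w * (inverse (norm w) * inverse (norm w))) = 1" using False by (simp add: field_simps)
    then show ?thesis by (simp add: rank_one_matrix_def vec_eq_iff power2_eq_square mult_ac)
  qed
  moreover have "norm (w /\<^sub>R norm w) = 1" using False by simp
  ultimately show ?thesis using F_pos[of "w /\<^sub>R norm w" a "b * (norm w)\<^sup>2"] assms by simp
qed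

text \<open>Comparison with \<open>exp_barrier\<close> on a ball inside \<open>\<Omega>\<close>,
  with \<open>k\<close> still free. Nothing is used about the frontier, only that
  \<open>v \<le> 1\<close>.\<close>

lemma exp_bound_aux:
  assumes d: "0 < d" "cball y0 d \<subseteq> \<Omega>" and k: "0 < k" and t: "0 < t"
  shows "v (y0, t) \<le> exp (k * ((l * (2 * real CARD('n) + 4 * k * d\<^sup>2) + 1) * t - d\<^sup>2))"
proof -
  \<comment> \<open>On the ball \<open>F\<close> of the Hessian is at most
    \<open>k * f * (C - 1)\<close>, while the time derivative is \<open>k * f * C\<close>; the
    summand 1 makes the barrier strict.\<close>
  define C where "C = l * (2 * real CARD('n) + 4 * k * d\<^sup>2) + 1"
  have C0: "0 < C" unfolding C_def using l0 k by (simp add: add_pos_pos add_nonneg_pos)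
  have y0: "y0 \<in> \<Omega>" using d by auto
  show ?thesis unfolding C_def[symmetric]
  proof (cases "C * t < d\<^sup>2")
    case False
    then have "1 \<le> exp (k * (C * t - d\<^sup>2))" using k by simp
    then show "v (y0, t) \<le> exp (k * (C * t - d\<^sup>2))" using v_range_interior[OF y0, of t] t by linarith
  next
    case True
    \<comment> \<open>The time at which the barrier reaches 1 even at the centre, so that the top
      slice needs no information on \<open>v\<close>.\<close>
    define T where "T = d\<^sup>2 / C"
    have tT: "t < T" using True C0 by (simp add: T_def field_simps)
    let ?f = "exp_barrier k C d y0"
    \<comment> \<open>The bound \<open>exp (- (k * d^2))\<close> is the smallest value of the
      barrier at nonnegative times, attained at the centre at time 0.\<close>
    obtain \<tau>' where \<tau>': "0 < \<tau>'" "\<And>y s. y \<in> cball y0 d \<Longrightarrow> 0 \<le> s \<Longrightarrow> s \<le> \<tau>' \<Longrightarrow> v (y, s) \<le> exp (- (k * d\<^sup>2))"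
      using v_small_initially[OF compact_cball d(2), of "exp (- (k * d\<^sup>2))"] by auto
    define \<tau> where "\<tau> = min \<tau>' t"
    have \<tau>: "0 < \<tau>" "\<tau> \<le> t" "\<tau> < T" using \<tau>' t tT by (auto simp: \<tau>_def)
    let ?K = "cball y0 d \<times> {\<tau>..T}" and ?U = "ball y0 d \<times> {\<tau><..<T}"
    have UQ: "?U \<subseteq> \<Omega> \<times> {0<..}" using d(2) \<tau> ball_subset_cball[of y0 d] by fastforce
    have "v (y0, t) \<le> ?f (y0, t)"
    proof (rule viscosity_subsolution_le[where Q = "\<Omega> \<times> {0<..}" and K = ?K and U = ?U and F = F])
      show "viscosity_subsolution F (\<Omega> \<times> {0<..}) v"
        using sol by (simp add: is_solution_def viscosity_solution_def)
      show "compact ?K" by (simp add: compact_Times)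
      show "continuous_on ?K v"
        by (rule v_continuous_on) (use d(2) \<tau> closure_subset[of \<Omega>] in fastforce)
      show "continuous_on ?K ?f" unfolding exp_barrier_def by (intro continuous_intros)
      show "open ?U" by (simp add: open_Times)
      show "?U \<subseteq> \<Omega> \<times> {0<..}" by (rule UQ)
      show "?U \<subseteq> ?K" by auto
      show "C21_on ?U ?f" by (rule exp_barrier_C21)
      show "(y0, t) \<in> ?K" using d \<tau> tT by auto
    next
      fix p assume p: "p \<in> ?K - ?U"
      obtain y s where ys: "p = (y, s)" by (cases p)
      have y: "y \<in> \<Omega>" "dist y0 y \<le> d" and s: "\<tau> \<le> s" "s \<le> T" using p d(2) ys by auto
      have v1: "v (y, s) \<le> 1" using v_range_interior[OF y(1), of s] s \<tau> by auto
      consider "dist y0 y = d" | "s = T" | "s = \<tau>" using p ys by force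
      then show "v p \<le> ?f p"
      proof cases
        case 1
        then have "1 \<le> ?f p" using k C0 s \<tau> ys by (simp add: exp_barrier_def dist_norm norm_minus_commute)
        then show ?thesis using v1 ys by simp
      next
        case 2
        then have "1 \<le> ?f p" using k C0 ys by (simp add: exp_barrier_def T_def)
        then show ?thesis using v1 ys by simp
      next
        case 3
        have "v p \<le> exp (- (k * d\<^sup>2))" using \<tau>'(2)[of y s] y s 3 \<tau> ys by (simp add: \<tau>_def)
        also have "\<dots> \<le> ?f p" using k C0 s \<tau> ys by (simp add: exp_barrier_def right_diff_distrib)
        finally show ?thesis .
      qed
    next
      fix p assume p: "p \<in> ?U"
      obtain y s where ys: "p = (y, s)" by (cases p)
      have n: "(norm (fst p - y0))\<^sup>2 \<le> d\<^sup>2" using p ys by (auto simp: dist_norm norm_minus_commute intro!: power_mono)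
      have f0: "0 < ?f p" by (simp add: exp_barrier_def)
      have "F (space_hessian ?f p) \<le> l * (real CARD('n) * (2 * k * ?f p) + 4 * k\<^sup>2 * ?f p * (norm (fst p - y0))\<^sup>2)"
        unfolding exp_barrier_C21(2)[OF p] by (rule F_le) (use k f0 in auto)
      also have "\<dots> \<le> l * (real CARD('n) * (2 * k * ?f p) + 4 * k\<^sup>2 * ?f p * d\<^sup>2)"
        using l0 n f0 by (intro mult_left_mono add_left_mono) auto
      also have "\<dots> = k * ?f p * (C - 1)" by (simp add: C_def algebra_simps power2_eq_square)
      also have "\<dots> < k * ?f p * C" using k f0 by simp
      also have "\<dots> = time_deriv ?f p" unfolding exp_barrier_C21(3)[OF p] by simp
      finally show "0 < time_deriv ?f p - F (space_hessian ?f p)" by simp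
    qed
    also have "?f (y0, t) = exp (k * (C * t - d\<^sup>2))" by (simp add: exp_barrier_def)
    finally show "v (y0, t) \<le> exp (k * (C * t - d\<^sup>2))" .
  qed
qed

text \<open>The exponent is optimized at \<open>k = 1 / (8 * l * t)\<close>.\<close>

lemma gaussian_bound:
  assumes d: "0 < d" "cball y0 d \<subseteq> \<Omega>" and t: "0 < t"
  shows "v (y0, t) \<le> exp ((2 * real CARD('n) * l + 1) / (8 * l)) * exp (- (d\<^sup>2 / (16 * l * t)))"
proof -
  have "v (y0, t) \<le> exp (1 / (8 * l * t) * ((l * (2 * real CARD('n) + 4 * (1 / (8 * l * t)) * d\<^sup>2) + 1) * t - d\<^sup>2))"
    by (rule exp_bound_aux[OF d _ t]) (use l0 t in auto)
  also have "1 / (8 * l * t) * ((l * (2 * real CARD('n) + 4 * (1 / (8 * l * t)) * d\<^sup>2) + 1) * t - d\<^sup>2)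
     = (2 * real CARD('n) * l + 1) / (8 * l) + - (d\<^sup>2 / (16 * l * t))"
    using l0 t by (simp add: field_simps)
  finally show ?thesis by (simp only: exp_add)
qed

text \<open>
  The region where \<open>y \<bullet> n < b\<close> needs no care: there the barrier is at least 1, although it need not be a
  supersolution.
\<close>

lemma flat_upper_bound:
  assumes y0: "y0 \<in> \<Omega>" and r: "0 < r" and t: "0 < t" and n: "norm n = 1"
    and geo: "\<And>y. y \<in> cball y0 r \<Longrightarrow> y \<notin> \<Omega> \<Longrightarrow> y \<bullet> n < b"
  shows "v (y0, t) \<le> Erfc ((y0 \<bullet> n - b) / (2 * sqrt (l * t))) + (2 * L * real CARD('n) + 1) * t / r\<^sup>2"
proof (rule field_le_epsilon)
  fix \<delta> :: real assume \<delta>: "0 < \<delta>"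
  \<comment> \<open>The paraboloid adds \<open>C / r^2\<close> to the time derivative and at most
    \<open>2 * L * N / r^2\<close> to the operator, so this \<open>C\<close> gives strictness. The
    same \<open>C\<close> makes the penalty reach 1 at time \<open>r^2 / C\<close>.\<close>
  define C where "C = 2 * L * real CARD('n) + 1"
  have C0: "0 < C" unfolding C_def using L_pos by (simp add: add_nonneg_pos)
  show "v (y0, t) \<le> Erfc ((y0 \<bullet> n - b) / (2 * sqrt (l * t))) + (2 * L * real CARD('n) + 1) * t / r\<^sup>2 + \<delta>"
    unfolding C_def[symmetric]
  proof (cases "C * t < r\<^sup>2")
    case False
    then have "1 \<le> C * t / r\<^sup>2" using r by simp
    then show "v (y0, t) \<le> Erfc ((y0 \<bullet> n - b) / (2 * sqrt (l * t))) + C * t / r\<^sup>2 + \<delta>"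
      using v_range_interior[OF y0, of t] t \<delta> Erfc_nonneg[of "(y0 \<bullet> n - b) / (2 * sqrt (l * t))"] by linarith
  next
    case True
    define T where "T = r\<^sup>2 / C"
    have tT: "t < T" using True C0 by (simp add: T_def field_simps)
    let ?f = "flat_barrier l n b (1 / r\<^sup>2) C y0 \<delta>"
    \<comment> \<open>The part of the ball on or above the plane. It is a compact subset of
      \<open>\<Omega>\<close> by \<open>geo\<close>, so \<open>v \<le> \<delta>\<close> there for a
      short time, and the constant \<open>\<delta>\<close> of the barrier absorbs this.\<close>
    define M where "M = cball y0 r \<inter> {y. b \<le> y \<bullet> n}"
    have M: "compact M" "M \<subseteq> \<Omega>"
    proof -
      have "closed {y. b \<le> y \<bullet> n}" by (intro closed_Collect_le continuous_intros)
      then show "compact M" by (simp add: M_def compact_Int_closed)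
      show "M \<subseteq> \<Omega>" using geo by (force simp: M_def)
    qed
    obtain \<tau>' where \<tau>': "0 < \<tau>'" "\<And>y s. y \<in> M \<Longrightarrow> 0 \<le> s \<Longrightarrow> s \<le> \<tau>' \<Longrightarrow> v (y, s) \<le> \<delta>"
      using v_small_initially[OF M \<delta>] by auto
    define \<tau> where "\<tau> = min \<tau>' t"
    have \<tau>: "0 < \<tau>" "\<tau> \<le> t" "\<tau> < T" using \<tau>' t tT by (auto simp: \<tau>_def)
    \<comment> \<open>\<open>K - U\<close> may also contain frontier points of
      \<open>\<Omega>\<close>. There \<open>v = 1\<close>, and \<open>geo\<close> puts them below
      the plane, where the Erfc part is at least 1.\<close>
    let ?K = "(closure \<Omega> \<inter> cball y0 r) \<times> {\<tau>..T}" and ?U = "(\<Omega> \<inter> ball y0 r) \<times> {\<tau><..<T}"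
    have Upos: "snd p > 0" if "p \<in> ?U" for p using that \<tau> by auto
    note C21 = flat_barrier_C21[where U = ?U and l = l, OF l0 Upos]
    have pen: "0 \<le> 1 / r\<^sup>2 * ((norm (y - y0))\<^sup>2 + C * s)" if "0 \<le> s" for y s
      using that C0 by simp
    have "v (y0, t) \<le> ?f (y0, t)"
    proof (rule viscosity_subsolution_le[where Q = "\<Omega> \<times> {0<..}" and K = ?K and U = ?U and F = F])
      show "viscosity_subsolution F (\<Omega> \<times> {0<..}) v"
        using sol by (simp add: is_solution_def viscosity_solution_def)
      show "compact ?K" by (simp add: compact_Times closed_Int_compact)
      show "continuous_on ?K v"
        by (rule v_continuous_on) (use \<tau> in fastforce)
      show "continuous_on ?K ?f" unfolding flat_barrier_def
        by (intro continuous_intros) (use \<tau> l0 in auto)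
      show "open ?U" using op by (simp add: open_Times open_Int)
      show "?U \<subseteq> \<Omega> \<times> {0<..}" using \<tau> by auto
      show "?U \<subseteq> ?K" using closure_subset[of \<Omega>] by auto
      show "C21_on ?U ?f" by (rule C21(1))
      show "(y0, t) \<in> ?K" using y0 r \<tau> tT closure_subset[of \<Omega>] by auto
    next
      fix p assume p: "p \<in> ?K - ?U"
      obtain y s where ys: "p = (y, s)" by (cases p)
      have y: "y \<in> closure \<Omega>" "dist y0 y \<le> r" and s: "\<tau> \<le> s" "s \<le> T" "0 < s" using p ys \<tau> by auto
      have v1: "v (y, s) \<le> 1" using v_range[OF y(1) s(3)] by simp
      have f_def: "?f p = Erfc ((y \<bullet> n - b) / (2 * sqrt (l * s))) + 1 / r\<^sup>2 * ((norm (y - y0))\<^sup>2 + C * s) + \<delta>"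
        by (simp add: flat_barrier_def ys)
      have pen': "0 \<le> 1 / r\<^sup>2 * ((norm (y - y0))\<^sup>2 + C * s)" by (rule pen) (use s in auto)
      have E0: "0 \<le> Erfc ((y \<bullet> n - b) / (2 * sqrt (l * s)))" by (rule Erfc_nonneg)
      have below: "1 \<le> ?f p" if "y \<bullet> n \<le> b"
      proof -
        have "(y \<bullet> n - b) / (2 * sqrt (l * s)) \<le> 0" using that s l0 by (simp add: divide_nonpos_pos)
        then have "1 \<le> Erfc ((y \<bullet> n - b) / (2 * sqrt (l * s)))" by (rule Erfc_ge_1)
        then show ?thesis using pen' \<delta> unfolding f_def by linarith
      qed
      consider "y \<bullet> n \<le> b" | "y \<notin> \<Omega>" | "dist y0 y = r" | "s = T" | "s = \<tau>" "b \<le> y \<bullet> n" using p ys by force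
      then show "v p \<le> ?f p"
      proof cases
        case 1
        then show ?thesis using below v1 ys by simp
      next
        case 2
        then show ?thesis using below geo[of y] y v1 ys by simp
      next
        case 3
        then have "1 \<le> 1 / r\<^sup>2 * ((norm (y - y0))\<^sup>2 + C * s)" using r C0 s by (simp add: dist_norm norm_minus_commute divide_simps)
        then show ?thesis using v1 E0 \<delta> using f_def unfolding ys by linarith
      next
        case 4
        then have "1 \<le> 1 / r\<^sup>2 * ((norm (y - y0))\<^sup>2 + C * s)" using r C0 by (simp add: T_def divide_simps mult.commute)
        then show ?thesis using v1 E0 \<delta> using f_def unfolding ys by linarith
      next
        case 5
        then have "v (y, s) \<le> \<delta>" using \<tau>'(2)[of y s] y s \<tau> by (simp add: M_def \<tau>_def)
        then show ?thesis using E0 pen' using f_def unfolding ys by linarith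
      qed
    next
      fix p assume p: "p \<in> ?U" and less: "?f p < v p"
      obtain y s where ys: "p = (y, s)" by (cases p)
      have s: "0 < s" and y: "y \<in> \<Omega>" using p ys \<tau> by auto
      have v1: "v p \<le> 1" using v_range_interior[OF y, of s] s ys by simp
      have f_def: "?f p = Erfc ((y \<bullet> n - b) / (2 * sqrt (l * s))) + 1 / r\<^sup>2 * ((norm (y - y0))\<^sup>2 + C * s) + \<delta>"
        by (simp add: flat_barrier_def ys)
      have pen': "0 \<le> 1 / r\<^sup>2 * ((norm (y - y0))\<^sup>2 + C * s)" by (rule pen) (use s in auto)
      \<comment> \<open>Where the barrier lies below \<open>v \<le> 1\<close>, the argument of Erfc
        is positive. There Erfc is convex, the Hessian is nonnegative, and \<open>F\<close> takes
        the explicit value given by \<open>F_pos\<close>.\<close>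
      have "\<not> (y \<bullet> n - b) / (2 * sqrt (l * s)) \<le> 0"
      proof
        assume "(y \<bullet> n - b) / (2 * sqrt (l * s)) \<le> 0"
        then have "1 \<le> Erfc ((y \<bullet> n - b) / (2 * sqrt (l * s)))" by (rule Erfc_ge_1)
        then have "1 \<le> ?f p" using pen' \<delta> unfolding f_def by linarith
        then show False using less v1 by simp
      qed
      then have fc: "0 \<le> flat_curv l n b p" using s l0 by (intro flat_curv_nonneg) (auto simp: ys)
      have H: "space_hessian ?f p = rank_one_matrix (2 * (1 / r\<^sup>2)) (flat_curv l n b p) n" by (rule C21(2)[OF _ p])
      have TD: "time_deriv ?f p = l * flat_curv l n b p + 1 / r\<^sup>2 * C" by (rule C21(3)[OF _ p])
      have "F (space_hessian ?f p) = l * (real CARD('n) * (2 * (1 / r\<^sup>2)) + flat_curv l n b p)"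
        unfolding H by (rule F_pos[OF n _ fc]) simp
      also have "\<dots> = l * flat_curv l n b p + 1 / r\<^sup>2 * (2 * l * real CARD('n))" by (simp add: algebra_simps)
      also have "\<dots> < l * flat_curv l n b p + 1 / r\<^sup>2 * C"
      proof -
        have "2 * l * real CARD('n) < C" unfolding C_def using lL by (smt (verit) mult_right_mono N_pos)
        then have "1 / r\<^sup>2 * (2 * l * real CARD('n)) < 1 / r\<^sup>2 * C" using r by (intro mult_strict_left_mono) auto
        then show ?thesis by linarith
      qed
      also have "\<dots> = time_deriv ?f p" unfolding TD by simp
      finally show "0 < time_deriv ?f p - F (space_hessian ?f p)" by simp
    qed
    also have "?f (y0, t) = Erfc ((y0 \<bullet> n - b) / (2 * sqrt (l * t))) + C * t / r\<^sup>2 + \<delta>"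
      by (simp add: flat_barrier_def)
    finally show "v (y0, t) \<le> Erfc ((y0 \<bullet> n - b) / (2 * sqrt (l * t))) + C * t / r\<^sup>2 + \<delta>" .
  qed
qed

text \<open>The mirror image of the upper bound, but now all of the closure of
  \<open>\<Omega>\<close> in the ball has to lie above the plane: this keeps the Erfc part at most 1
  on the frontier and convex throughout. At the initial slice only \<open>v \<ge> 0\<close> is
  available, so it is the Erfc part that has to be small there.\<close>

lemma flat_lower_bound:
  assumes y0: "y0 \<in> \<Omega>" and r: "0 < r" and t: "0 < t" and n: "norm n = 1"
    and geo: "\<And>y. y \<in> cball y0 r \<Longrightarrow> y \<in> closure \<Omega> \<Longrightarrow> b < y \<bullet> n"
  shows "Erfc ((y0 \<bullet> n - b) / (2 * sqrt (l * t))) - (2 * L * real CARD('n) + 1) * t / r\<^sup>2 \<le> v (y0, t)"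
proof (rule field_le_epsilon)
  fix \<delta> :: real assume \<delta>: "0 < \<delta>"
  define C where "C = 2 * L * real CARD('n) + 1"
  have C0: "0 < C" unfolding C_def using L_pos by (simp add: add_nonneg_pos)
  have y0b: "b < y0 \<bullet> n" using geo[of y0] y0 r closure_subset[of \<Omega>] by auto
  show "Erfc ((y0 \<bullet> n - b) / (2 * sqrt (l * t))) - (2 * L * real CARD('n) + 1) * t / r\<^sup>2 \<le> v (y0, t) + \<delta>"
    unfolding C_def[symmetric]
  proof (cases "C * t < r\<^sup>2")
    case False
    then have "1 \<le> C * t / r\<^sup>2" using r by simp
    moreover have "Erfc ((y0 \<bullet> n - b) / (2 * sqrt (l * t))) \<le> 1" using y0b l0 t by (intro Erfc_le_1) simp
    ultimately show "Erfc ((y0 \<bullet> n - b) / (2 * sqrt (l * t))) - C * t / r\<^sup>2 \<le> v (y0, t) + \<delta>"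
      using v_range_interior[OF y0, of t] t \<delta> by linarith
  next
    case True
    define T where "T = r\<^sup>2 / C"
    have tT: "t < T" using True C0 by (simp add: T_def field_simps)
    let ?f = "flat_barrier l n b (- 1 / r\<^sup>2) C y0 (- \<delta>)"
    define M where "M = closure \<Omega> \<inter> cball y0 r"
    have M: "compact M" unfolding M_def by (simp add: closed_Int_compact)
    have "y0 \<in> M" using y0 r closure_subset[of \<Omega>] by (auto simp: M_def)
    then obtain ym where ym: "ym \<in> M" "\<And>y. y \<in> M \<Longrightarrow> ym \<bullet> n \<le> y \<bullet> n"
      using continuous_attains_inf[OF M _ continuous_on_inner[OF continuous_on_id continuous_on_const], of n] by blast
    \<comment> \<open>By compactness the closure of \<open>\<Omega>\<close> within the ball keeps a
      positive distance from the plane; hence the argument of Erfc tends to infinity uniformly as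
      the time tends to 0.\<close>
    define \<eta> where "\<eta> = ym \<bullet> n - b"
    have \<eta>: "0 < \<eta>" "\<And>y. y \<in> M \<Longrightarrow> \<eta> \<le> y \<bullet> n - b" using ym geo[of ym] by (auto simp: \<eta>_def M_def)
    obtain X where X: "\<And>x. X \<le> x \<Longrightarrow> Erfc x < \<delta>"
      using order_tendstoD(2)[OF Erfc_tendsto_0 \<delta>] unfolding eventually_at_top_linorder by auto
    define X' where "X' = max X 1"
    \<comment> \<open>Solves \<open>\<eta> / (2 * sqrt (l * \<tau>)) = X'\<close>, capped at
      \<open>t\<close>. The maximum with 1 in \<open>X'\<close> only ensures a positive
      denominator.\<close>
    define \<tau> where "\<tau> = min (\<eta>\<^sup>2 / (4 * X'\<^sup>2 * l)) t"
    have X'0: "0 < X'" by (simp add: X'_def)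
    have \<tau>: "0 < \<tau>" "\<tau> \<le> t" "\<tau> < T" using \<eta> t tT X'0 l0 by (auto simp: \<tau>_def)
    have "l * \<tau> \<le> l * (\<eta>\<^sup>2 / (4 * X'\<^sup>2 * l))" using l0 by (intro mult_left_mono) (auto simp: \<tau>_def)
    also have "\<dots> = (\<eta> / (2 * X'))\<^sup>2" using l0 by (simp add: power_divide power_mult_distrib)
    finally have "sqrt (l * \<tau>) \<le> \<eta> / (2 * X')" using \<eta> X'0 by (intro real_le_lsqrt) auto
    then have X'\<tau>: "X' \<le> \<eta> / (2 * sqrt (l * \<tau>))" using X'0 l0 \<tau> by (simp add: field_simps)
    let ?K = "M \<times> {\<tau>..T}" and ?U = "(\<Omega> \<inter> ball y0 r) \<times> {\<tau><..<T}"
    have Upos: "snd p > 0" if "p \<in> ?U" for p using that \<tau> by auto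
    note C21 = flat_barrier_C21[where U = ?U and l = l, OF l0 Upos]
    have UK: "?U \<subseteq> ?K" using closure_subset[of \<Omega>] by (auto simp: M_def)
    have pen: "0 \<le> 1 / r\<^sup>2 * ((norm (y - y0))\<^sup>2 + C * s)" if "0 \<le> s" for y s
      using that C0 by simp
    have xi: "0 \<le> (y \<bullet> n - b) / (2 * sqrt (l * s))" if "y \<in> M" "0 < s" for y s
      using \<eta>(1) \<eta>(2)[OF that(1)] l0 that(2) by simp
    have fE: "?f (y, s) = Erfc ((y \<bullet> n - b) / (2 * sqrt (l * s))) - 1 / r\<^sup>2 * ((norm (y - y0))\<^sup>2 + C * s) - \<delta>" for y s
      by (simp add: flat_barrier_def)
    have "?f (y0, t) \<le> v (y0, t)"
    proof (rule viscosity_supersolution_ge[where Q = "\<Omega> \<times> {0<..}" and K = ?K and U = ?U and F = F])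
      show "viscosity_supersolution F (\<Omega> \<times> {0<..}) v"
        using sol by (simp add: is_solution_def viscosity_solution_def)
      show "compact ?K" using M by (simp add: compact_Times)
      show "continuous_on ?K v"
        by (rule v_continuous_on) (use \<tau> in \<open>fastforce simp: M_def\<close>)
      show "continuous_on ?K ?f" unfolding flat_barrier_def
        by (intro continuous_intros) (use \<tau> l0 in auto)
      show "open ?U" using op by (simp add: open_Times open_Int)
      show "?U \<subseteq> \<Omega> \<times> {0<..}" using \<tau> by auto
      show "?U \<subseteq> ?K" by (rule UK)
      show "C21_on ?U ?f" by (rule C21(1))
      show "(y0, t) \<in> ?K" using \<open>y0 \<in> M\<close> \<tau> tT by auto
    next
      fix p assume p: "p \<in> ?K - ?U"
      obtain y s where ys: "p = (y, s)" by (cases p)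
      have y: "y \<in> M" and s: "\<tau> \<le> s" "s \<le> T" "0 < s" using p ys \<tau> by auto
      have v0: "0 \<le> v (y, s)" using v_range[of y s] y s(3) by (simp add: M_def)
      have pen': "0 \<le> 1 / r\<^sup>2 * ((norm (y - y0))\<^sup>2 + C * s)" by (rule pen) (use s in auto)
      have E1: "Erfc ((y \<bullet> n - b) / (2 * sqrt (l * s))) \<le> 1" by (rule Erfc_le_1[OF xi[OF y s(3)]])
      consider "y \<notin> \<Omega>" | "dist y0 y = r" | "s = T" | "s = \<tau>" using p ys M_def by force
      then show "?f p \<le> v p"
      proof cases
        case 1
        then have "v (y, s) = 1" using v_boundary y s by (simp add: M_def)
        then show ?thesis using E1 pen' \<delta> unfolding fE ys by linarith
      next
        case 2
        then have "1 \<le> 1 / r\<^sup>2 * ((norm (y - y0))\<^sup>2 + C * s)" using r C0 s by (simp add: dist_norm norm_minus_commute divide_simps)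
        then show ?thesis using v0 E1 \<delta> unfolding fE ys by linarith
      next
        case 3
        then have "1 \<le> 1 / r\<^sup>2 * ((norm (y - y0))\<^sup>2 + C * s)" using r C0 by (simp add: T_def divide_simps mult.commute)
        then show ?thesis using v0 E1 \<delta> unfolding fE ys by linarith
      next
        case 4
        have "X \<le> X'" by (simp add: X'_def)
        also have "X' \<le> \<eta> / (2 * sqrt (l * \<tau>))" by (rule X'\<tau>)
        also have "\<dots> \<le> (y \<bullet> n - b) / (2 * sqrt (l * s))"
          using \<eta>(2)[OF y] 4 l0 \<tau> by (simp add: divide_right_mono)
        finally have "Erfc ((y \<bullet> n - b) / (2 * sqrt (l * s))) < \<delta>" by (rule X)
        then show ?thesis using v0 pen' unfolding fE ys by linarith
      qed
    next
      fix p assume p: "p \<in> ?U"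
      obtain y s where ys: "p = (y, s)" by (cases p)
      have s: "0 < s" and y: "y \<in> M" using p subsetD[OF UK p] ys \<tau> by simp_all
      have fc: "0 \<le> flat_curv l n b p" using s l0 xi[OF y s] by (intro flat_curv_nonneg) (auto simp: ys)
      have H: "space_hessian ?f p = rank_one_matrix (2 * (- 1 / r\<^sup>2)) (flat_curv l n b p) n" by (rule C21(2)[OF _ p])
      have TD: "time_deriv ?f p = l * flat_curv l n b p + - 1 / r\<^sup>2 * C" by (rule C21(3)[OF _ p])
      have "time_deriv ?f p = l * flat_curv l n b p - 1 / r\<^sup>2 * C" unfolding TD by simp
      also have "\<dots> < l * flat_curv l n b p - 1 / r\<^sup>2 * (2 * L * real CARD('n))"
      proof -
        have "1 / r\<^sup>2 * (2 * L * real CARD('n)) < 1 / r\<^sup>2 * C" using r by (intro mult_strict_left_mono) (auto simp: C_def)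
        then show ?thesis by linarith
      qed
      also have "\<dots> = l * flat_curv l n b p - L * (real CARD('n) * (2 / r\<^sup>2))" by (simp add: algebra_simps)
      also have "\<dots> \<le> F (rank_one_matrix (- (2 / r\<^sup>2)) (flat_curv l n b p) n)" by (rule F_ge[OF n _ fc]) simp
      also have "\<dots> = F (space_hessian ?f p)" unfolding H by simp
      finally show "time_deriv ?f p - F (space_hessian ?f p) < 0" by simp
    qed
    also have "?f (y0, t) = Erfc ((y0 \<bullet> n - b) / (2 * sqrt (l * t))) - C * t / r\<^sup>2 - \<delta>"
      by (simp add: flat_barrier_def)
    finally show "Erfc ((y0 \<bullet> n - b) / (2 * sqrt (l * t))) - C * t / r\<^sup>2 \<le> v (y0, t) + \<delta>" by simp
  qed
qed

end

subsection \<open>Second-order expansion of the boundary\<close>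

lemma has_derivative_remainder_le:
  fixes g :: "'a::euclidean_space \<Rightarrow> 'b::euclidean_space"
  assumes "(g has_derivative D) (at z)" "0 < \<epsilon>"
  obtains \<delta> where "0 < \<delta>" "\<And>p. norm p < \<delta> \<Longrightarrow> norm (g (z + p) - g z - D p) \<le> \<epsilon> * norm p"
proof -
  obtain d where d: "d > 0" "\<And>y. norm (y - z) < d \<Longrightarrow> norm (g y - g z - D (y - z)) \<le> \<epsilon> * norm (y - z)"
    using assms unfolding has_derivative_at_alt by blast
  show thesis
    by (rule that[OF d(1)]) (use d(2)[of "z + _"] in simp)
qed

lemma has_derivative_line:
  fixes f :: "'a::euclidean_space \<Rightarrow> real"
  assumes "\<And>y. (f has_derivative (\<lambda>h. g y \<bullet> h)) (at y)"
  shows "((\<lambda>s. f (a + s *\<^sub>R b)) has_real_derivative (g (a + s *\<^sub>R b) \<bullet> b)) (at s)"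
proof -
  have "((\<lambda>s. a + s *\<^sub>R b) has_derivative (\<lambda>h. h *\<^sub>R b)) (at s)"
    by (auto intro!: derivative_eq_intros)
  from has_derivative_compose[OF this assms]
  have "((\<lambda>s. f (a + s *\<^sub>R b)) has_derivative (\<lambda>h. h * (g (a + s *\<^sub>R b) \<bullet> b))) (at s)" by simp
  then show ?thesis unfolding has_field_derivative_def by (simp add: mult.commute[of _ "g _ \<bullet> _"])
qed

lemma DERIV_bound_diff_le:
  fixes \<phi> :: "real \<Rightarrow> real"
  assumes "\<And>s. 0 \<le> s \<Longrightarrow> s \<le> 1 \<Longrightarrow> (\<phi> has_real_derivative \<phi>' s) (at s)"
    and "\<And>s. 0 \<le> s \<Longrightarrow> s \<le> 1 \<Longrightarrow> \<bar>\<phi>' s\<bar> \<le> B"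
  shows "\<bar>\<phi> 1 - \<phi> 0\<bar> \<le> B"
proof -
  obtain s where "0 < s" "s < 1" "\<phi> 1 - \<phi> 0 = (1 - 0) * \<phi>' s"
    using MVT2[of 0 1 \<phi> \<phi>'] assms(1) by auto
  then show ?thesis using assms(2)[of s] by simp
qed

text \<open>Peano form: the gradient is differentiable at \<open>z\<close> alone. Along the segment,
  the derivative of \<open>f\<close> minus its quadratic polynomial is the first-order remainder of
  \<open>g\<close>, to which the mean value theorem applies.\<close>

lemma second_order_taylor:
  fixes f :: "'a::euclidean_space \<Rightarrow> real"
  assumes f: "\<And>y. (f has_derivative (\<lambda>h. g y \<bullet> h)) (at y)" and g: "(g has_derivative D) (at z)" and "0 < \<epsilon>"
  obtains \<delta> where "0 < \<delta>" "\<And>u. norm u < \<delta> \<Longrightarrow> \<bar>f (z + u) - f z - g z \<bullet> u - D u \<bullet> u / 2\<bar> \<le> \<epsilon> * (norm u)\<^sup>2"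
proof -
  obtain d where d: "0 < d" "\<And>p. norm p < d \<Longrightarrow> norm (g (z + p) - g z - D p) \<le> \<epsilon> * norm p"
    using has_derivative_remainder_le[OF g \<open>0 < \<epsilon>\<close>] by blast
  have lin: "linear D" using g has_derivative_linear by blast
  show thesis
  proof (rule that[OF d(1)])
    fix u :: 'a assume u: "norm u < d"
    define \<phi> where "\<phi> s = f (z + s *\<^sub>R u) - s * (g z \<bullet> u) - s\<^sup>2 / 2 * (D u \<bullet> u)" for s
    have "\<bar>\<phi> 1 - \<phi> 0\<bar> \<le> \<epsilon> * (norm u)\<^sup>2"
    proof (rule DERIV_bound_diff_le)
      fix s :: real assume s: "0 \<le> s" "s \<le> 1"
      have 2: "((\<lambda>s. s * (g z \<bullet> u)) has_real_derivative g z \<bullet> u) (at s)" "((\<lambda>s. s\<^sup>2 / 2 * (D u \<bullet> u)) has_real_derivative s * (D u \<bullet> u)) (at s)"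
        by (auto intro!: derivative_eq_intros)
      have "(\<phi> has_real_derivative (g (z + s *\<^sub>R u) \<bullet> u - g z \<bullet> u - s * (D u \<bullet> u))) (at s)"
        unfolding \<phi>_def by (intro DERIV_diff 2 has_derivative_line[OF f])
      also have "g (z + s *\<^sub>R u) \<bullet> u - g z \<bullet> u - s * (D u \<bullet> u) = (g (z + s *\<^sub>R u) - g z - D (s *\<^sub>R u)) \<bullet> u"
        using lin by (simp add: inner_diff_left linear_scale)
      finally show "(\<phi> has_real_derivative (g (z + s *\<^sub>R u) - g z - D (s *\<^sub>R u)) \<bullet> u) (at s)" .
      have su: "norm (s *\<^sub>R u) \<le> norm u" using s by (simp add: mult_left_le_one_le)
      then have "norm (g (z + s *\<^sub>R u) - g z - D (s *\<^sub>R u)) \<le> \<epsilon> * norm (s *\<^sub>R u)"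
        using u by (intro d(2)) simp
      also have "\<dots> \<le> \<epsilon> * norm u" using su \<open>0 < \<epsilon>\<close> by (simp only: mult_left_mono less_imp_le)
      finally have "norm (g (z + s *\<^sub>R u) - g z - D (s *\<^sub>R u)) * norm u \<le> \<epsilon> * norm u * norm u"
        by (rule mult_right_mono) simp
      then show "\<bar>(g (z + s *\<^sub>R u) - g z - D (s *\<^sub>R u)) \<bullet> u\<bar> \<le> \<epsilon> * (norm u)\<^sup>2"
        using Cauchy_Schwarz_ineq2[of "g (z + s *\<^sub>R u) - g z - D (s *\<^sub>R u)" u]
        by (simp add: power2_eq_square mult.assoc)
    qed
    then show "\<bar>f (z + u) - f z - g z \<bullet> u - D u \<bullet> u / 2\<bar> \<le> \<epsilon> * (norm u)\<^sup>2"
      by (simp add: \<phi>_def algebra_simps)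
  qed
qed

text \<open>The second difference of \<open>f\<close> over the parallelogram spanned by
  \<open>t u\<close> and \<open>t v\<close> is symmetric in \<open>u\<close> and \<open>v\<close>,
  and it equals \<open>t^2 (D v \<bullet> u)\<close> up to \<open>o(t^2)\<close>. Differentiability
  of the gradient at \<open>z\<close> suffices for this.\<close>

lemma second_derivative_symmetric:
  fixes f :: "'a::euclidean_space \<Rightarrow> real"
  assumes f: "\<And>y. (f has_derivative (\<lambda>h. g y \<bullet> h)) (at y)" and g: "(g has_derivative D) (at z)"
  shows "D u \<bullet> v = u \<bullet> D v"
proof -
  have lin: "linear D" using g has_derivative_linear by blast
  define M where "M = norm u + norm v"
  have M0: "0 \<le> M" by (simp add: M_def)
  have second_diff: "\<exists>\<tau>>0. \<forall>t. 0 < t \<and> t \<le> \<tau> \<longrightarrow>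
      \<bar>f (z + t *\<^sub>R u + t *\<^sub>R v) - f (z + t *\<^sub>R u) - f (z + t *\<^sub>R v) + f z - t\<^sup>2 * (D v \<bullet> u)\<bar> \<le> t\<^sup>2 * (2 * \<epsilon> * (norm u + norm v)\<^sup>2)"
    if \<epsilon>: "0 < \<epsilon>" for \<epsilon> u v
  proof -
    obtain d where d: "0 < d" "\<And>p. norm p < d \<Longrightarrow> norm (g (z + p) - g z - D p) \<le> \<epsilon> * norm p"
      using has_derivative_remainder_le[OF g \<epsilon>] by blast
    define M where "M = norm u + norm v"
    have M0: "0 \<le> M" by (simp add: M_def)
    \<comment> \<open>Keeps all points that occur within distance \<open>d\<close> of
      \<open>z\<close>; the summand 1 covers the case that both vectors vanish.\<close>
    define \<tau> where "\<tau> = d / (M + 1)"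
    have \<tau>: "0 < \<tau>" using d M0 by (simp add: \<tau>_def)
    have "\<bar>f (z + t *\<^sub>R u + t *\<^sub>R v) - f (z + t *\<^sub>R u) - f (z + t *\<^sub>R v) + f z - t\<^sup>2 * (D v \<bullet> u)\<bar> \<le> t\<^sup>2 * (2 * \<epsilon> * M\<^sup>2)"
      if t: "0 < t" "t \<le> \<tau>" for t
    proof -
      \<comment> \<open>The increment of \<open>\<psi>\<close> over the unit interval is the second
        difference minus its expected value, and its derivative involves two remainders of the
        gradient.\<close>
      define \<psi> where "\<psi> s = f ((z + t *\<^sub>R v) + s *\<^sub>R (t *\<^sub>R u)) - f (z + s *\<^sub>R (t *\<^sub>R u)) - s * (t\<^sup>2 * (D v \<bullet> u))" for s
      have tM: "t * M < d"
      proof -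
        have "t * (M + 1) \<le> d" using t M0 unfolding \<tau>_def by (simp add: pos_le_divide_eq)
        moreover have "t * M < t * (M + 1)" using t by simp
        ultimately show ?thesis by linarith
      qed
      have "\<bar>\<psi> 1 - \<psi> 0\<bar> \<le> t\<^sup>2 * (2 * \<epsilon> * M\<^sup>2)"
      proof (rule DERIV_bound_diff_le)
        fix s :: real assume s: "0 \<le> s" "s \<le> 1"
        let ?p = "t *\<^sub>R v + s *\<^sub>R (t *\<^sub>R u)" and ?q = "s *\<^sub>R (t *\<^sub>R u)"
        let ?r = "\<lambda>p. g (z + p) - g z - D p"
        have D3: "((\<lambda>s. s * (t\<^sup>2 * (D v \<bullet> u))) has_real_derivative t\<^sup>2 * (D v \<bullet> u)) (at s)"
          by (auto intro!: derivative_eq_intros)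
        have "(\<psi> has_real_derivative (g (z + t *\<^sub>R v + ?q) \<bullet> (t *\<^sub>R u) - g (z + ?q) \<bullet> (t *\<^sub>R u) - t\<^sup>2 * (D v \<bullet> u))) (at s)"
          unfolding \<psi>_def by (intro DERIV_diff has_derivative_line[OF f] D3)
        also have "g (z + t *\<^sub>R v + ?q) \<bullet> (t *\<^sub>R u) - g (z + ?q) \<bullet> (t *\<^sub>R u) - t\<^sup>2 * (D v \<bullet> u)
            = t * ((?r ?p - ?r ?q) \<bullet> u)"
          using lin by (simp add: linear_add linear_scale inner_diff_left inner_add_left power2_eq_square algebra_simps)
        finally show "(\<psi> has_real_derivative t * ((?r ?p - ?r ?q) \<bullet> u)) (at s)" .
        have su: "s * norm u \<le> norm u" using s by (simp add: mult_left_le_one_le)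
        have nq: "norm ?q \<le> t * M"
        proof -
          have "norm ?q = t * (s * norm u)" using s t by simp
          also have "\<dots> \<le> t * M" using su t by (intro mult_left_mono) (auto simp: M_def intro: add_increasing2)
          finally show ?thesis .
        qed
        have np: "norm ?p \<le> t * M"
        proof -
          have "norm ?p \<le> t * norm v + t * (s * norm u)" using norm_triangle_ineq[of "t *\<^sub>R v" ?q] s t by (simp add: mult_ac)
          also have "\<dots> = t * (norm v + s * norm u)" by (simp add: algebra_simps)
          also have "\<dots> \<le> t * M" using su t by (intro mult_left_mono) (auto simp: M_def)
          finally show ?thesis .
        qed
        have rb: "norm (?r p) \<le> \<epsilon> * (t * M)" if "norm p \<le> t * M" for p
        proof -
          have "norm (?r p) \<le> \<epsilon> * norm p" using that tM by (intro d(2)) simp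
          also have "\<dots> \<le> \<epsilon> * (t * M)" using that \<epsilon> by simp
          finally show ?thesis .
        qed
        have "\<bar>(?r ?p - ?r ?q) \<bullet> u\<bar> \<le> norm (?r ?p - ?r ?q) * norm u" by (rule Cauchy_Schwarz_ineq2)
        also have "\<dots> \<le> (2 * (\<epsilon> * (t * M))) * M"
          using norm_triangle_ineq4[of "?r ?p" "?r ?q"] rb[OF np] rb[OF nq] \<epsilon> t M0
          by (intro mult_mono) (auto simp: M_def)
        finally have "t * \<bar>(?r ?p - ?r ?q) \<bullet> u\<bar> \<le> t * ((2 * (\<epsilon> * (t * M))) * M)"
          using t by (intro mult_left_mono) auto
        then show "\<bar>t * ((?r ?p - ?r ?q) \<bullet> u)\<bar> \<le> t\<^sup>2 * (2 * \<epsilon> * M\<^sup>2)"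
          using t by (simp add: abs_mult power2_eq_square mult_ac)
      qed
      then show ?thesis by (simp add: \<psi>_def algebra_simps)
    qed
    then show ?thesis using \<tau> M_def by blast
  qed
  have le: "\<bar>D v \<bullet> u - D u \<bullet> v\<bar> \<le> 4 * \<epsilon> * M\<^sup>2" if \<epsilon>: "0 < \<epsilon>" for \<epsilon>
  proof -
    obtain \<tau>1 \<tau>2 where \<tau>: "\<tau>1 > 0" "\<tau>2 > 0"
      and 1: "\<forall>t. 0 < t \<and> t \<le> \<tau>1 \<longrightarrow> \<bar>f (z + t *\<^sub>R u + t *\<^sub>R v) - f (z + t *\<^sub>R u) - f (z + t *\<^sub>R v) + f z - t\<^sup>2 * (D v \<bullet> u)\<bar> \<le> t\<^sup>2 * (2 * \<epsilon> * (norm u + norm v)\<^sup>2)"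
      and 2: "\<forall>t. 0 < t \<and> t \<le> \<tau>2 \<longrightarrow> \<bar>f (z + t *\<^sub>R v + t *\<^sub>R u) - f (z + t *\<^sub>R v) - f (z + t *\<^sub>R u) + f z - t\<^sup>2 * (D u \<bullet> v)\<bar> \<le> t\<^sup>2 * (2 * \<epsilon> * (norm v + norm u)\<^sup>2)"
      using second_diff[OF \<epsilon>, of u v] second_diff[OF \<epsilon>, of v u] by blast
    define t where "t = min \<tau>1 \<tau>2"
    have t: "0 < t" using \<tau> by (simp add: t_def)
    define A where "A = f (z + t *\<^sub>R u + t *\<^sub>R v) - f (z + t *\<^sub>R u) - f (z + t *\<^sub>R v) + f z"
    have sw: "z + t *\<^sub>R v + t *\<^sub>R u = z + t *\<^sub>R u + t *\<^sub>R v" by simp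
    have "\<bar>A - t\<^sup>2 * (D v \<bullet> u)\<bar> \<le> t\<^sup>2 * (2 * \<epsilon> * M\<^sup>2)" using 1 t unfolding A_def M_def by (simp add: t_def)
    moreover have "\<bar>A - t\<^sup>2 * (D u \<bullet> v)\<bar> \<le> t\<^sup>2 * (2 * \<epsilon> * M\<^sup>2)"
    proof -
      have "\<bar>f (z + t *\<^sub>R v + t *\<^sub>R u) - f (z + t *\<^sub>R v) - f (z + t *\<^sub>R u) + f z - t\<^sup>2 * (D u \<bullet> v)\<bar> \<le> t\<^sup>2 * (2 * \<epsilon> * (norm v + norm u)\<^sup>2)"
        using 2 t by (simp add: t_def)
      then show ?thesis unfolding A_def M_def sw by (simp add: add.commute[of "norm v"] algebra_simps)
    qed
    ultimately have "\<bar>t\<^sup>2 * (D v \<bullet> u) - t\<^sup>2 * (D u \<bullet> v)\<bar> \<le> 2 * (t\<^sup>2 * (2 * \<epsilon> * M\<^sup>2))" by linarith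
    also have "\<bar>t\<^sup>2 * (D v \<bullet> u) - t\<^sup>2 * (D u \<bullet> v)\<bar> = t\<^sup>2 * \<bar>D v \<bullet> u - D u \<bullet> v\<bar>"
      by (simp add: right_diff_distrib[symmetric] abs_mult del: right_diff_distrib)
    finally have "t\<^sup>2 * \<bar>D v \<bullet> u - D u \<bullet> v\<bar> \<le> t\<^sup>2 * (4 * \<epsilon> * M\<^sup>2)" by (simp add: mult_ac)
    then show ?thesis using t by (simp del: mult_le_cancel_left_pos add: mult_le_cancel_left_pos[of "t\<^sup>2"])
  qed
  have "\<bar>D v \<bullet> u - D u \<bullet> v\<bar> \<le> 0"
  proof (rule field_le_epsilon)
    fix e :: real assume e: "0 < e"
    have "\<bar>D v \<bullet> u - D u \<bullet> v\<bar> \<le> 4 * (e / (4 * (M\<^sup>2 + 1))) * M\<^sup>2"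
      using e by (intro le) (simp add: add_nonneg_pos)
    also have "4 * (e / (4 * (M\<^sup>2 + 1))) * M\<^sup>2 = e * (M\<^sup>2 / (M\<^sup>2 + 1))"
    proof -
      have "4 * (e / (4 * X)) * Y = e * (Y / X)" for X Y :: real by simp
      then show ?thesis .
    qed
    also have "\<dots> \<le> e" using e by (intro mult_left_le) (auto simp: divide_simps add_nonneg_pos)
    finally show "\<bar>D v \<bullet> u - D u \<bullet> v\<bar> \<le> 0 + e" by simp
  qed
  then show ?thesis by (simp add: inner_commute)
qed

text \<open>Only these consequences of the graph representation are used. Slope 1 along
  \<open>e\<close> makes the frontier inside \<open>Z\<close> exactly the zero set of
  \<open>G\<close>, and it allows a point to be moved onto the frontier by an explicit
  displacement.\<close>

locale defining_function =
  fixes S :: "(real^'n) set" and G :: "real^'n \<Rightarrow> real" and g :: "real^'n \<Rightarrow> real^'n"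
    and e :: "real^'n" and Z :: "(real^'n) set"
  assumes Z: "open Z" and Sopen: "open S"
    and S_iff: "\<And>y. y \<in> Z \<Longrightarrow> y \<in> S \<longleftrightarrow> 0 < G y"
    and G_deriv: "\<And>y. (G has_derivative (\<lambda>h. g y \<bullet> h)) (at y)"
    and G_shift: "\<And>y s. G (y + s *\<^sub>R e) = G y + s"
    and g_e: "\<And>y. g y \<bullet> e = 1"
begin

lemma g_nonzero: "g y \<noteq> 0"
  using g_e[of y] by auto

lemma G_continuous: "continuous_on UNIV G"
  using G_deriv has_derivative_continuous continuous_at_imp_continuous_on by blast

lemma closure_imp: "y \<in> Z \<Longrightarrow> y \<in> closure S \<Longrightarrow> 0 \<le> G y"
proof (rule ccontr)
  assume y: "y \<in> Z" "y \<in> closure S" and "\<not> 0 \<le> G y"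
  define V where "V = Z \<inter> {y. G y < 0}"
  have "open V" unfolding V_def using Z G_continuous
    by (intro open_Int open_Collect_less) auto
  moreover have "y \<in> V" using y \<open>\<not> 0 \<le> G y\<close> by (simp add: V_def)
  ultimately obtain y' where "y' \<in> V" "y' \<in> S"
    using y(2) open_Int_closure_eq_empty[of V S] by blast
  then show False using S_iff[of y'] by (auto simp: V_def)
qed

lemma frontier_iff: assumes y: "y \<in> Z" shows "y \<in> frontier S \<longleftrightarrow> G y = 0"
proof
  assume "y \<in> frontier S"
  then show "G y = 0" using closure_imp[OF y] S_iff[OF y] Sopen
    by (auto simp: frontier_def interior_open)
next
  assume G0: "G y = 0"
  have "y \<notin> S" using S_iff[OF y] G0 by simp
  moreover have "y \<in> closure S"
  proof -
    \<comment> \<open>A zero of \<open>G\<close> is a limit of points of \<open>S\<close>: any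
      positive displacement along \<open>e\<close> makes \<open>G\<close> positive.\<close>
    have lim: "((\<lambda>s. y + s *\<^sub>R e) \<longlongrightarrow> y) (at_right 0)"
      by (auto intro!: tendsto_eq_intros)
    have "eventually (\<lambda>s. y + s *\<^sub>R e \<in> Z) (at_right 0)"
      using lim Z y by (rule topological_tendstoD)
    moreover have "eventually (\<lambda>s::real. 0 < s) (at_right 0)" by (simp add: eventually_at_right_less)
    ultimately have "eventually (\<lambda>s. y + s *\<^sub>R e \<in> closure S) (at_right 0)"
    proof eventually_elim
      case (elim s)
      then have "y + s *\<^sub>R e \<in> S" using S_iff G_shift G0 by simp
      then show ?case using closure_subset by blast
    qed
    then show ?thesis
      using Lim_in_closed_set[OF closed_closure _ _ lim] by simp
  qed
  ultimately show "y \<in> frontier S" using Sopen by (simp add: frontier_def interior_open)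
qed

text \<open>Moving a tangential displacement back to the frontier along \<open>e\<close>, on which \<open>G\<close> is affine with slope 1.\<close>

definition tangent_curve :: "real^'n \<Rightarrow> real^'n \<Rightarrow> real \<Rightarrow> real^'n" where
  "tangent_curve y w s = y + s *\<^sub>R w - G (y + s *\<^sub>R w) *\<^sub>R e"

text \<open>\<open>G\<close> has derivative 0 along \<open>w\<close>, so the correction along
  \<open>e\<close> is \<open>o(s)\<close> and the corrected curve still leaves \<open>y\<close> in
  direction \<open>w\<close>.\<close>

lemma tangent_curve:
  assumes y: "y \<in> Z" "G y = 0" and w: "g y \<bullet> w = 0" "w \<noteq> 0"
  shows tangent_curve_slope: "((\<lambda>s. (tangent_curve y w s - y) /\<^sub>R s) \<longlongrightarrow> w) (at_right 0)"
    and tangent_curve_filterlim: "filterlim (tangent_curve y w) (at y within frontier S) (at_right 0)"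
proof -
  have D: "((\<lambda>s. G (y + s *\<^sub>R w)) has_real_derivative 0) (at 0)"
    using has_derivative_line[of G g y w 0, OF G_deriv] w by simp
  then have "((\<lambda>s. G (y + s *\<^sub>R w) / s) \<longlongrightarrow> 0) (at 0)"
    using y(2) by (simp add: has_field_derivative_iff)
  then have q: "((\<lambda>s. G (y + s *\<^sub>R w) / s) \<longlongrightarrow> 0) (at_right 0)"
    by (rule filterlim_mono) (auto simp: at_le)
  have pos: "eventually (\<lambda>s::real. 0 < s) (at_right 0)" by (simp add: eventually_at_right_less)
  have "((\<lambda>s. w - (G (y + s *\<^sub>R w) / s) *\<^sub>R e) \<longlongrightarrow> w - 0 *\<^sub>R e) (at_right 0)"
    by (intro tendsto_intros q)
  moreover have "eventually (\<lambda>s. w - (G (y + s *\<^sub>R w) / s) *\<^sub>R e = (tangent_curve y w s - y) /\<^sub>R s) (at_right 0)"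
    using pos by eventually_elim (simp add: tangent_curve_def scaleR_diff_right divide_inverse_commute)
  ultimately show slope: "((\<lambda>s. (tangent_curve y w s - y) /\<^sub>R s) \<longlongrightarrow> w) (at_right 0)"
    by (simp add: tendsto_cong)
  have c0: "((\<lambda>s. G (y + s *\<^sub>R w)) \<longlongrightarrow> 0) (at_right 0)"
  proof -
    have "isCont (\<lambda>s. G (y + s *\<^sub>R w)) 0" using D DERIV_isCont by blast
    then have "((\<lambda>s. G (y + s *\<^sub>R w)) \<longlongrightarrow> 0) (at 0)" using y(2) by (simp add: isCont_def)
    then show ?thesis by (rule filterlim_mono) (auto simp: at_le)
  qed
  have "((\<lambda>s. y + s *\<^sub>R w - G (y + s *\<^sub>R w) *\<^sub>R e) \<longlongrightarrow> y + 0 *\<^sub>R w - 0 *\<^sub>R e) (at_right 0)"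
    by (intro tendsto_intros c0)
  then have lim: "(tangent_curve y w \<longlongrightarrow> y) (at_right 0)"
    unfolding tangent_curve_def by simp
  have "eventually (\<lambda>s. tangent_curve y w s \<in> Z) (at_right 0)"
    using lim Z y(1) by (rule topological_tendstoD)
  then have fr: "eventually (\<lambda>s. tangent_curve y w s \<in> frontier S) (at_right 0)"
  proof eventually_elim
    case (elim s)
    have "G (tangent_curve y w s) = 0"
      using G_shift[of "y + s *\<^sub>R w" "- G (y + s *\<^sub>R w)"] by (simp add: tangent_curve_def)
    then show ?case using frontier_iff[OF elim] by simp
  qed
  have "eventually (\<lambda>s. (tangent_curve y w s - y) /\<^sub>R s \<noteq> 0) (at_right 0)"
    using tendsto_imp_eventually_ne[OF slope w(2)] .
  then have "eventually (\<lambda>s. tangent_curve y w s \<noteq> y) (at_right 0)"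
    by eventually_elim auto
  with lim fr show "filterlim (tangent_curve y w) (at y within frontier S) (at_right 0)"
    unfolding filterlim_at by (auto elim: eventually_elim2)
qed

text \<open>The definite description needs existence and uniqueness. Differentiability of
  \<open>G\<close> gives existence. For uniqueness, curves on the frontier make a candidate
  orthogonal to every tangent vector, which leaves two opposite unit vectors, and entering
  \<open>S\<close> selects the sign.\<close>

lemma inward_normal_eq:
  assumes y: "y \<in> Z" "G y = 0"
  shows "inward_normal S y = g y /\<^sub>R norm (g y)"
proof -
  let ?n = "g y /\<^sub>R norm (g y)"
  have gn: "0 < norm (g y)" using g_nonzero by simp
  have Gline: "((\<lambda>s. G (y + s *\<^sub>R w) / s) \<longlongrightarrow> g y \<bullet> w) (at_right 0)" for w
  proof -
    have "((\<lambda>s. G (y + s *\<^sub>R w)) has_real_derivative g y \<bullet> w) (at 0)"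
      using has_derivative_line[of G g y w 0, OF G_deriv] by simp
    then have "((\<lambda>s. G (y + s *\<^sub>R w) / s) \<longlongrightarrow> g y \<bullet> w) (at 0)"
      using y(2) by (simp add: has_field_derivative_iff)
    then show ?thesis by (rule filterlim_mono) (auto simp: at_le)
  qed
  have pos: "eventually (\<lambda>s::real. 0 < s) (at_right 0)" by (simp add: eventually_at_right_less)
  have inZ: "eventually (\<lambda>s. y + s *\<^sub>R w \<in> Z) (at_right 0)" for w
  proof -
    have "((\<lambda>s. y + s *\<^sub>R w) \<longlongrightarrow> y) (at_right 0)" by (auto intro!: tendsto_eq_intros)
    then show ?thesis using Z y(1) by (rule topological_tendstoD)
  qed
  have nn: "g y \<bullet> ?n = norm (g y)" using gn by (simp add: dot_square_norm power2_eq_square)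
  have n1: "norm ?n = 1" using gn by simp
  show ?thesis unfolding inward_normal_def
  proof (rule the_equality, intro conjI)
    show "norm ?n = 1" by (rule n1)
    show "((\<lambda>y'. (y' - y) \<bullet> ?n / norm (y' - y)) \<longlongrightarrow> 0) (at y within frontier S)"
    proof -
      have "((\<lambda>y'. (G y' - G y - g y \<bullet> (y' - y)) / norm (y' - y)) \<longlongrightarrow> 0) (at y within frontier S)"
        using G_deriv[of y] has_derivative_at_withinI[OF G_deriv[of y], of "frontier S"]
        by (simp add: has_derivative_within divide_inverse_commute diff_diff_eq)
      then have "((\<lambda>y'. - inverse (norm (g y)) * ((G y' - G y - g y \<bullet> (y' - y)) / norm (y' - y))) \<longlongrightarrow> - inverse (norm (g y)) * 0) (at y within frontier S)"
        by (intro tendsto_mult tendsto_const)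
      moreover have "eventually (\<lambda>y'. - inverse (norm (g y)) * ((G y' - G y - g y \<bullet> (y' - y)) / norm (y' - y))
          = (y' - y) \<bullet> ?n / norm (y' - y)) (at y within frontier S)"
      proof -
        have "eventually (\<lambda>y'. y' \<in> Z) (at y within frontier S)"
          using Z y(1) by (auto simp: eventually_at_topological)
        moreover have "eventually (\<lambda>y'. y' \<in> frontier S) (at y within frontier S)"
          by (simp add: eventually_at_filter)
        ultimately show ?thesis
        proof eventually_elim
          case (elim y')
          then have "G y' = 0" using frontier_iff by blast
          then show ?case using y(2) by (simp add: inner_commute divide_inverse mult_ac)
        qed
      qed
      ultimately show ?thesis by (simp add: tendsto_cong)
    qed
    show "\<forall>\<^sub>F s in at_right 0. y + s *\<^sub>R ?n \<in> S"
    proof -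
      have "eventually (\<lambda>s. 0 < G (y + s *\<^sub>R ?n) / s) (at_right 0)"
        using order_tendstoD(1)[OF Gline[of ?n], of 0] gn nn by simp
      with pos inZ[of ?n] show ?thesis
      proof eventually_elim
        case (elim s)
        then show ?case using S_iff zero_less_divide_iff by fastforce
      qed
    qed
  next
    fix n assume n: "norm n = 1 \<and> ((\<lambda>y'. (y' - y) \<bullet> n / norm (y' - y)) \<longlongrightarrow> 0) (at y within frontier S) \<and>
       (\<forall>\<^sub>F s in at_right 0. y + s *\<^sub>R n \<in> S)"
    \<comment> \<open>The quotient in the definition is unchanged when numerator and denominator are
      divided by \<open>s\<close>; along the tangent curve it therefore tends to
      \<open>w \<bullet> n / |w|\<close>.\<close>
    have orth: "w \<bullet> n = 0" if w: "g y \<bullet> w = 0" for w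
    proof (cases "w = 0")
      case False
      let ?c = "tangent_curve y w"
      have 1: "((\<lambda>s. (?c s - y) \<bullet> n / norm (?c s - y)) \<longlongrightarrow> 0) (at_right 0)"
        using n tangent_curve_filterlim[OF y w False] filterlim_compose by blast
      have sl: "((\<lambda>s. (?c s - y) /\<^sub>R s) \<longlongrightarrow> w) (at_right 0)"
        by (rule tangent_curve_slope[OF y w False])
      have "((\<lambda>s. ((?c s - y) /\<^sub>R s) \<bullet> n / norm ((?c s - y) /\<^sub>R s)) \<longlongrightarrow> w \<bullet> n / norm w) (at_right 0)"
        using False by (intro tendsto_divide tendsto_inner tendsto_norm sl tendsto_const) auto
      moreover have "eventually (\<lambda>s. ((?c s - y) /\<^sub>R s) \<bullet> n / norm ((?c s - y) /\<^sub>R s) = (?c s - y) \<bullet> n / norm (?c s - y)) (at_right 0)"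
        using pos by eventually_elim (simp add: divide_simps)
      ultimately have "((\<lambda>s. (?c s - y) \<bullet> n / norm (?c s - y)) \<longlongrightarrow> w \<bullet> n / norm w) (at_right 0)"
        by (simp add: tendsto_cong)
      with 1 have "w \<bullet> n / norm w = 0" using tendsto_unique[OF trivial_limit_at_right_real] by blast
      then show ?thesis using False by simp
    qed simp
    define c where "c = n \<bullet> ?n"
    define w where "w = n - c *\<^sub>R ?n"
    have "?n \<bullet> ?n = 1" using gn by (simp add: dot_square_norm power2_eq_square)
    then have "w \<bullet> ?n = 0" by (simp add: w_def c_def inner_diff_left)
    then have "g y \<bullet> w = 0" using gn by (simp add: inner_commute)
    from orth[OF this] have wn: "w \<bullet> n = 0" .
    have "w \<bullet> w = w \<bullet> (n - c *\<^sub>R ?n)" by (simp only: w_def)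
    also have "\<dots> = w \<bullet> n - c * (w \<bullet> ?n)" by (simp only: inner_diff_right inner_scaleR_right)
    also have "\<dots> = 0" unfolding wn \<open>w \<bullet> ?n = 0\<close> by simp
    finally have "w = 0" by simp
    then have ncn: "n = c *\<^sub>R ?n" by (simp add: w_def)
    have "norm n = \<bar>c\<bar> * norm ?n" unfolding ncn by (simp only: norm_scaleR)
    then have "\<bar>c\<bar> = 1" using n n1 by simp
    \<comment> \<open>With the opposite sign \<open>G\<close> would be negative along the ray, so
      the ray would leave \<open>S\<close> instead of entering it.\<close>
    moreover have "c \<noteq> - 1"
    proof
      assume "c = - 1"
      have "g y \<bullet> n = c * (g y \<bullet> ?n)" unfolding ncn by (simp only: inner_scaleR_right)
      then have "g y \<bullet> n < 0" using nn gn \<open>c = - 1\<close> by simp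
      then have "eventually (\<lambda>s. G (y + s *\<^sub>R n) / s < 0) (at_right 0)"
        using order_tendstoD(2)[OF Gline[of n], of 0] by simp
      with pos inZ[of n] have "eventually (\<lambda>s. y + s *\<^sub>R n \<notin> S) (at_right 0)"
      proof eventually_elim
        case (elim s)
        then show ?case using S_iff by (auto simp: divide_less_0_iff)
      qed
      moreover have "eventually (\<lambda>s. y + s *\<^sub>R n \<in> S) (at_right 0)" using n by blast
      ultimately have "eventually (\<lambda>s::real. False) (at_right 0)"
        by eventually_elim blast
      then show False using eventually_False trivial_limit_at_right_real by blast
    qed
    ultimately have "c = 1" by linarith
    then show "n = ?n" using ncn by simp
  qed
qed


text \<open>\<open>frechet_derivative\<close> picks some derivative, and within the frontier a
  derivative is not determined in the normal direction. On tangent vectors it is, since these are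
  limits of difference quotients along curves in the frontier.\<close>

lemma has_derivative_within_frontier_unique:
  assumes z: "z \<in> Z" "G z = 0" and f1: "(f has_derivative f1) (at z within frontier S)"
    and f2: "(f has_derivative f2) (at z within frontier S)" and w: "g z \<bullet> w = 0"
  shows "f1 w = f2 w"
proof (cases "w = 0")
  case True
  then show ?thesis using has_derivative_linear[OF f1] has_derivative_linear[OF f2] by (simp add: linear_0)
next
  case False
  define d where "d = (\<lambda>h. f1 h - f2 h)"
  have D: "((\<lambda>x. 0) has_derivative d) (at z within frontier S)"
    using has_derivative_diff[OF f1 f2] by (simp add: d_def)
  have bl: "bounded_linear d" using D has_derivative_bounded_linear by blast
  then interpret d: bounded_linear d .
  let ?c = "tangent_curve z w"
  note fl = tangent_curve_filterlim[OF z w False] and sl = tangent_curve_slope[OF z w False]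
  have "((\<lambda>y. (0 - 0 - d (y - z)) /\<^sub>R norm (y - z)) \<longlongrightarrow> 0) (at z within frontier S)"
    using D by (simp add: has_derivative_within diff_diff_eq divide_inverse)
  then have "((\<lambda>s. (0 - 0 - d (?c s - z)) /\<^sub>R norm (?c s - z)) \<longlongrightarrow> 0) (at_right 0)"
    using fl filterlim_compose by blast
  then have 1: "((\<lambda>s. - (((0 - 0 - d (?c s - z)) /\<^sub>R norm (?c s - z))) ) \<longlongrightarrow> - 0) (at_right 0)"
    by (rule tendsto_minus)
  have 2: "((\<lambda>s. d ((?c s - z) /\<^sub>R s) /\<^sub>R norm ((?c s - z) /\<^sub>R s)) \<longlongrightarrow> d w /\<^sub>R norm w) (at_right 0)"
    using False by (intro tendsto_scaleR tendsto_inverse tendsto_norm sl d.tendsto) auto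
  have pos: "eventually (\<lambda>s::real. 0 < s) (at_right 0)" by (simp add: eventually_at_right_less)
  have "eventually (\<lambda>s. d ((?c s - z) /\<^sub>R s) /\<^sub>R norm ((?c s - z) /\<^sub>R s)
      = - (((0 - 0 - d (?c s - z)) /\<^sub>R norm (?c s - z)))) (at_right 0)"
    using pos by eventually_elim (simp add: d.scaleR)
  with 2 have "((\<lambda>s. - (((0 - 0 - d (?c s - z)) /\<^sub>R norm (?c s - z)))) \<longlongrightarrow> d w /\<^sub>R norm w) (at_right 0)"
    by (rule Lim_transform_eventually)
  from tendsto_unique[OF trivial_limit_at_right_real this 1] have "d w = 0" using False by simp
  then show ?thesis by (simp add: d_def)
qed

text \<open>On the frontier the normal coincides with \<open>g / |g|\<close>, which is
  differentiable at \<open>z\<close> in the whole space. Differentiating the normalization removes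
  the component along \<open>n\<close>; uniqueness on tangent vectors transfers the result to the
  chosen derivative.\<close>

lemma frechet_derivative_inward_normal:
  assumes z: "z \<in> Z" "G z = 0" and gD: "(g has_derivative D) (at z)"
  defines "n \<equiv> g z /\<^sub>R norm (g z)"
  shows "linear (frechet_derivative (inward_normal S) (at z within frontier S))"
    and "g z \<bullet> w = 0 \<Longrightarrow> frechet_derivative (inward_normal S) (at z within frontier S) w
        = (D w - (D w \<bullet> n) *\<^sub>R n) /\<^sub>R norm (g z)"
proof -
  let ?f' = "frechet_derivative (inward_normal S) (at z within frontier S)"
  let ?\<nu>' = "\<lambda>h. (D h - (D h \<bullet> n) *\<^sub>R n) /\<^sub>R norm (g z)"
  have nd: "((\<lambda>y. norm (g y)) has_derivative (\<lambda>h. D h \<bullet> sgn (g z))) (at z)"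
    by (rule has_derivative_compose[OF gD has_derivative_norm[OF g_nonzero]])
  have ng: "norm (g z) \<noteq> 0" using g_nonzero by simp
  have "((\<lambda>y. inverse (norm (g y)) *\<^sub>R g y) has_derivative
      (\<lambda>h. inverse (norm (g z)) *\<^sub>R D h + (- (inverse (norm (g z)) * (D h \<bullet> sgn (g z)) * inverse (norm (g z)))) *\<^sub>R g z)) (at z)"
    by (rule has_derivative_scaleR[OF Deriv.has_derivative_inverse[OF ng nd] gD])
  also have "(\<lambda>h. inverse (norm (g z)) *\<^sub>R D h + (- (inverse (norm (g z)) * (D h \<bullet> sgn (g z)) * inverse (norm (g z)))) *\<^sub>R g z) = ?\<nu>'"
    by (simp add: fun_eq_iff n_def sgn_div_norm scaleR_diff_right mult_ac)
  finally have d1: "((\<lambda>y. g y /\<^sub>R norm (g y)) has_derivative ?\<nu>') (at z within frontier S)"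
    by (rule has_derivative_at_withinI)
  obtain r where r: "0 < r" "ball z r \<subseteq> Z" using Z z(1) openE by blast
  have zf: "z \<in> frontier S" using frontier_iff[OF z(1)] z(2) by simp
  have d2: "(inward_normal S has_derivative ?\<nu>') (at z within frontier S)"
  proof (rule has_derivative_transform_within[OF d1 r(1) zf])
    fix y assume y: "y \<in> frontier S" "dist y z < r"
    then have "y \<in> Z" using r(2) by (auto simp: dist_commute)
    moreover from this y have "G y = 0" using frontier_iff by blast
    ultimately show "g y /\<^sub>R norm (g y) = inward_normal S y" using inward_normal_eq by simp
  qed
  then have "inward_normal S differentiable (at z within frontier S)" by (auto simp: differentiable_def)
  then have d3: "(inward_normal S has_derivative ?f') (at z within frontier S)" by (simp add: frechet_derivative_works)
  then show "linear ?f'" by (rule has_derivative_linear)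
  show "?f' w = ?\<nu>' w" if "g z \<bullet> w = 0"
    by (rule has_derivative_within_frontier_unique[OF z d3 d2 that])
qed

end

text \<open>The defining function is the signed vertical distance to the graph; being defined in the
  whole space, it turns the one-sided description of the domain into the sign of a differentiable
  function.\<close>

lemma C2_domain_defining_function:
  fixes S :: "(real^'n) set"
  assumes "C2_domain S" "z \<in> frontier S"
  obtains G g e Z D where "defining_function S G g e Z" "z \<in> Z" "(g has_derivative D) (at z)"
proof -
  obtain r e h where r: "r > 0" and e: "norm e = 1" and h: "C2_function h"
    and S: "S \<inter> ball z r = {y \<in> ball z r. y \<bullet> e > h (y - (y \<bullet> e) *\<^sub>R e)}"
    using assms unfolding C2_domain_def by blast
  define P where "P y = y - (y \<bullet> e) *\<^sub>R e" for y
  define G where "G y = y \<bullet> e - h (P y)" for y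
  \<comment> \<open>Chain rule: the projection \<open>P\<close> is self-adjoint, so the gradient of
    \<open>h\<close> composed with \<open>P\<close> is the projected gradient of
    \<open>h\<close>.\<close>
  define g where "g y = e - P (gradient h (P y))" for y
  have ee: "e \<bullet> e = 1" using e by (simp add: norm_eq_1)
  have Pe: "P v \<bullet> e = 0" for v by (simp add: P_def inner_diff_left ee)
  have Psa: "P v \<bullet> w = v \<bullet> P w" for v w by (simp add: P_def inner_diff_left inner_diff_right inner_commute)
  have dP: "(P has_derivative P) (at y)" for y
    unfolding P_def by (auto intro!: derivative_eq_intros)
  have dh: "(h has_derivative (\<lambda>w. gradient h y \<bullet> w)) (at y)" for y
  proof -
    have "h differentiable (at y)" using h by (simp add: C2_function_def)
    then have *: "(h has_derivative frechet_derivative h (at y)) (at y)" by (simp add: frechet_derivative_works)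
    have lin: "linear (frechet_derivative h (at y))" using * by (rule has_derivative_linear)
    have "frechet_derivative h (at y) w = gradient h y \<bullet> w" for w
    proof -
      have "w = (\<Sum>i\<in>UNIV. w $ i *\<^sub>R axis i 1)" by (simp add: vec_eq_iff axis_def if_distrib cong: if_cong)
      then have "frechet_derivative h (at y) w = frechet_derivative h (at y) (\<Sum>i\<in>UNIV. w $ i *\<^sub>R axis i 1)" by simp
      also have "\<dots> = (\<Sum>i\<in>UNIV. w $ i * frechet_derivative h (at y) (axis i 1))"
        using lin by (simp add: linear_sum linear_scale)
      also have "\<dots> = gradient h y \<bullet> w" by (simp add: gradient_def inner_vec_def mult.commute)
      finally show ?thesis .
    qed
    then show ?thesis using * by (metis ext)
  qed
  have dg: "(gradient h has_derivative frechet_derivative (gradient h) (at y)) (at y)" for y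
    using h by (simp add: C2_function_def frechet_derivative_works)
  let ?D = "\<lambda>w. 0 - P (frechet_derivative (gradient h) (at (P z)) (P w))"
  have "defining_function S G g e (ball z r)"
  proof
    show "open (ball z r)" by simp
    show "open S" using assms(1) by (simp add: C2_domain_def)
    show "y \<in> S \<longleftrightarrow> 0 < G y" if "y \<in> ball z r" for y
    proof -
      have "y \<in> S \<longleftrightarrow> y \<in> S \<inter> ball z r" using that by simp
      also have "\<dots> \<longleftrightarrow> 0 < G y" unfolding S using that by (simp add: G_def P_def)
      finally show ?thesis .
    qed
    show "(G has_derivative (\<lambda>w. g y \<bullet> w)) (at y)" for y
    proof -
      have "(G has_derivative (\<lambda>w. w \<bullet> e - gradient h (P y) \<bullet> P w)) (at y)"
        unfolding G_def
        by (intro has_derivative_diff has_derivative_compose[OF dP dh]) (auto intro!: derivative_eq_intros)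
      also have "(\<lambda>w. w \<bullet> e - gradient h (P y) \<bullet> P w) = (\<lambda>w. g y \<bullet> w)"
        by (simp add: g_def inner_diff_left inner_diff_right Psa inner_commute fun_eq_iff)
      finally show ?thesis .
    qed
    show "G (y + s *\<^sub>R e) = G y + s" for y s
    proof -
      have "P (y + s *\<^sub>R e) = P y" by (simp add: P_def inner_add_left ee algebra_simps)
      then show ?thesis by (simp add: G_def inner_add_left ee)
    qed
    show "g y \<bullet> e = 1" for y by (simp add: g_def inner_diff_left Pe ee)
  qed
  moreover have "(g has_derivative ?D) (at z)"
    unfolding g_def
    by (intro has_derivative_diff has_derivative_const has_derivative_compose[OF has_derivative_compose[OF dP dg] dP])
  ultimately show thesis using that r by (metis centre_in_ball)
qed

text \<open>Contact with the ball identifies the inward normal as \<open>(x - z) / R\<close>, and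
  eigenvectors of the Weingarten map complete it to a frame. The expansion is the Taylor formula of
  \<open>G\<close> at \<open>z\<close> divided by \<open>|g z|\<close>. Reducing its quadratic term
  to the tangential part of \<open>u\<close> costs a small multiple of
  \<open>|u \<bullet> e i0|\<close>, which is why this term occurs in the error.\<close>

lemma C2_domain_boundary_expansion:
  fixes \<Omega> :: "(real^'n) set"
  assumes C2: "C2_domain \<Omega>" and z: "z \<in> frontier \<Omega>" and R: "0 < R" and ball: "ball x R \<subseteq> \<Omega>" and zx: "dist x z = R"
  obtains e :: "'n \<Rightarrow> real^'n" and i0 k where "\<And>i j. e i \<bullet> e j = (if i = j then 1 else 0)"
    "e i0 = (1 / R) *\<^sub>R (x - z)"
    "principal_curvatures \<Omega> z = image_mset k (mset_set (UNIV - {i0}))"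
    "\<And>\<epsilon>. 0 < \<epsilon> \<Longrightarrow> \<exists>\<delta>>0. \<forall>u. norm u < \<delta> \<longrightarrow>
      (z + u \<in> closure \<Omega> \<longrightarrow> (\<Sum>i\<in>UNIV - {i0}. k i * (u \<bullet> e i)\<^sup>2) / 2 - \<epsilon> * ((norm u)\<^sup>2 + \<bar>u \<bullet> e i0\<bar>) \<le> u \<bullet> e i0) \<and>
      (z + u \<notin> \<Omega> \<longrightarrow> u \<bullet> e i0 \<le> (\<Sum>i\<in>UNIV - {i0}. k i * (u \<bullet> e i)\<^sup>2) / 2 + \<epsilon> * ((norm u)\<^sup>2 + \<bar>u \<bullet> e i0\<bar>))"
proof -
  obtain G g d Z D where df: "defining_function \<Omega> G g d Z" and zZ: "z \<in> Z" and gD: "(g has_derivative D) (at z)"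
    using C2_domain_defining_function[OF C2 z] by metis
  interpret defining_function \<Omega> G g d Z by fact
  have Gz: "G z = 0" using frontier_iff[OF zZ] z by simp
  define n where "n = g z /\<^sub>R norm (g z)"
  define m where "m = (1 / R) *\<^sub>R (x - z)"
  have nm1: "norm m = 1" using zx R by (simp add: m_def dist_norm)
  have ng: "0 < norm (g z)" using g_nonzero by simp
  have xz: "x = z + R *\<^sub>R m" using R by (simp add: m_def)
  have mm: "m \<bullet> m = 1" using nm1 by (simp add: norm_eq_1)
  \<comment> \<open>A direction with \<open>u \<bullet> m > 0\<close> enters the ball, hence
    \<open>\<Omega>\<close>, for small \<open>s\<close>; so \<open>G\<close> is positive there and
    its one-sided derivative at \<open>z\<close> is nonnegative.\<close>
  have half: "0 \<le> g z \<bullet> u" if u: "0 < u \<bullet> m" for u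
  proof -
    have "((\<lambda>s. G (z + s *\<^sub>R u)) has_real_derivative g z \<bullet> u) (at 0)"
      using has_derivative_line[of G g z u 0, OF G_deriv] by simp
    then have "((\<lambda>s. G (z + s *\<^sub>R u) / s) \<longlongrightarrow> g z \<bullet> u) (at 0)"
      using Gz by (simp add: has_field_derivative_iff)
    then have lim: "((\<lambda>s. G (z + s *\<^sub>R u) / s) \<longlongrightarrow> g z \<bullet> u) (at_right 0)"
      by (rule filterlim_mono) (auto simp: at_le)
    have "((\<lambda>s. z + s *\<^sub>R u) \<longlongrightarrow> z) (at_right 0)" by (auto intro!: tendsto_eq_intros)
    then have inZ: "eventually (\<lambda>s. z + s *\<^sub>R u \<in> Z) (at_right 0)"
      using Z zZ by (rule topological_tendstoD)
    have "((\<lambda>s. s * (u \<bullet> u)) \<longlongrightarrow> 0 * (u \<bullet> u)) (at_right 0)" by (intro tendsto_intros)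
    then have sm: "eventually (\<lambda>s. s * (u \<bullet> u) < 2 * R * (u \<bullet> m)) (at_right 0)"
      by (rule order_tendstoD) (use R u in simp)
    have pos: "eventually (\<lambda>s::real. 0 < s) (at_right 0)" by (simp add: eventually_at_right_less)
    from inZ sm pos have "eventually (\<lambda>s. 0 \<le> G (z + s *\<^sub>R u) / s) (at_right 0)"
    proof eventually_elim
      case (elim s)
      have "(norm (x - (z + s *\<^sub>R u)))\<^sup>2 = R\<^sup>2 + s * (s * (u \<bullet> u) - 2 * R * (u \<bullet> m))"
        unfolding xz power2_norm_eq_inner
        by (simp add: inner_diff_left inner_diff_right inner_add_left inner_add_right mm power2_eq_square inner_commute algebra_simps)
      also have "\<dots> < R\<^sup>2" using elim by (simp add: mult_pos_neg)
      finally have "norm (x - (z + s *\<^sub>R u)) < R" using R by (simp add: power2_less_imp_less)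
      then have "z + s *\<^sub>R u \<in> \<Omega>" using ball by (auto simp: dist_norm)
      then show ?case using S_iff elim by simp
    qed
    then show ?thesis by (rule tendsto_lowerbound[OF lim]) simp
  qed
  \<comment> \<open>A vector that is nonnegative on an open half-space is a multiple of the normal
    of that half-space: let \<open>a\<close> be the part of \<open>g z\<close> orthogonal to
    \<open>m\<close>, and test the direction \<open>\<delta> m - a\<close> with small
    \<open>\<delta>\<close>.\<close>
  have nm: "n = m"
  proof -
    define c where "c = g z \<bullet> m"
    define a where "a = g z - c *\<^sub>R m"
    have am: "a \<bullet> m = 0" by (simp add: a_def c_def inner_diff_left mm)
    have ga: "g z \<bullet> a = a \<bullet> a"
    proof -
      have "g z = a + c *\<^sub>R m" by (simp add: a_def)
      then have "g z \<bullet> a = (a + c *\<^sub>R m) \<bullet> a" by (rule arg_cong)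
      also have "\<dots> = a \<bullet> a" using am by (simp add: inner_add_left inner_add_right inner_commute)
      finally show ?thesis .
    qed
    have "a \<bullet> a \<le> 0"
    proof (rule field_le_epsilon)
      fix \<epsilon> :: real assume \<epsilon>: "0 < \<epsilon>"
      define \<delta> where "\<delta> = \<epsilon> / (\<bar>c\<bar> + 1)"
      have \<delta>: "0 < \<delta>" using \<epsilon> by (simp add: \<delta>_def)
      have "0 \<le> g z \<bullet> (\<delta> *\<^sub>R m - a)"
        by (rule half) (use \<delta> in \<open>simp add: inner_diff_left mm am\<close>)
      then have "a \<bullet> a \<le> \<delta> * c" by (simp add: inner_diff_right ga c_def)
      also have "\<dots> \<le> \<delta> * (\<bar>c\<bar> + 1)" using \<delta> by (intro mult_left_mono) auto
      also have "\<dots> = \<epsilon>" by (simp add: \<delta>_def)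
      finally show "a \<bullet> a \<le> 0 + \<epsilon>" by simp
    qed
    then have "a = 0" by (metis inner_ge_zero inner_eq_zero_iff order_antisym)
    then have gc: "g z = c *\<^sub>R m" by (simp add: a_def)
    have "0 \<le> c" using half[of m] mm by (simp add: c_def)
    then have "norm (g z) = c" unfolding gc using nm1 by simp
    then show ?thesis using gc ng by (simp add: n_def)
  qed
  have nn: "n \<bullet> n = 1" using mm nm by simp
  have gn: "g z = norm (g z) *\<^sub>R n" using ng by (simp add: n_def)
  have normal: "inward_normal \<Omega> z = n" using inward_normal_eq[OF zZ Gz] by (simp add: n_def)
  define T where "T = {w. w \<bullet> n = 0}"
  have T: "boundary_tangent_space \<Omega> z = T" by (simp add: boundary_tangent_space_def normal T_def)
  have sT: "subspace T" unfolding T_def subspace_def by (auto simp: inner_add_left)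
  define f' where "f' = frechet_derivative (inward_normal \<Omega>) (at z within frontier \<Omega>)"
  have tang: "g z \<bullet> w = 0" if "w \<in> T" for w
    using that by (subst gn) (simp add: T_def inner_commute)
  have f': "f' w = (D w - (D w \<bullet> n) *\<^sub>R n) /\<^sub>R norm (g z)" if "w \<in> T" for w
    using frechet_derivative_inward_normal(2)[OF zZ Gz gD tang[OF that]] by (simp add: f'_def n_def)
  have linf: "linear f'" using frechet_derivative_inward_normal(1)[OF zZ Gz gD] by (simp add: f'_def)
  define W where "W w = - f' w" for w
  have linW: "linear W" unfolding W_def using linf by (rule linear_compose_neg)
  \<comment> \<open>On tangent vectors the bilinear form of \<open>W\<close> is that of
    \<open>- D / |g z|\<close>, so it inherits the symmetry of the second derivative of
    \<open>G\<close>.\<close>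
  have W_in: "W v \<bullet> w = - (D v \<bullet> w) / norm (g z)" if "v \<in> T" "w \<in> T" for v w
    using f'[OF that(1)] that(2) by (simp add: W_def inner_diff_left inner_diff_right T_def divide_inverse inner_commute)
  have WT: "W w \<in> T" if "w \<in> T" for w
    using f'[OF that] nn by (simp add: W_def T_def inner_diff_left)
  have Dsym: "D v \<bullet> w = v \<bullet> D w" for v w by (rule second_derivative_symmetric[OF G_deriv gD])
  have Wsym: "W v \<bullet> w = v \<bullet> W w" if "v \<in> T" "w \<in> T" for v w
    using W_in[OF that] W_in[OF that(2,1)] Dsym[of v w] by (simp add: inner_commute)
  obtain B \<kappa> where B: "B \<subseteq> T" "pairwise orthogonal B" "\<And>b. b \<in> B \<Longrightarrow> norm b = 1" "span B = T" "finite B"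
      "card B = dim T" "\<And>b. b \<in> B \<Longrightarrow> W b = \<kappa> b *\<^sub>R b"
    using selfadjoint_orthonormal_eigenbasis[OF sT linW WT Wsym] by blast
  have curv: "principal_curvatures \<Omega> z = image_mset \<kappa> (mset_set B)"
    unfolding principal_curvatures_def T f'_def[symmetric] W_def[symmetric] B(4)[symmetric]
    by (rule eigenvalues_on_orthonormal_eigenbasis[OF linW B(2,3,5,7)])
  have "n \<noteq> 0" using nn by auto
  then have "dim T = CARD('n) - 1" unfolding T_def using dim_hyperplane[of n] by (simp add: inner_commute)
  then have cB: "card B = CARD('n) - 1" using B(6) by simp
  \<comment> \<open>The frame is indexed by the coordinates themselves; an arbitrary index is set
    aside for the normal.\<close>
  obtain i0 :: 'n where True by blast
  have "card (UNIV - {i0}) = card B" using cB by (simp add: card_Diff_singleton)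
  then obtain b where b: "bij_betw b (UNIV - {i0}) B"
    using B(5) finite_same_card_bij[of "UNIV - {i0}" B] by auto
  define e where "e = b(i0 := n)"
  have eb: "e i \<in> B" if "i \<noteq> i0" for i using b that by (auto simp: e_def bij_betw_def)
  have bB: "bij_betw e (UNIV - {i0}) B"
    using b by (rule bij_betw_cong[THEN iffD1, rotated]) (simp add: e_def)
  have e0: "e i0 = n" by (simp add: e_def)
  have orth: "e i \<bullet> e j = (if i = j then 1 else 0)" for i j
  proof -
    have eT: "e i \<bullet> n = 0" if "i \<noteq> i0" for i using eb[OF that] B(1) by (auto simp: T_def)
    have ne: "norm (e i) = 1" for i using eb[of i] B(3) nn e0 by (cases "i = i0") (auto simp: norm_eq_1)
    have inj: "e i \<noteq> e j" if "i \<noteq> i0" "j \<noteq> i0" "i \<noteq> j" for i j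
      using bB that by (auto simp: bij_betw_def inj_on_def)
    show ?thesis
    proof (cases "i = j")
      case True then show ?thesis using ne by (simp add: norm_eq_1)
    next
      case False
      then consider "i = i0" "j \<noteq> i0" | "j = i0" "i \<noteq> i0" | "i \<noteq> i0" "j \<noteq> i0" by blast
      then have "e i \<bullet> e j = 0"
      proof cases
        case 1 then show ?thesis using eT[of j] e0 by (simp add: inner_commute)
      next
        case 2 then show ?thesis using eT[of i] e0 by simp
      next
        case 3
        then show ?thesis using B(2) eb inj[OF 3 False] unfolding pairwise_def orthogonal_def by blast
      qed
      then show ?thesis using False by simp
    qed
  qed
  define k where "k i = \<kappa> (e i)" for i
  have curv': "principal_curvatures \<Omega> z = image_mset k (mset_set (UNIV - {i0}))"
  proof -
    have "mset_set B = image_mset e (mset_set (UNIV - {i0}))"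
      using bB by (metis bij_betw_def image_mset_mset_set)
    then show ?thesis unfolding curv k_def by (simp add: multiset.map_comp comp_def)
  qed
  have quad: "D w \<bullet> w / norm (g z) = - (\<Sum>i\<in>UNIV - {i0}. k i * (w \<bullet> e i)\<^sup>2)" if w: "w \<in> T" for w
  proof -
    have wexp: "w = (\<Sum>c\<in>B. (w \<bullet> c) *\<^sub>R c)"
      using orthonormal_basis_expand[OF B(2) B(3) _ B(5)] w B(4) by metis
    have "W w = W (\<Sum>c\<in>B. (w \<bullet> c) *\<^sub>R c)" using wexp by simp
    also have "\<dots> = (\<Sum>c\<in>B. (w \<bullet> c) *\<^sub>R (\<kappa> c *\<^sub>R c))"
      using linW B(7) by (simp add: linear_sum linear_scale)
    finally have "W w \<bullet> w = (\<Sum>c\<in>B. (w \<bullet> c) *\<^sub>R (\<kappa> c *\<^sub>R c)) \<bullet> w" by (rule arg_cong)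
    also have "\<dots> = (\<Sum>c\<in>B. (w \<bullet> c) * (\<kappa> c * (c \<bullet> w)))"
      by (simp only: inner_sum_left inner_scaleR_left)
    also have "\<dots> = (\<Sum>c\<in>B. \<kappa> c * (w \<bullet> c)\<^sup>2)"
      by (simp add: power2_eq_square inner_commute mult_ac)
    also have "\<dots> = (\<Sum>i\<in>UNIV - {i0}. k i * (w \<bullet> e i)\<^sup>2)"
      unfolding k_def by (rule sum.reindex_bij_betw[OF bB, symmetric])
    finally show ?thesis using W_in[OF w w] by simp
  qed
  have expansion: "\<exists>\<delta>>0. \<forall>u. norm u < \<delta> \<longrightarrow>
      (z + u \<in> closure \<Omega> \<longrightarrow> (\<Sum>i\<in>UNIV - {i0}. k i * (u \<bullet> e i)\<^sup>2) / 2 - \<epsilon> * ((norm u)\<^sup>2 + \<bar>u \<bullet> e i0\<bar>) \<le> u \<bullet> e i0) \<and>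
      (z + u \<notin> \<Omega> \<longrightarrow> u \<bullet> e i0 \<le> (\<Sum>i\<in>UNIV - {i0}. k i * (u \<bullet> e i)\<^sup>2) / 2 + \<epsilon> * ((norm u)\<^sup>2 + \<bar>u \<bullet> e i0\<bar>))"
    if \<epsilon>: "0 < \<epsilon>" for \<epsilon>
  proof -
    let ?g = "norm (g z)"
    have linD: "bounded_linear D" using gD has_derivative_bounded_linear by blast
    interpret D: bounded_linear D by fact
    obtain K where K: "0 < K" "\<And>w. norm (D w) \<le> norm w * K"
      using D.pos_bounded by blast
    have "0 < \<epsilon> * ?g" using \<epsilon> ng by simp
    then obtain \<delta>1 where \<delta>1: "0 < \<delta>1"
      "\<And>u. norm u < \<delta>1 \<Longrightarrow> \<bar>G (z + u) - G z - g z \<bullet> u - D u \<bullet> u / 2\<bar> \<le> \<epsilon> * ?g * (norm u)\<^sup>2"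
      using second_order_taylor[of G g D z "\<epsilon> * ?g"] G_deriv gD by metis
    obtain \<delta>2 where \<delta>2: "0 < \<delta>2" "ball z \<delta>2 \<subseteq> Z" using Z zZ openE by blast
    \<comment> \<open>Within this radius \<open>2 * K * |u| \<le> \<epsilon> * |g z|\<close>, which
      absorbs the mixed and purely normal part of the quadratic term.\<close>
    define \<delta>3 where "\<delta>3 = \<epsilon> * ?g / (2 * K)"
    have \<delta>3: "0 < \<delta>3" using \<epsilon> ng K by (simp add: \<delta>3_def)
    show ?thesis
    proof (intro exI[of _ "min \<delta>1 (min \<delta>2 \<delta>3)"] conjI allI impI)
      fix u :: "real^'n"
      assume u: "norm u < min \<delta>1 (min \<delta>2 \<delta>3)"
      define a where "a = u \<bullet> n"
      define w where "w = u - a *\<^sub>R n"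
      let ?q = "\<Sum>i\<in>UNIV - {i0}. k i * (u \<bullet> e i)\<^sup>2"
      have wT: "w \<in> T" by (simp add: w_def T_def a_def inner_diff_left nn)
      have q: "D w \<bullet> w / ?g = - ?q"
      proof -
        have "w \<bullet> e i = u \<bullet> e i" if "i \<noteq> i0" for i
          using orth[of i0 i] that by (simp add: w_def inner_diff_left e0)
        then show ?thesis unfolding quad[OF wT] by simp
      qed
      have au: "\<bar>a\<bar> \<le> norm u" using Cauchy_Schwarz_ineq2[of u n] nm nm1 by (simp add: a_def)
      have wu: "norm w \<le> norm u"
      proof -
        have "(norm w)\<^sup>2 = (norm u)\<^sup>2 - a\<^sup>2"
        proof -
          have "w \<bullet> w = w \<bullet> (u - a *\<^sub>R n)" by (simp only: w_def)
          also have "\<dots> = w \<bullet> u - a * (w \<bullet> n)" by (simp only: inner_diff_right inner_scaleR_right)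
          also have "w \<bullet> n = 0" using wT by (simp add: T_def)
          also have "w \<bullet> u = u \<bullet> u - a * (n \<bullet> u)" by (simp only: w_def inner_diff_left inner_scaleR_left)
          also have "n \<bullet> u = a" by (simp add: a_def inner_commute)
          finally show ?thesis unfolding power2_norm_eq_inner by (simp add: power2_eq_square)
        qed
        then have "(norm w)\<^sup>2 \<le> (norm u)\<^sup>2" by simp
        then show ?thesis by (rule power2_le_imp_le) simp
      qed
      have "D u \<bullet> u - D w \<bullet> w = a * (D n \<bullet> (u + w))"
      proof -
        have uw: "u = w + a *\<^sub>R n" by (simp add: w_def)
        have sw: "D w \<bullet> n = D n \<bullet> w" using Dsym[of w n] by (simp add: inner_commute)
        show ?thesis
        proof -
          have "D u = D w + a *\<^sub>R D n" by (subst uw) (simp only: D.add D.scaleR)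
          then have "D u \<bullet> u = D w \<bullet> u + a * (D n \<bullet> u)" by (simp only: inner_add_left inner_scaleR_left)
          also have "D w \<bullet> u = D w \<bullet> (w + a *\<^sub>R n)" using uw by (rule arg_cong)
          also have "\<dots> = D w \<bullet> w + a * (D n \<bullet> w)" by (simp only: inner_add_right inner_scaleR_right sw)
          finally show ?thesis by (simp add: inner_add_right algebra_simps)
        qed
      qed
      then have "\<bar>D u \<bullet> u - D w \<bullet> w\<bar> \<le> \<bar>a\<bar> * (norm (D n) * norm (u + w))"
        using Cauchy_Schwarz_ineq2[of "D n" "u + w"] by (simp add: abs_mult mult_left_mono)
      also have "\<dots> \<le> \<bar>a\<bar> * (K * (2 * norm u))"
        using K(2)[of n] nm nm1 norm_triangle_ineq[of u w] wu K(1)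
        by (intro mult_left_mono mult_mono) auto
      also have "\<dots> \<le> \<bar>a\<bar> * (\<epsilon> * ?g)"
      proof -
        have "norm u \<le> \<epsilon> * ?g / (2 * K)" using u by (simp add: \<delta>3_def)
        then have "K * (2 * norm u) \<le> \<epsilon> * ?g" using K(1) by (simp add: field_simps)
        then show ?thesis by (rule mult_left_mono) simp
      qed
      finally have dd: "\<bar>D u \<bullet> u - D w \<bullet> w\<bar> \<le> \<epsilon> * ?g * \<bar>a\<bar>" by (simp add: mult_ac)
      have gu: "g z \<bullet> u = ?g * a" by (subst gn) (simp add: a_def inner_commute)
      have "\<bar>G (z + u) - ?g * a - D u \<bullet> u / 2\<bar> \<le> \<epsilon> * ?g * (norm u)\<^sup>2"
        using \<delta>1(2)[of u] u Gz gu by simp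
      then have "\<bar>G (z + u) - ?g * a - D w \<bullet> w / 2\<bar> \<le> \<epsilon> * ?g * (norm u)\<^sup>2 + \<epsilon> * ?g * \<bar>a\<bar>"
        using dd by linarith
      also have "D w \<bullet> w = - ?g * ?q" using q ng by (simp add: field_simps)
      finally have est: "\<bar>G (z + u) - ?g * a - (- ?g * ?q) / 2\<bar> \<le> \<epsilon> * ?g * (norm u)\<^sup>2 + \<epsilon> * ?g * \<bar>a\<bar>" .
      have uZ: "z + u \<in> Z" using \<delta>2(2) u by (auto simp: dist_norm)
      have cancel: "A \<le> C" if "?g * A \<le> ?g * C" for A C
        using that ng by simp
      show "?q / 2 - \<epsilon> * ((norm u)\<^sup>2 + \<bar>u \<bullet> e i0\<bar>) \<le> u \<bullet> e i0" if "z + u \<in> closure \<Omega>"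
      proof -
        have "0 \<le> G (z + u)" using closure_imp[OF uZ that] .
        then have "?g * (?q / 2 - \<epsilon> * ((norm u)\<^sup>2 + \<bar>a\<bar>)) \<le> ?g * a"
          using est by (simp add: algebra_simps)
        then show ?thesis using cancel unfolding e0 a_def by blast
      qed
      show "u \<bullet> e i0 \<le> ?q / 2 + \<epsilon> * ((norm u)\<^sup>2 + \<bar>u \<bullet> e i0\<bar>)" if "z + u \<notin> \<Omega>"
      proof -
        have "G (z + u) \<le> 0" using S_iff[OF uZ] that by auto
        then have "?g * a \<le> ?g * (?q / 2 + \<epsilon> * ((norm u)\<^sup>2 + \<bar>a\<bar>))"
          using est by (simp add: algebra_simps)
        then show ?thesis using cancel unfolding e0 a_def by blast
      qed
    qed (use \<delta>1 \<delta>2 \<delta>3 in auto)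
  qed
  show thesis
    by (rule that[OF orth _ curv' expansion]) (simp_all add: e0 nm m_def)
qed

subsection \<open>Blow-up at the contact point\<close>

lemma orthonormal_frame_expand:
  fixes e :: "'n::finite \<Rightarrow> real^'n"
  assumes orth: "\<And>i j. e i \<bullet> e j = (if i = j then 1 else 0)"
  shows "p = (\<Sum>i\<in>UNIV. (p \<bullet> e i) *\<^sub>R e i)"
proof -
  have inj: "inj e"
  proof (rule injI)
    fix i j assume "e i = e j"
    then have "e i \<bullet> e j = 1" using orth[of j j] by simp
    then show "i = j" using orth[of i j] by (auto split: if_splits)
  qed
  have ne: "norm (e i) = 1" for i using orth[of i i] by (simp add: norm_eq_1)
  have po: "pairwise orthogonal (range e)"
    unfolding pairwise_def orthogonal_def using orth inj by (auto simp: inj_def)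
  have "0 \<notin> range e" using ne by (metis imageE norm_zero zero_neq_one)
  then have ind: "independent (range e)" using po pairwise_orthogonal_independent by blast
  have "card (range e) = CARD('n)" using inj by (simp add: card_image)
  then have "UNIV \<subseteq> span (range e)" using ind by (intro card_ge_dim_independent) auto
  then have "p \<in> span (range e)" by blast
  then have "(\<Sum>b\<in>range e. (p \<bullet> b) *\<^sub>R b) = p"
    by (intro orthonormal_basis_expand[OF po]) (use ne in auto)
  then show ?thesis using inj by (simp add: sum.reindex)
qed

lemma orthonormal_frame_norm:
  fixes e :: "'n::finite \<Rightarrow> real^'n"
  assumes orth: "\<And>i j. e i \<bullet> e j = (if i = j then 1 else 0)"
  shows "(norm p)\<^sup>2 = (\<Sum>i\<in>UNIV. (p \<bullet> e i)\<^sup>2)"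
proof -
  have "p \<bullet> p = (\<Sum>i\<in>UNIV. (p \<bullet> e i) *\<^sub>R e i) \<bullet> p"
    by (rule arg_cong[OF orthonormal_frame_expand[OF orth]])
  also have "\<dots> = (\<Sum>i\<in>UNIV. (p \<bullet> e i) * (e i \<bullet> p))" by (simp only: inner_sum_left inner_scaleR_left)
  also have "\<dots> = (\<Sum>i\<in>UNIV. (p \<bullet> e i)\<^sup>2)" by (simp add: power2_eq_square inner_commute)
  finally show ?thesis unfolding power2_norm_eq_inner .
qed

text \<open>Here \<open>e i0\<close> is the inward normal at \<open>z\<close>, the other
  \<open>e i\<close> are principal directions, and \<open>k i\<close> are their curvatures.
  Everything about the domain that the asymptotics need is in \<open>touch\<close> and the two-sided
  \<open>expansion\<close>.\<close>

locale touching_ball = pucci_solution F \<Omega> v l L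
  for F :: "real^'n^'n \<Rightarrow> real" and \<Omega> v l L +
  fixes e :: "'n \<Rightarrow> real^'n" and i0 :: 'n and k :: "'n \<Rightarrow> real" and x z :: "real^'n" and R :: real
  assumes orth: "\<And>i j. e i \<bullet> e j = (if i = j then 1 else 0)"
    and R: "0 < R" and x_eq: "x = z + R *\<^sub>R e i0" and ball_sub: "ball x R \<subseteq> \<Omega>"
    and touch: "cball x R \<inter> (- \<Omega>) = {z}"
    and k_less: "\<And>i. i \<noteq> i0 \<Longrightarrow> k i < 1 / R"
    and expansion: "\<And>\<epsilon>. 0 < \<epsilon> \<Longrightarrow> \<exists>\<delta>>0. \<forall>u. norm u < \<delta> \<longrightarrow>
      (z + u \<in> closure \<Omega> \<longrightarrow> (\<Sum>i\<in>UNIV - {i0}. k i * (u \<bullet> e i)\<^sup>2) / 2 - \<epsilon> * ((norm u)\<^sup>2 + \<bar>u \<bullet> e i0\<bar>) \<le> u \<bullet> e i0) \<and>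
      (z + u \<notin> \<Omega> \<longrightarrow> u \<bullet> e i0 \<le> (\<Sum>i\<in>UNIV - {i0}. k i * (u \<bullet> e i)\<^sup>2) / 2 + \<epsilon> * ((norm u)\<^sup>2 + \<bar>u \<bullet> e i0\<bar>))"
begin

lemma norm_e: "norm (e i) = 1"
  using orth[of i i] by (simp add: norm_eq_1)

lemma norm_split: "(norm p)\<^sup>2 = (p \<bullet> e i0)\<^sup>2 + (\<Sum>i\<in>UNIV - {i0}. (p \<bullet> e i)\<^sup>2)"
  unfolding orthonormal_frame_norm[OF orth, of p] by (simp add: sum.remove[of UNIV i0])

lemma dist_x: "(dist x (z + p))\<^sup>2 = R\<^sup>2 + ((norm p)\<^sup>2 - 2 * R * (p \<bullet> e i0))"
proof -
  have "x - (z + p) = R *\<^sub>R e i0 - p" by (simp add: x_eq)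
  then show ?thesis unfolding dist_norm power2_norm_eq_inner using orth[of i0 i0]
    by (simp add: inner_diff_left inner_diff_right inner_commute power2_eq_square algebra_simps)
qed

lemma in_ball_iff: "z + p \<in> ball x R \<longleftrightarrow> (norm p)\<^sup>2 < 2 * R * (p \<bullet> e i0)"
proof -
  have "z + p \<in> ball x R \<longleftrightarrow> (dist x (z + p))\<^sup>2 < R\<^sup>2"
    using R by (auto simp: power2_less_imp_less intro: power_strict_mono)
  then show ?thesis unfolding dist_x by simp
qed

lemma e0_le_norm: "\<bar>p \<bullet> e i\<bar> \<le> norm p"
  using Cauchy_Schwarz_ineq2[of p "e i"] norm_e by simp

text \<open>A point of the ball at height \<open>a\<close> over the tangent plane at
  \<open>z\<close> has distance at least \<open>c * a\<close> to the complement of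
  \<open>\<Omega>\<close>. Away from \<open>z\<close> this is compactness; near \<open>z\<close> it
  expresses that the frontier curves strictly less than the sphere. It provides the radius for the
  Gaussian bound.\<close>

lemma interior_distance:
  obtains c where "0 < c" "\<And>y. y \<in> ball x R \<Longrightarrow> cball y (c * ((y - z) \<bullet> e i0)) \<subseteq> \<Omega>"
proof -
  \<comment> \<open>A uniform gap for the finitely many strict inequalities; inserting 1 in the set
    gives \<open>\<theta> \<le> 1\<close> and makes the minimum meaningful even without tangential
    directions.\<close>
  obtain \<theta> where \<theta>: "0 < \<theta>" "\<theta> \<le> 1" "\<And>i. i \<noteq> i0 \<Longrightarrow> k i \<le> (1 - \<theta>) / R"
  proof -
    define A where "A = insert 1 ((\<lambda>i. 1 - R * k i) ` (UNIV - {i0}))"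
    have fin: "finite A" "A \<noteq> {}" by (auto simp: A_def)
    have lt: "R * k i < 1" if "i \<noteq> i0" for i
      using k_less[OF that] R by (simp add: field_simps)
    have pos: "0 < a" if "a \<in> A" for a
      using that lt by (force simp: A_def)
    have "0 < Min A" using fin pos by simp
    moreover have "Min A \<le> 1" using fin by (intro Min_le) (auto simp: A_def)
    moreover have "k i \<le> (1 - Min A) / R" if "i \<noteq> i0" for i
    proof -
      have "Min A \<le> 1 - R * k i" using fin that by (intro Min_le) (auto simp: A_def)
      then show ?thesis using R by (simp add: field_simps)
    qed
    ultimately show thesis using that by blast
  qed
  \<comment> \<open>The error of the expansion turns out to be at most
    \<open>\<epsilon> * (8 * R + 2) * a\<close>, so this choice limits it to
    \<open>\<theta> / 4\<close> times \<open>a\<close>.\<close>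
  define \<epsilon> where "\<epsilon> = \<theta> / (4 * (8 * R + 2))"
  have \<epsilon>: "0 < \<epsilon>" using \<theta> R by (simp add: \<epsilon>_def)
  obtain \<delta> where \<delta>: "0 < \<delta>" "\<And>u. norm u < \<delta> \<Longrightarrow> z + u \<notin> \<Omega> \<Longrightarrow>
      u \<bullet> e i0 \<le> (\<Sum>i\<in>UNIV - {i0}. k i * (u \<bullet> e i)\<^sup>2) / 2 + \<epsilon> * ((norm u)\<^sup>2 + \<bar>u \<bullet> e i0\<bar>)"
    using expansion[OF \<epsilon>] by blast
  \<comment> \<open>The part of the closed ball away from the contact point is a compact subset of
    \<open>\<Omega>\<close>, hence has a uniform distance to the complement.\<close>
  define C where "C = cball x R - ball z (\<delta> / 2)"
  have "compact C" unfolding C_def by (simp add: compact_diff)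
  moreover have "C \<subseteq> \<Omega>"
  proof
    fix y assume "y \<in> C"
    then have "y \<in> cball x R" "y \<noteq> z" using \<delta>(1) by (auto simp: C_def)
    then show "y \<in> \<Omega>" using touch by blast
  qed
  ultimately obtain d0 where d0: "0 < d0" "(\<Union>y\<in>C. ball y d0) \<subseteq> \<Omega>"
    using compact_subset_open_imp_ball_epsilon_subset[of C \<Omega>] op by blast
  \<comment> \<open>The second bound serves the points away from \<open>z\<close>, whose height is
    below \<open>2 * R\<close>; the first serves those near \<open>z\<close>.\<close>
  define c where "c = min (\<theta> / 16) (d0 / (4 * R))"
  have c: "0 < c" "c \<le> \<theta> / 16" "c \<le> d0 / (4 * R)" "c \<le> 1" using \<theta> d0 R by (auto simp: c_def)
  show thesis
  proof (rule that[OF c(1)])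
    fix y assume y: "y \<in> ball x R"
    define p where "p = y - z"
    define a where "a = p \<bullet> e i0"
    have yp: "y = z + p" by (simp add: p_def)
    have np: "(norm p)\<^sup>2 < 2 * R * a" using y unfolding yp in_ball_iff a_def .
    then have a0: "0 < a" using R by (smt (verit) mult_nonneg_nonpos zero_le_power2)
    have an: "a \<le> norm p" using e0_le_norm[of p i0] by (simp add: a_def)
    have pR: "norm p < 2 * R"
    proof -
      have "norm p * norm p < 2 * R * norm p" using np an R by (smt (verit) mult_left_mono power2_eq_square)
      then show ?thesis using a0 an by (simp add: mult_less_cancel_right)
    qed
    show "cball y (c * ((y - z) \<bullet> e i0)) \<subseteq> \<Omega>"
    proof
      fix y' assume "y' \<in> cball y (c * ((y - z) \<bullet> e i0))"
      then have y': "norm (y' - y) \<le> c * a" by (simp add: a_def p_def dist_norm norm_minus_commute)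
      show "y' \<in> \<Omega>"
      proof (cases "norm p < \<delta> / 2")
        case False
        then have "y \<in> C" using y by (auto simp: C_def p_def dist_norm norm_minus_commute)
        moreover have "c * a < d0"
        proof -
          have "c * a \<le> d0 / (4 * R) * a" using c a0 by (intro mult_right_mono) auto
          also have "\<dots> < d0 / (4 * R) * (4 * R)" using an pR R d0 by (intro mult_strict_left_mono) auto
          finally show ?thesis using R by simp
        qed
        moreover from this have "y' \<in> ball y d0" using y' by (simp add: dist_norm norm_minus_commute)
        ultimately show ?thesis using d0(2) by blast
      next
        case True
        define p' where "p' = y' - z"
        define q where "q = y' - y"
        have pq: "p' = p + q" by (simp add: p'_def p_def q_def)
        have nq: "norm q \<le> c * a" using y' by (simp add: q_def)
        have "c * a \<le> 1 * a" using c a0 by (intro mult_right_mono) auto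
        then have "norm p' < \<delta>" using norm_triangle_ineq[of p q] nq an True unfolding pq by linarith
        show ?thesis
        proof (rule ccontr)
          assume "y' \<notin> \<Omega>"
          then have "z + p' \<notin> \<Omega>" by (simp add: p'_def)
          from \<delta>(2)[OF \<open>norm p' < \<delta>\<close> this]
          have 1: "p' \<bullet> e i0 \<le> (\<Sum>i\<in>UNIV - {i0}. k i * (p' \<bullet> e i)\<^sup>2) / 2 + \<epsilon> * ((norm p')\<^sup>2 + \<bar>p' \<bullet> e i0\<bar>)" .
          have "(\<Sum>i\<in>UNIV - {i0}. k i * (p' \<bullet> e i)\<^sup>2) \<le> (\<Sum>i\<in>UNIV - {i0}. (1 - \<theta>) / R * (p' \<bullet> e i)\<^sup>2)"
            using \<theta>(3) by (intro sum_mono mult_right_mono) auto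
          also have "\<dots> = (1 - \<theta>) / R * (\<Sum>i\<in>UNIV - {i0}. (p' \<bullet> e i)\<^sup>2)" by (simp add: sum_distrib_left)
          also have "\<dots> \<le> (1 - \<theta>) / R * (norm p')\<^sup>2"
            unfolding norm_split[of p'] using \<theta>(2) R by (intro mult_left_mono) auto
          finally have 2: "(\<Sum>i\<in>UNIV - {i0}. k i * (p' \<bullet> e i)\<^sup>2) / 2 \<le> (1 - \<theta>) / (2 * R) * (norm p')\<^sup>2" by simp
          have 3: "(norm p')\<^sup>2 \<le> a * (2 * R * (1 + 3 * c))"
          proof -
            have "norm p' \<le> norm p + c * a" using norm_triangle_ineq[of p q] nq unfolding pq by linarith
            then have "(norm p')\<^sup>2 \<le> (norm p + c * a)\<^sup>2" by (intro power_mono) auto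
            also have "\<dots> = (norm p)\<^sup>2 + 2 * (c * a) * norm p + (c * a) * (c * a)" by (simp add: power2_eq_square algebra_simps)
            also have "\<dots> \<le> 2 * R * a + 2 * (c * a) * (2 * R) + (c * a) * (2 * R)"
            proof -
              have "2 * (c * a) * norm p \<le> 2 * (c * a) * (2 * R)" using c a0 pR by (intro mult_left_mono) auto
              moreover have "c * a \<le> 2 * R" using \<open>c * a \<le> 1 * a\<close> an pR by linarith
              then have "(c * a) * (c * a) \<le> (c * a) * (2 * R)" using c a0 by (intro mult_left_mono) auto
              ultimately show ?thesis using np by linarith
            qed
            also have "\<dots> = a * (2 * R * (1 + 3 * c))" by (simp add: algebra_simps)
            finally show ?thesis .
          qed
          have qe: "\<bar>q \<bullet> e i0\<bar> \<le> c * a" using e0_le_norm[of q i0] nq by linarith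
          have 4: "a * (1 - c) \<le> p' \<bullet> e i0" "\<bar>p' \<bullet> e i0\<bar> \<le> a * 2"
            using qe \<open>c * a \<le> 1 * a\<close> a0
            unfolding pq inner_add_left a_def[symmetric] right_diff_distrib mult.commute[of a c] by linarith+
          have "a * (1 - c) \<le> (1 - \<theta>) / (2 * R) * (norm p')\<^sup>2 + \<epsilon> * ((norm p')\<^sup>2 + \<bar>p' \<bullet> e i0\<bar>)"
            using 1 2 4 by linarith
          also have "\<dots> \<le> (1 - \<theta>) / (2 * R) * (a * (2 * R * (1 + 3 * c))) + \<epsilon> * (a * (2 * R * (1 + 3 * c)) + a * 2)"
            using 3 4 \<theta>(2) R \<epsilon> by (intro add_mono mult_left_mono) auto
          also have "\<dots> = a * ((1 - \<theta>) * (1 + 3 * c) + \<epsilon> * (2 * R * (1 + 3 * c) + 2))"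
            using R by (simp add: field_simps)
          finally have "1 - c \<le> (1 - \<theta>) * (1 + 3 * c) + \<epsilon> * (2 * R * (1 + 3 * c) + 2)" using a0 by simp
          moreover have "\<epsilon> * (2 * R * (1 + 3 * c) + 2) \<le> \<epsilon> * (8 * R + 2)"
          proof -
            have "R * c \<le> R * 1" using R c by (intro mult_left_mono) auto
            then show ?thesis using \<epsilon> by (intro mult_left_mono) (auto simp: algebra_simps)
          qed
          moreover have "\<epsilon> * (8 * R + 2) = \<theta> / 4"
          proof -
            have "\<theta> / (4 * X) * X = \<theta> / 4" if "X \<noteq> 0" for X using that by simp
            then show ?thesis unfolding \<epsilon>_def using R by (metis add_pos_pos less_irrefl mult_pos_pos zero_less_numeral)
          qed
          moreover have "(1 - \<theta>) * (1 + 3 * c) \<le> 1 - \<theta> + 3 * c" using \<theta> c by (simp add: algebra_simps)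
          \<comment> \<open>The inequalities give
            \<open>1 - c \<le> 1 - \<theta> + 3 * c + \<theta> / 4\<close>, that is
            \<open>4 * c \<ge> 3 * \<theta> / 4\<close>, whereas
            \<open>c \<le> \<theta> / 16\<close>.\<close>
          ultimately show False using c \<theta> by linarith
        qed
      qed
    qed
  qed
qed

text \<open>
  Coordinates \<open>u\<close> at the contact point: \<open>u $ i0\<close> is normal, the others are tangential. The widths are chosen such that
  in the limit the ball becomes the region \<open>rho u < height u\<close>, with \<open>rho\<close> a plain sum of squares and
  \<open>height\<close> the distance to the limiting boundary.
\<close>

definition width :: "'n \<Rightarrow> real" where "width i = sqrt (2 / (1 / R - k i))"

definition curv_form :: "real^'n \<Rightarrow> real" where
  "curv_form u = (\<Sum>i\<in>UNIV - {i0}. k i * (width i * u $ i)\<^sup>2) / 2"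

definition rho :: "real^'n \<Rightarrow> real" where
  "rho u = (\<Sum>i\<in>UNIV - {i0}. (u $ i)\<^sup>2)"

definition height :: "real^'n \<Rightarrow> real" where
  "height u = u $ i0 - curv_form u"

definition blowup :: "real \<Rightarrow> real^'n \<Rightarrow> real^'n" where
  "blowup h u = (\<Sum>i\<in>UNIV. ((if i = i0 then h\<^sup>2 else h * width i) * u $ i) *\<^sub>R e i)"

lemma width_sq: "i \<noteq> i0 \<Longrightarrow> (width i)\<^sup>2 * (1 / R - k i) = 2"
proof -
  assume "i \<noteq> i0"
  then have "0 < 1 / R - k i" using k_less by simp
  moreover have "(sqrt (2 / d))\<^sup>2 * d = 2" if "0 < d" for d :: real
    using that by simp
  ultimately show ?thesis unfolding width_def by blast
qed

lemma width_pos: "i \<noteq> i0 \<Longrightarrow> 0 < width i"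
  using k_less[of i] by (simp add: width_def)

lemma blowup_inner: "blowup h u \<bullet> e i = (if i = i0 then h\<^sup>2 else h * width i) * u $ i"
proof -
  have "blowup h u \<bullet> e i = (\<Sum>j\<in>UNIV. (if j = i then (if j = i0 then h\<^sup>2 else h * width j) * u $ j else 0))"
    unfolding blowup_def inner_sum_left by (rule sum.cong) (auto simp: orth)
  then show ?thesis by simp
qed

text \<open>The origin of the widths: the right-hand side is the rise of the osculating paraboloid
  of the sphere over the tangent plane, and \<open>curv_form\<close> is that of the frontier. The
  gap between them becomes the plain sum of squares \<open>rho\<close>.\<close>

lemma rho_curv_form: "rho u + curv_form u = (\<Sum>i\<in>UNIV - {i0}. (width i * u $ i)\<^sup>2) / (2 * R)"
proof -
  have "(u $ i)\<^sup>2 + k i * (width i * u $ i)\<^sup>2 / 2 = (width i * u $ i)\<^sup>2 / (2 * R)" if "i \<noteq> i0" for i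
  proof -
    have "(u $ i)\<^sup>2 = (width i)\<^sup>2 * (1 / R - k i) * (u $ i)\<^sup>2 / 2" using width_sq[OF that] by simp
    then show ?thesis by (simp add: power_mult_distrib algebra_simps)
  qed
  then show ?thesis unfolding rho_def curv_form_def sum_divide_distrib sum.distrib[symmetric]
    by (intro sum.cong) auto
qed

text \<open>The term with \<open>h^2\<close> is the deviation of the sphere from its osculating
  paraboloid. It vanishes in the limit, and since it is nonnegative every blown-up ball lies inside
  the limit region.\<close>

lemma blowup_in_ball_iff:
  assumes h: "0 < h"
  shows "z + blowup h u \<in> ball x R \<longleftrightarrow> h\<^sup>2 * (u $ i0)\<^sup>2 / (2 * R) + rho u < height u"
proof -
  have n: "(norm (blowup h u))\<^sup>2 = h\<^sup>2 * (h\<^sup>2 * (u $ i0)\<^sup>2 + (\<Sum>i\<in>UNIV - {i0}. (width i * u $ i)\<^sup>2))"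
    unfolding norm_split blowup_inner by (simp add: power_mult_distrib sum_distrib_left power2_eq_square algebra_simps)
  have s: "(\<Sum>i\<in>UNIV - {i0}. (width i * u $ i)\<^sup>2) = 2 * R * (rho u + curv_form u)" using rho_curv_form[of u] R by simp
  have "z + blowup h u \<in> ball x R \<longleftrightarrow> h\<^sup>2 * (h\<^sup>2 * (u $ i0)\<^sup>2 + 2 * R * (rho u + curv_form u)) < h\<^sup>2 * (2 * R * u $ i0)"
    unfolding in_ball_iff n s blowup_inner by (simp add: mult_ac)
  also have "\<dots> \<longleftrightarrow> h\<^sup>2 * (u $ i0)\<^sup>2 + 2 * R * (rho u + curv_form u) < 2 * R * u $ i0"
    using h by (simp add: mult.assoc)
  also have "\<dots> \<longleftrightarrow> h\<^sup>2 * (u $ i0)\<^sup>2 / (2 * R) + rho u < height u"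
    unfolding height_def using R by (simp add: field_simps)
  finally show ?thesis .
qed

lemma rho_nonneg: "0 \<le> rho u"
  by (simp add: rho_def sum_nonneg)

text \<open>A tangential displacement of order \<open>h^2\<close> from a point at tangential
  distance of order \<open>h\<close> changes the quadratic form only by \<open>O(h^3)\<close>.
  Relative to \<open>h^2\<close> the frontier is thus asymptotically a plane, squeezed between two
  planes at distance \<open>2 * h^2 * \<eta>\<close>, as the flat barriers require.\<close>

lemma blowup_geometry:
  assumes K: "0 < K" and \<eta>: "0 < \<eta>"
  shows "eventually (\<lambda>h. \<forall>y. norm (y - (z + blowup h u)) \<le> K * h\<^sup>2 \<longrightarrow>
      (y \<in> closure \<Omega> \<longrightarrow> z \<bullet> e i0 + h\<^sup>2 * (curv_form u - \<eta>) < y \<bullet> e i0) \<and>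
      (y \<notin> \<Omega> \<longrightarrow> y \<bullet> e i0 < z \<bullet> e i0 + h\<^sup>2 * (curv_form u + \<eta>))) (at_right 0)"
proof -
  let ?I = "UNIV - {i0}"
  \<comment> \<open>With \<open>p\<close> the position relative to \<open>z\<close>, the constants
    \<open>C1\<close>, \<open>C0\<close>, \<open>C2\<close> will bound \<open>|p| / h\<close>,
    \<open>|p \<bullet> e i0| / h^2\<close>, and the change of the quadratic form divided by
    \<open>h^3\<close>.\<close>
  define C1 where "C1 = norm (u $ i0 *\<^sub>R e i0) + (\<Sum>i\<in>?I. norm ((width i * u $ i) *\<^sub>R e i)) + K"
  define C0 where "C0 = \<bar>u $ i0\<bar> + K"
  define C2 where "C2 = (\<Sum>i\<in>?I. \<bar>k i\<bar> * (2 * \<bar>width i * u $ i\<bar> * K + K\<^sup>2))"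
  define C3 where "C3 = C1\<^sup>2 + C0"
  have C1: "0 < C1" unfolding C1_def using K by (intro add_nonneg_pos add_nonneg_nonneg sum_nonneg) auto
  have C0: "0 < C0" unfolding C0_def using K by simp
  have C2: "0 \<le> C2" unfolding C2_def using K by (intro sum_nonneg mult_nonneg_nonneg) auto
  have C3: "0 < C3" unfolding C3_def using C0 by (simp add: add_nonneg_pos)
  \<comment> \<open>The remainder of the expansion may use \<open>\<eta> / 3\<close> and the
    quadratic form \<open>\<eta> / 2\<close>; what is left makes the inequalities strict.\<close>
  define \<epsilon> where "\<epsilon> = \<eta> / (3 * C3)"
  have \<epsilon>: "0 < \<epsilon>" using \<eta> C3 by (simp add: \<epsilon>_def)
  obtain \<delta> where \<delta>: "0 < \<delta>" and exp1: "\<And>p. norm p < \<delta> \<Longrightarrow> z + p \<in> closure \<Omega> \<Longrightarrow>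
       (\<Sum>i\<in>?I. k i * (p \<bullet> e i)\<^sup>2) / 2 - \<epsilon> * ((norm p)\<^sup>2 + \<bar>p \<bullet> e i0\<bar>) \<le> p \<bullet> e i0"
    and exp2: "\<And>p. norm p < \<delta> \<Longrightarrow> z + p \<notin> \<Omega> \<Longrightarrow>
       p \<bullet> e i0 \<le> (\<Sum>i\<in>?I. k i * (p \<bullet> e i)\<^sup>2) / 2 + \<epsilon> * ((norm p)\<^sup>2 + \<bar>p \<bullet> e i0\<bar>)"
    using expansion[OF \<epsilon>] by blast
  define h0 where "h0 = min 1 (min (\<delta> / (2 * C1)) (\<eta> / (C2 + 1)))"
  have h0: "0 < h0" using \<delta> C1 \<eta> C2 by (simp add: h0_def add_nonneg_pos)
  have main: "(y \<in> closure \<Omega> \<longrightarrow> z \<bullet> e i0 + h\<^sup>2 * (curv_form u - \<eta>) < y \<bullet> e i0) \<and>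
      (y \<notin> \<Omega> \<longrightarrow> y \<bullet> e i0 < z \<bullet> e i0 + h\<^sup>2 * (curv_form u + \<eta>))"
    if h: "0 < h" "h < h0" and y: "norm (y - (z + blowup h u)) \<le> K * h\<^sup>2" for h y
  proof -
    have h1: "h \<le> 1" "h < \<delta> / (2 * C1)" "h < \<eta> / (C2 + 1)" using h by (auto simp: h0_def)
    define q where "q = y - (z + blowup h u)"
    define p where "p = blowup h u + q"
    have yp: "y = z + p" by (simp add: p_def q_def)
    have hh: "h\<^sup>2 \<le> h" using h h1 by (simp add: power2_eq_square mult_left_le)
    have nq: "norm q \<le> K * h\<^sup>2" using y by (simp add: q_def)
    have qi: "\<bar>q \<bullet> e i\<bar> \<le> K * h\<^sup>2" for i using e0_le_norm[of q i] nq by linarith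
    have nA: "norm (blowup h u) \<le> h * (norm (u $ i0 *\<^sub>R e i0) + (\<Sum>i\<in>?I. norm ((width i * u $ i) *\<^sub>R e i)))"
    proof -
      have "blowup h u = (h\<^sup>2 * u $ i0) *\<^sub>R e i0 + (\<Sum>i\<in>?I. (h * width i * u $ i) *\<^sub>R e i)"
        unfolding blowup_def by (simp add: sum.remove[of UNIV i0])
      then have "norm (blowup h u) \<le> norm ((h\<^sup>2 * u $ i0) *\<^sub>R e i0) + (\<Sum>i\<in>?I. norm ((h * width i * u $ i) *\<^sub>R e i))"
        using norm_triangle_ineq[of "(h\<^sup>2 * u $ i0) *\<^sub>R e i0"] norm_sum[of "\<lambda>i. (h * width i * u $ i) *\<^sub>R e i" ?I]
        by (smt (verit))
      also have "norm ((h\<^sup>2 * u $ i0) *\<^sub>R e i0) \<le> h * norm (u $ i0 *\<^sub>R e i0)"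
        using hh by (simp add: abs_mult mult_right_mono norm_e)
      also have "(\<Sum>i\<in>?I. norm ((h * width i * u $ i) *\<^sub>R e i)) = h * (\<Sum>i\<in>?I. norm ((width i * u $ i) *\<^sub>R e i))"
        using h by (simp add: sum_distrib_left abs_mult mult_ac norm_e)
      finally show ?thesis by (simp add: distrib_left)
    qed
    have np: "norm p \<le> h * C1"
    proof -
      have "K * h\<^sup>2 \<le> h * K" using hh K by (simp add: mult.commute mult_left_mono)
      then show ?thesis using norm_triangle_ineq[of "blowup h u" q] nA nq
        unfolding p_def C1_def distrib_left by linarith
    qed
    have "h * C1 < \<delta>"
    proof -
      have "h * C1 < \<delta> / (2 * C1) * C1" using h1(2) C1 by (intro mult_strict_right_mono) auto
      also have "\<dots> = \<delta> / 2" using C1 by simp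
      finally show ?thesis using \<delta> by simp
    qed
    then have pd: "norm p < \<delta>" using np by simp
    have p0: "\<bar>p \<bullet> e i0\<bar> \<le> h\<^sup>2 * C0"
    proof -
      have "p \<bullet> e i0 = h\<^sup>2 * u $ i0 + q \<bullet> e i0" by (simp add: p_def inner_add_left blowup_inner)
      then have "\<bar>p \<bullet> e i0\<bar> \<le> \<bar>h\<^sup>2 * u $ i0\<bar> + K * h\<^sup>2" using qi[of i0] by linarith
      then show ?thesis by (simp add: C0_def abs_mult algebra_simps)
    qed
    have rem: "\<epsilon> * ((norm p)\<^sup>2 + \<bar>p \<bullet> e i0\<bar>) \<le> h\<^sup>2 * (\<eta> / 3)"
    proof -
      have "(norm p)\<^sup>2 \<le> (h * C1)\<^sup>2" using np by (intro power_mono) auto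
      then have "(norm p)\<^sup>2 + \<bar>p \<bullet> e i0\<bar> \<le> h\<^sup>2 * C3" using p0 by (simp add: C3_def power_mult_distrib distrib_left)
      then have "\<epsilon> * ((norm p)\<^sup>2 + \<bar>p \<bullet> e i0\<bar>) \<le> \<epsilon> * (h\<^sup>2 * C3)" using \<epsilon> by simp
      also have "\<dots> = h\<^sup>2 * (\<eta> / 3)" using C3 by (simp add: \<epsilon>_def)
      finally show ?thesis .
    qed
    have quad: "\<bar>(\<Sum>i\<in>?I. k i * (p \<bullet> e i)\<^sup>2) / 2 - h\<^sup>2 * curv_form u\<bar> \<le> h\<^sup>2 * (\<eta> / 2)"
    proof -
      have "(\<Sum>i\<in>?I. k i * (p \<bullet> e i)\<^sup>2) - 2 * (h\<^sup>2 * curv_form u)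
          = (\<Sum>i\<in>?I. k i * (2 * (h * width i * u $ i) * (q \<bullet> e i) + (q \<bullet> e i)\<^sup>2))"
        unfolding curv_form_def sum_distrib_left sum_divide_distrib sum_subtractf[symmetric]
        by (rule sum.cong) (auto simp: p_def inner_add_left blowup_inner power2_eq_square algebra_simps)
      also have "\<bar>\<dots>\<bar> \<le> (\<Sum>i\<in>?I. h\<^sup>2 * h * (\<bar>k i\<bar> * (2 * \<bar>width i * u $ i\<bar> * K + K\<^sup>2)))"
      proof (rule order_trans[OF sum_abs], rule sum_mono)
        fix i
        have a: "\<bar>2 * (h * width i * u $ i) * (q \<bullet> e i)\<bar> \<le> h\<^sup>2 * h * (2 * \<bar>width i * u $ i\<bar> * K)"
        proof -
          have "\<bar>2 * (h * width i * u $ i) * (q \<bullet> e i)\<bar> = 2 * h * \<bar>width i * u $ i\<bar> * \<bar>q \<bullet> e i\<bar>"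
            using h by (simp add: abs_mult)
          also have "\<dots> \<le> 2 * h * \<bar>width i * u $ i\<bar> * (K * h\<^sup>2)" using h qi by (intro mult_left_mono) auto
          finally show ?thesis by (simp add: mult_ac)
        qed
        have b: "(q \<bullet> e i)\<^sup>2 \<le> h\<^sup>2 * h * K\<^sup>2"
        proof -
          have "(q \<bullet> e i)\<^sup>2 = \<bar>q \<bullet> e i\<bar>\<^sup>2" by simp
          also have "\<dots> \<le> (K * h\<^sup>2)\<^sup>2" using qi by (intro power_mono) auto
          also have "\<dots> = h\<^sup>2 * h\<^sup>2 * K\<^sup>2" by (simp add: power_mult_distrib power2_eq_square mult_ac)
          also have "\<dots> \<le> h\<^sup>2 * h * K\<^sup>2" using hh by (intro mult_right_mono mult_left_mono) auto
          finally show ?thesis .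
        qed
        have "\<bar>2 * (h * width i * u $ i) * (q \<bullet> e i) + (q \<bullet> e i)\<^sup>2\<bar> \<le> h\<^sup>2 * h * (2 * \<bar>width i * u $ i\<bar> * K + K\<^sup>2)"
          using a b zero_le_power2[of "q \<bullet> e i"] unfolding distrib_left by linarith
        then have "\<bar>k i\<bar> * \<bar>2 * (h * width i * u $ i) * (q \<bullet> e i) + (q \<bullet> e i)\<^sup>2\<bar> \<le> \<bar>k i\<bar> * (h\<^sup>2 * h * (2 * \<bar>width i * u $ i\<bar> * K + K\<^sup>2))"
          by (rule mult_left_mono) simp
        then show "\<bar>k i * (2 * (h * width i * u $ i) * (q \<bullet> e i) + (q \<bullet> e i)\<^sup>2)\<bar> \<le> h\<^sup>2 * h * (\<bar>k i\<bar> * (2 * \<bar>width i * u $ i\<bar> * K + K\<^sup>2))"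
          by (simp add: abs_mult mult_ac)
      qed
      also have "\<dots> = h\<^sup>2 * (h * C2)" by (simp add: C2_def sum_distrib_left mult.assoc)
      also have "\<dots> \<le> h\<^sup>2 * \<eta>"
      proof -
        have "h * (C2 + 1) \<le> \<eta>" using h1(3) C2 by (simp add: field_simps)
        then have "h * C2 \<le> \<eta>" using h by (simp add: distrib_left)
        then show ?thesis by (intro mult_left_mono) auto
      qed
      finally show ?thesis by (simp add: field_simps)
    qed
    have pos: "0 < h\<^sup>2 * \<eta>" using h \<eta> by simp
    have ye: "y \<bullet> e i0 = z \<bullet> e i0 + p \<bullet> e i0" by (simp add: yp inner_add_left)
    show ?thesis
    proof (intro conjI impI)
      assume "y \<in> closure \<Omega>"
      then have "z + p \<in> closure \<Omega>" by (simp add: yp)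
      then show "z \<bullet> e i0 + h\<^sup>2 * (curv_form u - \<eta>) < y \<bullet> e i0"
        using exp1[OF pd] rem quad pos unfolding ye right_diff_distrib by linarith
    next
      assume "y \<notin> \<Omega>"
      then have "z + p \<notin> \<Omega>" by (simp add: yp)
      then show "y \<bullet> e i0 < z \<bullet> e i0 + h\<^sup>2 * (curv_form u + \<eta>)"
        using exp2[OF pd] rem quad pos unfolding ye distrib_left by linarith
    qed
  qed
  have "eventually (\<lambda>h. 0 < h \<and> h < h0) (at_right (0::real))"
    using h0 by (auto simp: eventually_at_right_field)
  then show ?thesis by (rule eventually_mono) (use main in blast)
qed

lemma eventually_in_ball:
  assumes u: "rho u < height u"
  shows "eventually (\<lambda>h. z + blowup h u \<in> ball x R) (at_right 0)"
proof -
  have "((\<lambda>h. h\<^sup>2 * (u $ i0)\<^sup>2 / (2 * R) + rho u) \<longlongrightarrow> 0\<^sup>2 * (u $ i0)\<^sup>2 / (2 * R) + rho u) (at_right 0)"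
    using R by (intro tendsto_intros) auto
  then have "eventually (\<lambda>h. h\<^sup>2 * (u $ i0)\<^sup>2 / (2 * R) + rho u < height u) (at_right 0)"
    by (rule order_tendstoD) (use u in simp)
  moreover have "eventually (\<lambda>h::real. 0 < h) (at_right 0)" by (simp add: eventually_at_right_less)
  ultimately show ?thesis by eventually_elim (rule blowup_in_ball_iff[THEN iffD2])
qed

lemma not_in_ball:
  assumes "\<not> rho u < height u" "0 < h"
  shows "z + blowup h u \<notin> ball x R"
proof -
  have "0 \<le> h\<^sup>2 * (u $ i0)\<^sup>2 / (2 * R)" using R by simp
  then show ?thesis unfolding blowup_in_ball_iff[OF assms(2)] using assms(1) by linarith
qed

text \<open>In the flat bounds with \<open>r = K * h^2\<close> and \<open>t = h^4\<close> the error
  \<open>t / r^2 = 1 / K^2\<close> does not depend on \<open>h\<close>, and the argument of Erfc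
  becomes independent of \<open>h\<close> too.\<close>

lemma blowup_limit:
  assumes u: "rho u < height u"
  shows "((\<lambda>h. v (z + blowup h u, h ^ 4)) \<longlongrightarrow> Erfc (height u / (2 * sqrt l))) (at_right 0)"
proof (rule tendstoI)
  fix \<epsilon> :: real assume \<epsilon>: "0 < \<epsilon>"
  define E where "E s = Erfc (s / (2 * sqrt l))" for s
  have "continuous_on UNIV E" unfolding E_def using l0 by (intro continuous_intros) auto
  then have "isCont E (height u)" by (simp add: continuous_on_eq_continuous_at)
  then obtain d where d: "0 < d" "\<And>s. \<bar>s - height u\<bar> < d \<Longrightarrow> \<bar>E s - E (height u)\<bar> < \<epsilon> / 2"
    using \<epsilon> unfolding continuous_at_eps_delta dist_real_def by (metis half_gt_zero)
  define \<eta> where "\<eta> = d / 2"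
  define C where "C = 2 * L * real CARD('n) + 1"
  have C: "0 < C" unfolding C_def using L_pos by (simp add: add_nonneg_pos)
  \<comment> \<open>Chosen so that the paraboloid costs exactly \<open>\<epsilon> / 2\<close>; the
    other half pays for shifting the plane by \<open>\<eta>\<close>.\<close>
  define K where "K = sqrt (2 * C / \<epsilon>)"
  have K: "0 < K" "C / K\<^sup>2 = \<epsilon> / 2" using C \<epsilon> by (simp_all add: K_def)
  have \<eta>: "0 < \<eta>" "\<bar>E (height u + \<eta>) - E (height u)\<bar> < \<epsilon> / 2" "\<bar>E (height u - \<eta>) - E (height u)\<bar> < \<epsilon> / 2"
    using d by (auto simp: \<eta>_def)
  have "eventually (\<lambda>h::real. 0 < h) (at_right 0)" by (simp add: eventually_at_right_less)
  then show "eventually (\<lambda>h. dist (v (z + blowup h u, h ^ 4)) (Erfc (height u / (2 * sqrt l))) < \<epsilon>) (at_right 0)"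
    using blowup_geometry[OF K(1) \<eta>(1), of u] eventually_in_ball[OF u]
  proof eventually_elim
    case (elim h)
    let ?y = "z + blowup h u"
    have yO: "?y \<in> \<Omega>" using elim ball_sub by blast
    have geo: "\<And>y. y \<in> cball ?y (K * h\<^sup>2) \<Longrightarrow> y \<in> closure \<Omega> \<Longrightarrow> z \<bullet> e i0 + h\<^sup>2 * (curv_form u - \<eta>) < y \<bullet> e i0"
        "\<And>y. y \<in> cball ?y (K * h\<^sup>2) \<Longrightarrow> y \<notin> \<Omega> \<Longrightarrow> y \<bullet> e i0 < z \<bullet> e i0 + h\<^sup>2 * (curv_form u + \<eta>)"
      using elim(2) by (auto simp: dist_norm norm_minus_commute)
    have r: "0 < K * h\<^sup>2" "0 < h ^ 4" using K elim by auto
    have sq: "sqrt (l * h ^ 4) = sqrt l * h\<^sup>2"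
    proof -
      have "sqrt (h ^ 4) = h\<^sup>2" by (rule real_sqrt_unique) auto
      then show ?thesis by (simp add: real_sqrt_mult)
    qed
    have ye: "?y \<bullet> e i0 = z \<bullet> e i0 + h\<^sup>2 * u $ i0" by (simp add: inner_add_left blowup_inner)
    have pen: "(2 * L * real CARD('n) + 1) * h ^ 4 / (K * h\<^sup>2)\<^sup>2 = \<epsilon> / 2"
    proof -
      have "(K * h\<^sup>2)\<^sup>2 = K\<^sup>2 * h ^ 4" by (simp add: power_mult_distrib)
      then show ?thesis using K(2) elim(1) unfolding C_def by simp
    qed
    have arg: "(?y \<bullet> e i0 - (z \<bullet> e i0 + h\<^sup>2 * b)) / (2 * sqrt (l * h ^ 4)) = (u $ i0 - b) / (2 * sqrt l)" for b
    proof -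
      have "?y \<bullet> e i0 - (z \<bullet> e i0 + h\<^sup>2 * b) = h\<^sup>2 * (u $ i0 - b)" unfolding ye right_diff_distrib by simp
      then show ?thesis unfolding sq using elim(1) l0 by simp
    qed
    have "v (?y, h ^ 4) \<le> E (height u - \<eta>) + \<epsilon> / 2"
      using flat_upper_bound[OF yO r norm_e geo(2)] unfolding pen arg E_def height_def by (simp add: diff_diff_eq)
    moreover have "E (height u + \<eta>) - \<epsilon> / 2 \<le> v (?y, h ^ 4)"
      using flat_lower_bound[OF yO r norm_e geo(1)] unfolding pen arg E_def height_def by (simp add: algebra_simps)
    ultimately show "dist (v (?y, h ^ 4)) (Erfc (height u / (2 * sqrt l))) < \<epsilon>"
      using \<eta> unfolding E_def[symmetric] dist_real_def by linarith
  qed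
qed

lemma ball_pos: "y \<in> ball x R \<Longrightarrow> 0 < (y - z) \<bullet> e i0"
  using in_ball_iff[of "y - z"] R by (smt (verit) add_diff_cancel_left' diff_add_cancel mult_nonneg_nonpos zero_le_power2 add.commute)

lemma gaussian_domination:
  obtains C a where "0 < C" "0 < a"
    "\<And>y t. y \<in> ball x R \<Longrightarrow> 0 < t \<Longrightarrow> v (y, t) \<le> C * exp (- (a * ((y - z) \<bullet> e i0)\<^sup>2 / t))"
proof -
  obtain b where b: "0 < b" "\<And>y. y \<in> ball x R \<Longrightarrow> cball y (b * ((y - z) \<bullet> e i0)) \<subseteq> \<Omega>"
    using interior_distance by blast
  show thesis
  proof (rule that)
    show "0 < exp ((2 * real CARD('n) * l + 1) / (8 * l))" by simp
    show "0 < b\<^sup>2 / (16 * l)" using b l0 by simp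
    fix y t assume y: "y \<in> ball x R" and t: "0 < (t::real)"
    have "0 < b * ((y - z) \<bullet> e i0)" using b(1) ball_pos[OF y] by simp
    from gaussian_bound[OF this b(2)[OF y] t]
    show "v (y, t) \<le> exp ((2 * real CARD('n) * l + 1) / (8 * l)) * exp (- (b\<^sup>2 / (16 * l) * ((y - z) \<bullet> e i0)\<^sup>2 / t))"
      by (simp add: power_mult_distrib mult_ac)
  qed
qed

end

subsection \<open>Means of bounded functions\<close>

text \<open>Up to the factor \<open>p + 1\<close>, the derivative of \<open>|s|^(p+1)\<close> for
  positive \<open>p\<close>.\<close>

definition signed_powr :: "real \<Rightarrow> real \<Rightarrow> real" where
  "signed_powr p s = sgn s * \<bar>s\<bar> powr p"

lemma signed_powr_eq: "signed_powr p s = (max s 0) powr p - (max (- s) 0) powr p"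
  by (simp add: signed_powr_def sgn_if max_def)

lemma measurable_signed_powr [measurable]: "signed_powr p \<in> borel_measurable borel"
  unfolding signed_powr_def[abs_def] by measurable

text \<open>The strictly convex function \<open>|r|^q\<close> lies above its tangent at 1. For
  positive \<open>r\<close> the mean value theorem shows this; for \<open>r \<le> 0\<close> the
  tangent is already negative.\<close>

lemma Bernoulli_powr_strict:
  fixes r q :: real
  assumes q: "1 < q" and r: "r \<noteq> 1"
  shows "1 + q * (r - 1) < \<bar>r\<bar> powr q"
proof (cases "r \<le> 0")
  case True
  have "q * (r - 1) \<le> q * (- 1)" using True q by (intro mult_left_mono) auto
  then have "1 + q * (r - 1) < 0" using q by simp
  also have "0 \<le> \<bar>r\<bar> powr q" by simp
  finally show ?thesis .
next
  case False
  have D: "((\<lambda>s. s powr q) has_real_derivative q * s powr (q - 1)) (at s)" if "0 < s" for s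
    using has_real_derivative_powr[OF that] by simp
  show ?thesis
  proof (cases "1 < r")
    case True
    obtain \<xi> where \<xi>: "1 < \<xi>" "r powr q - 1 powr q = (r - 1) * (q * \<xi> powr (q - 1))"
      using MVT2[of 1 r "\<lambda>s. s powr q" "\<lambda>s. q * s powr (q - 1)"] True D by auto
    have "1 < \<xi> powr (q - 1)" using \<xi>(1) q by simp
    then have "(r - 1) * (q * 1) < (r - 1) * (q * \<xi> powr (q - 1))" using True q by (intro mult_strict_left_mono) auto
    then show ?thesis using \<xi>(2) True by (simp add: mult.commute)
  next
    case nT: False
    have r1: "0 < r" "r < 1" using False nT r by auto
    obtain \<xi> where \<xi>: "r < \<xi>" "\<xi> < 1" "1 powr q - r powr q = (1 - r) * (q * \<xi> powr (q - 1))"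
      using MVT2[of r 1 "\<lambda>s. s powr q" "\<lambda>s. q * s powr (q - 1)"] r1 D by auto
    have "\<xi> powr (q - 1) < 1 powr (q - 1)" using \<xi> r1 q by (intro powr_less_mono2) auto
    then have "(1 - r) * (q * \<xi> powr (q - 1)) < (1 - r) * (q * 1)" using r1 q by (intro mult_strict_left_mono) auto
    then show ?thesis using \<xi>(3) r1 by (simp add: algebra_simps)
  qed
qed

text \<open>By homogeneity this is the Bernoulli inequality for the ratio
  \<open>b / a\<close>.\<close>

lemma abs_powr_subgradient_strict:
  fixes a b q :: real
  assumes q: "1 < q" and ab: "a \<noteq> b"
  shows "\<bar>a\<bar> powr q + q * signed_powr (q - 1) a * (b - a) < \<bar>b\<bar> powr q"
proof (cases "a = 0")
  case True
  then show ?thesis using ab q by (simp add: signed_powr_def)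
next
  case False
  define r where "r = b / a"
  have br: "b = a * r" using False by (simp add: r_def)
  have "1 + q * (r - 1) < \<bar>r\<bar> powr q"
    using ab False by (intro Bernoulli_powr_strict[OF q]) (auto simp: r_def)
  then have "\<bar>a\<bar> powr q * (1 + q * (r - 1)) < \<bar>a\<bar> powr q * \<bar>r\<bar> powr q"
    using False by (intro mult_strict_left_mono) auto
  also have "\<dots> = \<bar>b\<bar> powr q" by (simp add: br abs_mult powr_mult)
  finally have "\<bar>a\<bar> powr q + q * (\<bar>a\<bar> powr q * (r - 1)) < \<bar>b\<bar> powr q" by (simp add: algebra_simps)
  moreover have "\<bar>a\<bar> powr q * (r - 1) = signed_powr (q - 1) a * (b - a)"
  proof -
    have e0: "\<bar>a\<bar> powr q = \<bar>a\<bar> powr (q - 1) * \<bar>a\<bar>" using False by (simp add: powr_mult_base[symmetric] powr_diff)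
    have "\<bar>a\<bar> = sgn a * a" by (simp only: abs_sgn mult.commute)
    from e0 arg_cong[OF this, of "\<lambda>s. \<bar>a\<bar> powr (q - 1) * s"]
    have e: "\<bar>a\<bar> powr q = \<bar>a\<bar> powr (q - 1) * (sgn a * a)" by (rule trans)
    have "X * (s * a) * (r - 1) = s * X * (a * r - a)" for X s by (simp add: algebra_simps)
    then show ?thesis unfolding e signed_powr_def br .
  qed
  ultimately show ?thesis by (simp add: mult.assoc)
qed

lemma abs_powr_subgradient:
  fixes a b q :: real
  assumes q: "1 < q"
  shows "\<bar>a\<bar> powr q + q * signed_powr (q - 1) a * (b - a) \<le> \<bar>b\<bar> powr q"
  using abs_powr_subgradient_strict[OF q, of a b] by (cases "a = b") auto

locale bounded_on_finite_measure = finite_measure M for M :: "'b measure" +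
  fixes u :: "'b \<Rightarrow> real" and q :: real
  assumes u_meas [measurable]: "u \<in> borel_measurable M" and u_range: "\<And>y. y \<in> space M \<Longrightarrow> 0 \<le> u y \<and> u y \<le> 1"
    and pos: "0 < measure M (space M)" and q1: "1 < q"
begin

definition deviation :: "real \<Rightarrow> real" where
  "deviation m = (\<integral>y. \<bar>u y - m\<bar> powr q \<partial>M)"

text \<open>Formally the derivative of \<open>deviation\<close> is \<open>- q * balance m\<close>,
  so the sign of \<open>balance m\<close> tells on which side of \<open>m\<close> the minimum point
  lies.\<close>

definition balance :: "real \<Rightarrow> real" where
  "balance m = (\<integral>y. signed_powr (q - 1) (u y - m) \<partial>M)"

lemma u_diff_le: "y \<in> space M \<Longrightarrow> \<bar>u y - m\<bar> \<le> 1 + \<bar>m\<bar>"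
  using u_range[of y] by auto

lemma integrable_deviation [simp]: "integrable M (\<lambda>y. \<bar>u y - m\<bar> powr q)"
  by (rule integrable_const_bound[of _ "(1 + \<bar>m\<bar>) powr q"])
     (use u_diff_le q1 in \<open>auto intro!: AE_I2 powr_mono2\<close>)

lemma signed_powr_le: "y \<in> space M \<Longrightarrow> \<bar>signed_powr (q - 1) (u y - m)\<bar> \<le> (1 + \<bar>m\<bar>) powr (q - 1)"
  using u_diff_le[of y m] q1 by (auto simp: signed_powr_def abs_mult sgn_if intro!: powr_mono2)

lemma integrable_balance [simp]: "integrable M (\<lambda>y. signed_powr (q - 1) (u y - m))"
  by (rule integrable_const_bound[of _ "(1 + \<bar>m\<bar>) powr (q - 1)"])
     (use signed_powr_le in \<open>auto intro!: AE_I2\<close>)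

lemma deviation_subgradient: "deviation m + q * balance m * (m - m') \<le> deviation m'"
proof -
  have "deviation m + q * balance m * (m - m')
      = (\<integral>y. \<bar>u y - m\<bar> powr q + q * signed_powr (q - 1) (u y - m) * (m - m') \<partial>M)"
    by (simp add: deviation_def balance_def)
  also have "\<dots> \<le> deviation m'" unfolding deviation_def
  proof (rule integral_mono)
    fix y assume "y \<in> space M"
    show "\<bar>u y - m\<bar> powr q + q * signed_powr (q - 1) (u y - m) * (m - m') \<le> \<bar>u y - m'\<bar> powr q"
      using abs_powr_subgradient[OF q1, of "u y - m" "u y - m'"] by simp
  qed simp_all
  finally show ?thesis .
qed

text \<open>Two strict subgradient inequalities at the midpoint have opposite linear terms, which
  cancel in the sum. Strictness yields uniqueness of the mean.\<close>

lemma deviation_midpoint_less: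
  assumes "m1 \<noteq> m2"
  shows "2 * deviation ((m1 + m2) / 2) < deviation m1 + deviation m2"
proof -
  let ?m = "(m1 + m2) / 2"
  have "(\<integral>y. 2 * \<bar>u y - ?m\<bar> powr q \<partial>M) < (\<integral>y. \<bar>u y - m1\<bar> powr q + \<bar>u y - m2\<bar> powr q \<partial>M)"
  proof (rule integral_less_AE_space)
    show "AE y in M. 2 * \<bar>u y - ?m\<bar> powr q < \<bar>u y - m1\<bar> powr q + \<bar>u y - m2\<bar> powr q"
    proof (rule AE_I2)
      fix y
      have ne: "u y - ?m \<noteq> u y - m1" "u y - ?m \<noteq> u y - m2" using assms by (auto simp: field_simps)
      have "\<bar>u y - ?m\<bar> powr q + q * signed_powr (q - 1) (u y - ?m) * (u y - m1 - (u y - ?m)) < \<bar>u y - m1\<bar> powr q"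
        "\<bar>u y - ?m\<bar> powr q + q * signed_powr (q - 1) (u y - ?m) * (u y - m2 - (u y - ?m)) < \<bar>u y - m2\<bar> powr q"
        by (rule abs_powr_subgradient_strict[OF q1 ne(1)], rule abs_powr_subgradient_strict[OF q1 ne(2)])
      moreover have "u y - m2 - (u y - ?m) = - (u y - m1 - (u y - ?m))" by (simp add: field_simps)
      ultimately show "2 * \<bar>u y - ?m\<bar> powr q < \<bar>u y - m1\<bar> powr q + \<bar>u y - m2\<bar> powr q"
        by simp
    qed
    show "emeasure M (space M) \<noteq> 0" using pos unfolding measure_def by (metis enn2real_0 less_irrefl)
  qed simp_all
  then show ?thesis by (simp add: deviation_def)
qed

text \<open>Truncating \<open>m\<close> to the unit interval brings it closer to all values of
  \<open>u\<close>, so only that interval matters. There the subgradients are bounded, hence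
  \<open>deviation\<close> is Lipschitz and attains its minimum.\<close>

lemma deviation_minimizer: "\<exists>m\<in>{0..1::real}. \<forall>m'::real. deviation m \<le> deviation m'"
proof -
  define B where "B = q * (2 powr (q - 1) * measure M (space M))"
  have B0: "0 \<le> B" using q1 by (simp add: B_def)
  have bal: "\<bar>q * balance m\<bar> \<le> B" if m: "m \<in> {0..1}" for m
  proof -
    have "\<bar>balance m\<bar> \<le> (\<integral>y. 2 powr (q - 1) \<partial>M)" unfolding balance_def
    proof (rule order_trans[OF integral_abs_bound], rule integral_mono)
      fix y assume "y \<in> space M"
      have "\<bar>signed_powr (q - 1) (u y - m)\<bar> \<le> (1 + \<bar>m\<bar>) powr (q - 1)" by (rule signed_powr_le) fact
      also have "\<dots> \<le> 2 powr (q - 1)" using m q1 by (intro powr_mono2) auto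
      finally show "\<bar>signed_powr (q - 1) (u y - m)\<bar> \<le> 2 powr (q - 1)" .
    qed simp_all
    then have "q * \<bar>balance m\<bar> \<le> B" using q1 unfolding B_def by (intro mult_left_mono) (auto simp: mult.commute)
    then show ?thesis using q1 by (simp add: abs_mult)
  qed
  have one: "deviation m - deviation m' \<le> B * \<bar>m - m'\<bar>" if "m \<in> {0..1}" for m m' :: real
  proof -
    have "\<bar>q * balance m * (m - m')\<bar> \<le> B * \<bar>m - m'\<bar>"
      unfolding abs_mult[of "q * balance m"] by (intro mult_right_mono bal that) simp
    then show ?thesis using deviation_subgradient[of m m'] by linarith
  qed
  have "B-lipschitz_on {0..1} deviation"
  proof (rule lipschitz_onI)
    fix m m' :: real assume "m \<in> {0..1::real}" "m' \<in> {0..1}"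
    then show "dist (deviation m) (deviation m') \<le> B * dist m m'"
      using one[of m m'] one[of m' m] by (simp add: dist_real_def abs_minus_commute abs_le_iff)
  qed (rule B0)
  then have "continuous_on {0..1} deviation" by (rule lipschitz_on_continuous_on)
  then obtain m0 where m0: "m0 \<in> {0..1}" "\<And>m'. m' \<in> {0..1} \<Longrightarrow> deviation m0 \<le> deviation m'"
    using continuous_attains_inf[of "{0..1::real}" deviation] by auto
  have "deviation m0 \<le> deviation m'" for m' :: real
  proof -
    have "deviation (max 0 (min 1 m')) \<le> deviation m'" unfolding deviation_def
    proof (rule integral_mono)
      fix y assume "y \<in> space M"
      then have "\<bar>u y - max 0 (min 1 m')\<bar> \<le> \<bar>u y - m'\<bar>" using u_range[of y] by auto
      then show "\<bar>u y - max 0 (min 1 m')\<bar> powr q \<le> \<bar>u y - m'\<bar> powr q" using q1 by (intro powr_mono2) auto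
    qed simp_all
    moreover have "deviation m0 \<le> deviation (max 0 (min 1 m'))" by (rule m0) auto
    ultimately show ?thesis by linarith
  qed
  then show ?thesis using m0(1) by blast
qed

text \<open>Only one-sided information is extracted: a sign of \<open>balance\<close> at a trial
  level bounds the mean by that level, so the equation for the mean need not be solved.\<close>

lemma THE_deviation_minimizer:
  defines "\<mu> \<equiv> (THE m. is_arg_min (\<lambda>m. ereal (deviation m powr (1 / q))) (\<lambda>_. True) m)"
  shows "0 \<le> \<mu>" and "0 < balance m \<Longrightarrow> m \<le> \<mu>" and "balance m < 0 \<Longrightarrow> \<mu> \<le> m"
proof -
  obtain m0 where m0: "m0 \<in> {0..1}" "\<And>m'. deviation m0 \<le> deviation m'" using deviation_minimizer by blast
  have d0: "0 \<le> deviation m" for m unfolding deviation_def by simp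
  \<comment> \<open>Taking the root is strictly increasing on nonnegative numbers, so the norm and
    \<open>deviation\<close> have the same minimum points.\<close>
  have le: "deviation m' powr (1 / q) < deviation m powr (1 / q) \<longleftrightarrow> deviation m' < deviation m" for m m' :: real
  proof
    assume "deviation m' < deviation m"
    then show "deviation m' powr (1 / q) < deviation m powr (1 / q)" using d0 q1 by (intro powr_less_mono2) auto
  next
    assume "deviation m' powr (1 / q) < deviation m powr (1 / q)"
    then show "deviation m' < deviation m"
      using powr_mono2[of "1 / q" "deviation m" "deviation m'"] d0 q1 by (meson divide_nonneg_nonneg leD leI less_imp_le zero_le_one order_trans)
  qed
  have min: "is_arg_min (\<lambda>m. ereal (deviation m powr (1 / q))) (\<lambda>_. True) m \<longleftrightarrow> (\<forall>m'. deviation m \<le> deviation m')" for m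
    unfolding is_arg_min_def using le by (auto simp: not_less)
  have \<mu>: "\<mu> = m0" unfolding \<mu>_def
  proof (rule the_equality)
    show "is_arg_min (\<lambda>m. ereal (deviation m powr (1 / q))) (\<lambda>_. True) m0" unfolding min using m0 by blast
    fix m assume "is_arg_min (\<lambda>m. ereal (deviation m powr (1 / q))) (\<lambda>_. True) m"
    then have m: "\<And>m'. deviation m \<le> deviation m'" unfolding min by blast
    show "m = m0"
    proof (rule ccontr)
      assume "m \<noteq> m0"
      from deviation_midpoint_less[OF this] show False
        using m[of "(m + m0) / 2"] m0(2)[of "(m + m0) / 2"] by linarith
    qed
  qed
  show "0 \<le> \<mu>" using \<mu> m0 by simp
  show "m \<le> \<mu>" if "0 < balance m"
  proof (rule ccontr)
    assume "\<not> m \<le> \<mu>"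
    then have "0 < q * balance m * (m - \<mu>)" using that q1 by simp
    then show False using deviation_subgradient[of m \<mu>] m0(2)[of m] \<mu> by simp
  qed
  show "\<mu> \<le> m" if "balance m < 0"
  proof (rule ccontr)
    assume "\<not> \<mu> \<le> m"
    then have "0 < q * balance m * (m - \<mu>)" using that q1 by (simp add: mult_neg_neg mult_pos_neg)
    then show False using deviation_subgradient[of m \<mu>] m0(2)[of m] \<mu> by simp
  qed
qed

end

lemma q_mean_bounds:
  fixes B :: "'a::euclidean_space set"
  assumes B: "B \<in> sets borel" "emeasure lborel B < \<infinity>" "0 < measure lborel B"
    and u: "u \<in> borel_measurable (restrict_space lborel B)" "\<And>y. y \<in> B \<Longrightarrow> 0 \<le> u y \<and> u y \<le> 1" and q: "1 < q"
  shows "0 \<le> q_mean (ereal q) B u"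
    and "0 < (LINT y:B|lborel. signed_powr (q - 1) (u y - m)) \<Longrightarrow> m \<le> q_mean (ereal q) B u"
    and "(LINT y:B|lborel. signed_powr (q - 1) (u y - m)) < 0 \<Longrightarrow> q_mean (ereal q) B u \<le> m"
proof -
  let ?M = "restrict_space lborel B"
  have sp: "space ?M = B" by (simp add: space_restrict_space)
  have em: "emeasure ?M B = emeasure lborel B" using B by (simp add: emeasure_restrict_space)
  interpret finite_measure ?M
    by (rule finite_measureI) (use B sp em in simp)
  have "0 < measure ?M (space ?M)" using B sp em by (simp add: measure_def)
  then interpret bounded_on_finite_measure ?M u q
    by unfold_locales (use u q sp in auto)
  have int: "(LINT y:B|lborel. f y) = integral\<^sup>L ?M f" for f :: "'a \<Rightarrow> real"
    using B(1) by (simp add: integral_restrict_space set_lebesgue_integral_def)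
  have mean: "q_mean (ereal q) B u = (THE m. is_arg_min (\<lambda>m. ereal (deviation m powr (1 / q))) (\<lambda>_. True) m)"
    unfolding q_mean_def Lq_norm_def deviation_def int by simp
  show "0 \<le> q_mean (ereal q) B u" unfolding mean by (rule THE_deviation_minimizer)
  show "0 < (LINT y:B|lborel. signed_powr (q - 1) (u y - m)) \<Longrightarrow> m \<le> q_mean (ereal q) B u"
    unfolding mean int balance_def[symmetric] by (rule THE_deviation_minimizer)
  show "(LINT y:B|lborel. signed_powr (q - 1) (u y - m)) < 0 \<Longrightarrow> q_mean (ereal q) B u \<le> m"
    unfolding mean int balance_def[symmetric] by (rule THE_deviation_minimizer)
qed

text \<open>For a continuous function on an open set the essential supremum is the supremum;
  \<open>a\<close> and \<open>b\<close> are the infimum and supremum of \<open>u\<close> when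
  \<open>B\<close> is nonempty.\<close>

lemma esssup_abs_diff_open:
  fixes u :: "'a::euclidean_space \<Rightarrow> real"
  assumes B: "open B" and u: "continuous_on B u" and range: "\<And>y. y \<in> B \<Longrightarrow> a \<le> u y \<and> u y \<le> b"
    and low: "\<And>c. a < c \<Longrightarrow> \<exists>y\<in>B. u y < c" and high: "\<And>c. c < b \<Longrightarrow> \<exists>y\<in>B. c < u y"
  shows "esssup (restrict_space lborel B) (\<lambda>y. ereal \<bar>u y - m\<bar>) = ereal (max (b - m) (m - a))"
proof (rule antisym)
  let ?M = "restrict_space lborel B"
  have sp: "space ?M = B" by (simp add: space_restrict_space)
  have "(\<lambda>y. \<bar>u y - m\<bar>) \<in> borel_measurable (restrict_space borel B)"
    by (intro borel_measurable_continuous_on_restrict continuous_intros u)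
  then have "(\<lambda>y. \<bar>u y - m\<bar>) \<in> borel_measurable ?M"
    by (simp cong: measurable_cong_sets add: sets_restrict_space_cong[of lborel borel])
  then have meas: "(\<lambda>y. ereal \<bar>u y - m\<bar>) \<in> borel_measurable ?M" by measurable
  show "esssup ?M (\<lambda>y. ereal \<bar>u y - m\<bar>) \<le> ereal (max (b - m) (m - a))"
  proof (rule esssup_I[OF meas], rule AE_I2)
    fix y assume "y \<in> space ?M"
    then have "\<bar>u y - m\<bar> \<le> max (b - m) (m - a)" using range[of y] sp by (auto simp: max_def)
    then show "ereal \<bar>u y - m\<bar> \<le> ereal (max (b - m) (m - a))" by (simp only: ereal_less_eq)
  qed
  \<comment> \<open>If the essential supremum were below \<open>c\<close>, the nonempty open set
    \<open>B \<inter> V\<close> would be a null set.\<close>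
  have lower: "ereal c \<le> esssup ?M (\<lambda>y. ereal \<bar>u y - m\<bar>)"
    if V: "open V" "y0 \<in> B \<inter> V" and c: "\<And>y. y \<in> B \<Longrightarrow> y \<in> V \<Longrightarrow> c < \<bar>u y - m\<bar>" for c V y0
  proof (rule ccontr)
    assume "\<not> ereal c \<le> esssup ?M (\<lambda>y. ereal \<bar>u y - m\<bar>)"
    then have lt: "esssup ?M (\<lambda>y. ereal \<bar>u y - m\<bar>) < ereal c" by simp
    have "AE y in ?M. y \<notin> V"
      using esssup_AE[of "\<lambda>y. ereal \<bar>u y - m\<bar>" ?M] AE_space
    proof eventually_elim
      case (elim y)
      then have "ereal \<bar>u y - m\<bar> < ereal c" using lt by (meson le_less_trans)
      then show ?case using c[of y] elim sp by auto
    qed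
    then have "AE y in lborel. y \<in> B \<longrightarrow> y \<notin> V"
      using B by (subst (asm) AE_restrict_space_iff) auto
    then have "AE y in lborel. y \<notin> B \<inter> V" by (auto elim: eventually_mono)
    moreover have "open (B \<inter> V)" using B V by (simp add: open_Int)
    ultimately have "B \<inter> V \<in> null_sets lborel" by (subst (asm) AE_iff_null_sets[symmetric]) auto
    moreover have "\<not> negligible (B \<inter> V)" using \<open>open (B \<inter> V)\<close> V(2) open_not_negligible by blast
    ultimately show False by (simp add: negligible_iff_null_sets null_sets_completionI)
  qed
  have 1: "ereal c \<le> esssup ?M (\<lambda>y. ereal \<bar>u y - m\<bar>)" if c: "c < b - m" for c
  proof -
    obtain y0 where y0: "y0 \<in> B" "c + m < u y0" using high[of "c + m"] c by auto
    obtain V where V: "open V" "V \<inter> B = u -` {c + m<..} \<inter> B"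
      using continuous_on_open_invariant[THEN iffD1, OF u, rule_format, of "{c + m<..}"] by auto
    show ?thesis
    proof (rule lower[OF V(1), of y0])
      show "y0 \<in> B \<inter> V" using y0 V(2) by auto
      show "c < \<bar>u y - m\<bar>" if "y \<in> B" "y \<in> V" for y
      proof -
        have "y \<in> u -` {c + m<..} \<inter> B" using that V(2) by blast
        then show ?thesis by auto
      qed
    qed
  qed
  have 2: "ereal c \<le> esssup ?M (\<lambda>y. ereal \<bar>u y - m\<bar>)" if c: "c < m - a" for c
  proof -
    obtain y0 where y0: "y0 \<in> B" "u y0 < m - c" using low[of "m - c"] c by auto
    obtain V where V: "open V" "V \<inter> B = u -` {..<m - c} \<inter> B"
      using continuous_on_open_invariant[THEN iffD1, OF u, rule_format, of "{..<m - c}"] by auto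
    show ?thesis
    proof (rule lower[OF V(1), of y0])
      show "y0 \<in> B \<inter> V" using y0 V(2) by auto
      show "c < \<bar>u y - m\<bar>" if "y \<in> B" "y \<in> V" for y
      proof -
        have "y \<in> u -` {..<m - c} \<inter> B" using that V(2) by blast
        then show ?thesis by auto
      qed
    qed
  qed
  show "ereal (max (b - m) (m - a)) \<le> esssup ?M (\<lambda>y. ereal \<bar>u y - m\<bar>)"
  proof (rule dense_le)
    fix r assume r: "r < ereal (max (b - m) (m - a))"
    show "r \<le> esssup ?M (\<lambda>y. ereal \<bar>u y - m\<bar>)"
    proof (cases r)
      case (real c)
      then have "c < max (b - m) (m - a)" using r by (simp only: less_ereal.simps)
      then have "c < b - m \<or> c < m - a" by (simp only: less_max_iff_disj)
      then show ?thesis using 1 2 real by auto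
    qed (use r in auto)
  qed
qed

text \<open>As a function of \<open>m\<close>, the larger of the distances to the two extreme values
  is minimal at their midpoint and nowhere else.\<close>

lemma q_mean_infinity:
  fixes u :: "'a::euclidean_space \<Rightarrow> real"
  assumes "open B" "continuous_on B u" "\<And>y. y \<in> B \<Longrightarrow> a \<le> u y \<and> u y \<le> b"
    and "\<And>c. a < c \<Longrightarrow> \<exists>y\<in>B. u y < c" "\<And>c. c < b \<Longrightarrow> \<exists>y\<in>B. c < u y"
  shows "q_mean \<infinity> B u = (a + b) / 2"
proof -
  have N: "Lq_norm \<infinity> B (\<lambda>y. u y - m) = ereal (max (b - m) (m - a))" for m
    unfolding Lq_norm_def using esssup_abs_diff_open[OF assms, of m] by simp
  have "is_arg_min (\<lambda>m. Lq_norm \<infinity> B (\<lambda>y. u y - m)) (\<lambda>_. True) m \<longleftrightarrow> m = (a + b) / 2" for m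
  proof
    assume "is_arg_min (\<lambda>m. Lq_norm \<infinity> B (\<lambda>y. u y - m)) (\<lambda>_. True) m"
    then have "\<not> ereal (max (b - (a + b) / 2) ((a + b) / 2 - a)) < ereal (max (b - m) (m - a))"
      unfolding is_arg_min_def N by blast
    then have "max (b - m) (m - a) \<le> max (b - (a + b) / 2) ((a + b) / 2 - a)"
      by (simp only: less_ereal.simps not_less)
    then show "m = (a + b) / 2" by (auto simp: max_def field_simps split: if_splits)
  qed (auto simp: is_arg_min_def N max_def field_simps)
  note iff = this
  show ?thesis unfolding q_mean_def
    by (rule the_equality) (simp_all only: iff)
qed

subsection \<open>Linear changes of variables\<close>

lemma measurable_vec_lambda_PiM [measurable]:
  "(\<lambda>f. (\<chi> i. f i) :: real^'n) \<in> borel_measurable (Pi\<^sub>M UNIV (\<lambda>_::'n. lborel :: real measure))"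
proof (rule borel_measurable_euclidean_space[THEN iffD2], intro ballI)
  fix b :: "real^'n" assume "b \<in> Basis"
  then obtain i where b: "b = axis i 1" by (auto simp: Basis_vec_def)
  have "(\<lambda>f. f i) \<in> borel_measurable (Pi\<^sub>M UNIV (\<lambda>_::'n. lborel :: real measure))"
    using measurable_component_singleton[of i UNIV "\<lambda>_. lborel :: real measure"] by simp
  then show "(\<lambda>f. (\<chi> i. f i) \<bullet> b) \<in> borel_measurable (Pi\<^sub>M UNIV (\<lambda>_::'n. lborel :: real measure))"
    by (simp add: b inner_axis)
qed

lemma prod_Basis_vec: "(\<Prod>b\<in>Basis. (w :: real^'n) \<bullet> b) = (\<Prod>i\<in>UNIV. w $ i)"
proof -
  have B: "Basis = (\<lambda>i. axis i (1::real)) ` (UNIV :: 'n set)" by (auto simp: Basis_vec_def)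
  show ?thesis unfolding B
    by (subst prod.reindex) (auto simp: inj_on_def axis_eq_axis inner_axis)
qed

lemma prod_Basis_vec_abs: "(\<Prod>b\<in>Basis. \<bar>(w :: real^'n) \<bullet> b\<bar>) = (\<Prod>i\<in>UNIV. \<bar>w $ i\<bar>)"
proof -
  have B: "Basis = (\<lambda>i. axis i (1::real)) ` (UNIV :: 'n set)" by (auto simp: Basis_vec_def)
  show ?thesis unfolding B
    by (subst prod.reindex) (auto simp: inj_on_def axis_eq_axis inner_axis)
qed

lemma lborel_vec_eq_distr_PiM:
  "(lborel :: (real^'n) measure) = distr (Pi\<^sub>M UNIV (\<lambda>_::'n. lborel)) borel (\<lambda>f. \<chi> i. f i)"
proof (rule lborel_eqI)
  interpret product_sigma_finite "\<lambda>_::'n. lborel :: real measure" by standard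
  fix l u :: "real^'n" assume "\<And>b. b \<in> Basis \<Longrightarrow> l \<bullet> b \<le> u \<bullet> b"
  then have le: "l $ i \<le> u $ i" for i
    using axis_in_Basis_iff[of i 1] by (metis axis_in_Basis_iff cart_eq_inner_axis Basis_real_def insertI1)
  have "emeasure (distr (Pi\<^sub>M UNIV (\<lambda>_::'n. lborel)) borel (\<lambda>f. \<chi> i. f i)) (box l u)
      = emeasure (Pi\<^sub>M UNIV (\<lambda>_::'n. lborel)) (Pi\<^sub>E UNIV (\<lambda>i. {l $ i<..<u $ i}))"
    by (subst emeasure_distr) (auto intro!: arg_cong[of _ _ "emeasure _"] simp: mem_box_cart space_PiM PiE_UNIV_domain Pi_iff)
  also have "\<dots> = (\<Prod>i\<in>UNIV. emeasure lborel {l $ i<..<u $ i})"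
    by (rule emeasure_PiM) auto
  also have "\<dots> = (\<Prod>i\<in>UNIV. ennreal ((u - l) $ i))"
    using le by (intro prod.cong) auto
  also have "\<dots> = ennreal (\<Prod>i\<in>UNIV. (u - l) $ i)" by (rule prod_ennreal) (use le in auto)
  finally show "emeasure (distr (Pi\<^sub>M UNIV (\<lambda>_::'n. lborel)) borel (\<lambda>f. \<chi> i. f i)) (box l u) = ennreal (\<Prod>b\<in>Basis. (u - l) \<bullet> b)"
    by (simp only: prod_Basis_vec)
qed simp

lemma nn_integral_vec_fiber:
  fixes F :: "real^'n \<Rightarrow> ennreal"
  assumes F [measurable]: "F \<in> borel_measurable borel"
  shows "(\<integral>\<^sup>+ u. F u \<partial>lborel) = (\<integral>\<^sup>+ w. (\<integral>\<^sup>+ s. F (\<chi> j. (w(i := s)) j) \<partial>lborel) \<partial>Pi\<^sub>M (UNIV - {i}) (\<lambda>_. lborel))"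
proof -
  interpret product_sigma_finite "\<lambda>_::'n. lborel :: real measure" by standard
  have U: "insert i (UNIV - {i}) = UNIV" by auto
  have "(\<integral>\<^sup>+ u. F u \<partial>lborel) = (\<integral>\<^sup>+ f. F (\<chi> j. f j) \<partial>Pi\<^sub>M UNIV (\<lambda>_. lborel))"
    by (subst lborel_vec_eq_distr_PiM, subst nn_integral_distr) auto
  also have "\<dots> = (\<integral>\<^sup>+ f. F (\<chi> j. f j) \<partial>Pi\<^sub>M (insert i (UNIV - {i})) (\<lambda>_. lborel))" unfolding U ..
  also have "\<dots> = (\<integral>\<^sup>+ w. (\<integral>\<^sup>+ s. F (\<chi> j. (w(i := s)) j) \<partial>lborel) \<partial>Pi\<^sub>M (UNIV - {i}) (\<lambda>_. lborel))"
    by (rule product_nn_integral_insert) (auto simp: U)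
  finally show ?thesis .
qed

text \<open>The shift does not depend on coordinate \<open>i\<close>, so on each line in that
  direction the map is a translation.\<close>

lemma nn_integral_shear:
  fixes F :: "real^'n \<Rightarrow> ennreal" and \<phi> :: "real^'n \<Rightarrow> real"
  assumes F [measurable]: "F \<in> borel_measurable borel" and \<phi> [measurable]: "\<phi> \<in> borel_measurable borel"
    and indep: "\<And>u w. (\<And>j. j \<noteq> i \<Longrightarrow> u $ j = w $ j) \<Longrightarrow> \<phi> u = \<phi> w"
  shows "(\<integral>\<^sup>+ u. F (u + \<phi> u *\<^sub>R axis i 1) \<partial>lborel) = (\<integral>\<^sup>+ u. F u \<partial>lborel)"
proof -
  have "(\<integral>\<^sup>+ s. F ((\<chi> j. (w(i := s)) j) + \<phi> (\<chi> j. (w(i := s)) j) *\<^sub>R axis i 1) \<partial>lborel)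
      = (\<integral>\<^sup>+ s. F (\<chi> j. (w(i := s)) j) \<partial>lborel)" for w :: "'n \<Rightarrow> real"
  proof -
    define p where "p = \<phi> (\<chi> j. w j)"
    have p: "\<phi> (\<chi> j. (w(i := s)) j) = p" for s unfolding p_def by (rule indep) simp
    have e: "(\<chi> j. (w(i := s)) j) + p *\<^sub>R axis i 1 = (\<chi> j. (w(i := p + 1 * s)) j)" for s
      by (simp add: vec_eq_iff axis_def)
    have [measurable]: "(\<lambda>s. \<chi> j. (w(i := s)) j) \<in> borel_measurable borel"
    proof -
      have "(\<lambda>s. \<chi> j. (w(i := s)) j) = (\<lambda>s. (\<chi> j. (w(i := 0)) j) + s *\<^sub>R axis i 1)"
        by (simp add: fun_eq_iff vec_eq_iff axis_def)
      then show ?thesis by simp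
    qed
    have "(\<integral>\<^sup>+ s. F (\<chi> j. (w(i := s)) j) \<partial>lborel) = ennreal \<bar>1\<bar> * (\<integral>\<^sup>+ s. F (\<chi> j. (w(i := p + 1 * s)) j) \<partial>lborel)"
    proof (rule nn_integral_real_affine)
      show "(\<lambda>s. F (\<chi> j. (w(i := s)) j)) \<in> borel_measurable borel" by measurable
    qed simp
    then show ?thesis unfolding p e by (simp only: abs_one ennreal_1 mult_1)
  qed
  note inner_eq = this
  have "(\<lambda>u. F (u + \<phi> u *\<^sub>R axis i 1)) \<in> borel_measurable borel" by measurable
  from nn_integral_vec_fiber[OF this, of i] show ?thesis
    unfolding inner_eq nn_integral_vec_fiber[OF F, of i] .
qed

lemma nn_integral_diagonal:
  fixes F :: "real^'n \<Rightarrow> ennreal"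
  assumes F [measurable]: "F \<in> borel_measurable borel" and c: "\<And>i. c i \<noteq> 0"
  shows "(\<integral>\<^sup>+ u. F u \<partial>lborel) = ennreal (\<Prod>i\<in>UNIV. \<bar>c i\<bar>) * (\<integral>\<^sup>+ u. F (\<chi> i. c i * u $ i) \<partial>lborel)"
proof -
  define C :: "real^'n" where "C = (\<chi> i. c i)"
  define T :: "real^'n \<Rightarrow> real^'n" where "T u = 0 + (\<Sum>b\<in>Basis. ((C \<bullet> b) * (u \<bullet> b)) *\<^sub>R b)" for u
  have T: "T u = (\<chi> i. c i * u $ i)" for u
  proof -
    have "T u $ i = c i * u $ i" for i
    proof -
      have "T u \<bullet> axis i 1 = (C \<bullet> axis i 1) * (u \<bullet> axis i 1)"
        unfolding T_def using axis_in_Basis_iff[of i "1::real"] by (simp add: inner_sum_left inner_Basis if_distrib cong: if_cong)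
      then show ?thesis by (simp add: cart_eq_inner_axis[symmetric] C_def)
    qed
    then show ?thesis by (simp add: vec_eq_iff)
  qed
  have C0: "C \<bullet> b \<noteq> 0" if "b \<in> Basis" for b using that c by (auto simp: Basis_vec_def C_def inner_axis)
  have [measurable]: "T \<in> borel_measurable borel" unfolding T_def[abs_def] by measurable
  have "(\<integral>\<^sup>+ u. F u \<partial>lborel) = (\<integral>\<^sup>+ u. F u \<partial>density (distr lborel borel T) (\<lambda>_. (\<Prod>b\<in>Basis. \<bar>C \<bullet> b\<bar>)))"
    using lborel_affine_euclidean[of "\<lambda>b. C \<bullet> b" 0, OF C0] unfolding T_def[symmetric] by simp
  also have "\<dots> = ennreal (\<Prod>b\<in>Basis. \<bar>C \<bullet> b\<bar>) * (\<integral>\<^sup>+ u. F (T u) \<partial>lborel)"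
    by (simp add: nn_integral_density nn_integral_distr nn_integral_cmult)
  also have "(\<Prod>b\<in>Basis. \<bar>C \<bullet> b\<bar>) = (\<Prod>i\<in>UNIV. \<bar>c i\<bar>)" unfolding prod_Basis_vec_abs by (simp add: C_def)
  finally show ?thesis unfolding T .
qed

lemma nn_integral_coordinate_permutation:
  fixes F :: "real^'n \<Rightarrow> ennreal" and p :: "'n \<Rightarrow> 'n"
  assumes F [measurable]: "F \<in> borel_measurable borel" and p: "bij p"
  shows "(\<integral>\<^sup>+ u. F (\<chi> i. u $ p i) \<partial>lborel) = (\<integral>\<^sup>+ u. F u \<partial>lborel)"
proof -
  let ?T = "\<lambda>u :: real^'n. (\<chi> i. u $ p i) :: real^'n"
  have T: "?T \<in> borel_measurable borel"
    by (intro borel_measurable_continuous_onI continuous_intros)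
  have "lborel = distr lborel borel ?T"
  proof (rule lborel_eqI)
    fix l u :: "real^'n" assume "\<And>b. b \<in> Basis \<Longrightarrow> l \<bullet> b \<le> u \<bullet> b"
    then have le: "l $ i \<le> u $ i" for i
      using axis_in_Basis_iff[of i 1] by (metis axis_in_Basis_iff cart_eq_inner_axis Basis_real_def insertI1)
    define l' u' :: "real^'n" where "l' = (\<chi> i. l $ inv p i)" and "u' = (\<chi> i. u $ inv p i)"
    have "?T -` box l u = box l' u'"
      using p unfolding set_eq_iff mem_box_cart vimage_def l'_def u'_def
      by (auto; metis bij_inv_eq_iff)
    then have "emeasure (distr lborel borel ?T) (box l u) = emeasure lborel (box l' u')"
      using T by (simp add: emeasure_distr)
    also have "\<dots> = ennreal (\<Prod>b\<in>Basis. (u' - l') \<bullet> b)"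
      by (rule emeasure_lborel_box) (use le in \<open>auto simp: Basis_vec_def l'_def u'_def inner_axis\<close>)
    also have "(\<Prod>b\<in>Basis. (u' - l') \<bullet> b) = (\<Prod>i\<in>UNIV. (u - l) $ inv p i)" unfolding prod_Basis_vec by (simp add: l'_def u'_def)
    also have "\<dots> = (\<Prod>i\<in>UNIV. (u - l) $ i)"
      by (rule prod.reindex_bij_betw[OF bij_imp_bij_inv[OF p]])
    finally show "emeasure (distr lborel borel ?T) (box l u) = ennreal (\<Prod>b\<in>Basis. (u - l) \<bullet> b)" by (simp only: prod_Basis_vec)
  qed simp
  then have "(\<integral>\<^sup>+ u. F u \<partial>lborel) = (\<integral>\<^sup>+ u. F u \<partial>distr lborel borel ?T)" by simp
  also have "\<dots> = (\<integral>\<^sup>+ u. F (?T u) \<partial>lborel)" using T by (subst nn_integral_distr) auto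
  finally show ?thesis ..
qed

lemma nn_integral_linear_proportional:
  fixes T :: "real^'n \<Rightarrow> real^'n"
  assumes "linear T" "inj T"
  shows "\<exists>c>0. \<forall>F\<in>borel_measurable borel. (\<integral>\<^sup>+ u. F u \<partial>lborel) = ennreal c * (\<integral>\<^sup>+ u. F (T u) \<partial>lborel)"
proof -
  define P where "P T \<longleftrightarrow> (inj T \<longrightarrow> (\<exists>c>0. \<forall>F\<in>borel_measurable borel. (\<integral>\<^sup>+ u. F u \<partial>lborel) = ennreal c * (\<integral>\<^sup>+ u. F (T u) \<partial>lborel)))"
    for T :: "real^'n \<Rightarrow> real^'n"
  have "P T"
  proof (rule induct_linear_elementary[OF \<open>linear T\<close>])
    fix f g :: "real^'n \<Rightarrow> real^'n" assume lin: "linear f" "linear g" and P: "P f" "P g"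
    show "P (f \<circ> g)" unfolding P_def
    proof
      assume inj: "inj (f \<circ> g)"
      then have ig: "inj g" by (rule inj_on_imageI2)
      \<comment> \<open>Injectivity of the composition passes to \<open>f\<close> only because the
        injective linear map \<open>g\<close> is onto.\<close>
      then have "surj g" using lin linear_injective_imp_surjective by blast
      then have "inj f" using inj by (metis comp_inj_on_iff inj_on_imageI inj_imp_surj_inv surj_iff fun.map_comp comp_id o_inv_distrib inj_compose inj_def surj_def comp_apply)
      then obtain a b where a: "0 < a" "\<And>F. F \<in> borel_measurable borel \<Longrightarrow> (\<integral>\<^sup>+ u. F u \<partial>lborel) = ennreal a * (\<integral>\<^sup>+ u. F (f u) \<partial>lborel)"
        and b: "0 < b" "\<And>F. F \<in> borel_measurable borel \<Longrightarrow> (\<integral>\<^sup>+ u. F u \<partial>lborel) = ennreal b * (\<integral>\<^sup>+ u. F (g u) \<partial>lborel)"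
        using P ig unfolding P_def by blast
      have "(\<integral>\<^sup>+ u. F u \<partial>lborel) = ennreal (a * b) * (\<integral>\<^sup>+ u. F ((f \<circ> g) u) \<partial>lborel)" if F: "F \<in> borel_measurable borel" for F
      proof -
        have "f \<in> borel_measurable borel"
          using lin by (intro borel_measurable_continuous_onI linear_continuous_on) (simp add: linear_conv_bounded_linear)
        then have "(\<lambda>u. F (f u)) \<in> borel_measurable borel" using F by measurable
        from b(2)[OF this] show ?thesis unfolding a(2)[OF F]
          using a(1) b(1) by (simp add: ennreal_mult' mult.assoc)
      qed
      then show "\<exists>c>0. \<forall>F\<in>borel_measurable borel. (\<integral>\<^sup>+ u. F u \<partial>lborel) = ennreal c * (\<integral>\<^sup>+ u. F ((f \<circ> g) u) \<partial>lborel)"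
        using a(1) b(1) by (intro exI[of _ "a * b"]) auto
    qed
  next
    \<comment> \<open>A map whose image lies in a coordinate hyperplane is not onto, so it is not
      injective and there is nothing to prove.\<close>
    fix f :: "real^'n \<Rightarrow> real^'n" and i assume lin: "linear f" and 0: "\<And>x. f x $ i = 0"
    show "P f" unfolding P_def
    proof
      assume "inj f"
      then have "surj f" using lin linear_injective_imp_surjective by blast
      then obtain x where "f x = axis i 1" by (metis surjD)
      then show "\<exists>c>0. \<forall>F\<in>borel_measurable borel. (\<integral>\<^sup>+ u. F u \<partial>lborel) = ennreal c * (\<integral>\<^sup>+ u. F (f u) \<partial>lborel)"
        using 0[of x] by simp
    qed
  next
    fix c :: "'n \<Rightarrow> real"
    show "P (\<lambda>x. \<chi> i. c i * x $ i)" unfolding P_def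
    proof
      assume inj: "inj (\<lambda>x::real^'n. \<chi> i. c i * x $ i)"
      have c: "c i \<noteq> 0" for i
      proof
        assume "c i = 0"
        then have "(\<chi> j. c j * (axis i 1 :: real^'n) $ j) = (\<chi> j. c j * (0 :: real^'n) $ j)"
          by (simp add: vec_eq_iff axis_def)
        from injD[OF inj this] show False by (simp add: axis_eq_0_iff)
      qed
      have "0 < (\<Prod>i\<in>UNIV. \<bar>c i\<bar>)" using c by (intro prod_pos) auto
      then show "\<exists>k>0. \<forall>F\<in>borel_measurable borel. (\<integral>\<^sup>+ u. F u \<partial>lborel) = ennreal k * (\<integral>\<^sup>+ u. F (\<chi> i. c i * u $ i) \<partial>lborel)"
        using nn_integral_diagonal[of _ c, OF _ c] by blast
    qed
  next
    fix m n :: 'n assume "m \<noteq> n"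
    have "bij (Transposition.transpose m n)" by simp
    from nn_integral_coordinate_permutation[OF _ this]
    show "P (\<lambda>x. \<chi> i. x $ Transposition.transpose m n i)" unfolding P_def
      by (intro impI exI[of _ 1]) simp
  next
    fix m n :: 'n assume mn: "m \<noteq> n"
    have "(\<chi> i. if i = m then u $ m + u $ n else u $ i) = u + (u $ n) *\<^sub>R axis m 1" for u :: "real^'n"
      by (simp add: vec_eq_iff axis_def)
    moreover have "(\<integral>\<^sup>+ u. F (u + (u $ n) *\<^sub>R axis m 1) \<partial>lborel) = (\<integral>\<^sup>+ u. F u \<partial>lborel)"
      if "F \<in> borel_measurable borel" for F :: "real^'n \<Rightarrow> ennreal"
      by (rule nn_integral_shear[OF that]) (use mn in auto)
    ultimately show "P (\<lambda>x. \<chi> i. if i = m then x $ m + x $ n else x $ i)" unfolding P_def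
      by (intro impI exI[of _ 1]) simp
  qed
  then show ?thesis using assms by (simp add: P_def)
qed

text \<open>The proportionality constant is 1 because isometries preserve the unit ball.\<close>

lemma nn_integral_isometry:
  fixes T :: "real^'n \<Rightarrow> real^'n"
  assumes lin: "linear T" and nT: "\<And>u. norm (T u) = norm u" and F: "F \<in> borel_measurable borel"
  shows "(\<integral>\<^sup>+ u. F u \<partial>lborel) = (\<integral>\<^sup>+ u. F (T u) \<partial>lborel)"
proof -
  have "inj T"
  proof (rule injI)
    fix u w assume "T u = T w"
    then have "norm (T (u - w)) = 0" using lin by (simp add: linear_diff)
    then show "u = w" using nT by simp
  qed
  then obtain c where c: "0 < c" "\<And>F. F \<in> borel_measurable borel \<Longrightarrow> (\<integral>\<^sup>+ u. F u \<partial>lborel) = ennreal c * (\<integral>\<^sup>+ u. F (T u) \<partial>lborel)"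
    using nn_integral_linear_proportional[OF lin] by blast
  let ?B = "ball (0::real^'n) 1"
  let ?b = "unit_ball_vol (real CARD('n))"
  have e: "emeasure lborel ?B = ennreal ?b" by (simp add: emeasure_ball)
  have "(\<integral>\<^sup>+ u. indicator ?B u \<partial>lborel) = ennreal c * (\<integral>\<^sup>+ u. indicator ?B (T u) \<partial>lborel)"
    by (rule c(2), rule borel_measurable_indicator) simp
  also have "(\<lambda>u. indicator ?B (T u) :: ennreal) = indicator ?B" by (auto simp: indicator_def nT fun_eq_iff)
  finally have "ennreal ?b = ennreal (c * ?b)" using c(1) e by (simp add: ennreal_mult')
  moreover have "0 < ?b" by simp
  ultimately have "c = 1" using c(1) by (simp add: ennreal_inj mult_nonneg_nonneg less_imp_le)
  then show ?thesis using c(2)[OF F] by simp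
qed

subsection \<open>Asymptotics of the integral over the ball\<close>

lemma dominated_convergence_at_right:
  fixes s :: "real \<Rightarrow> 'b \<Rightarrow> real"
  assumes "\<And>h. 0 < h \<Longrightarrow> s h \<in> borel_measurable M" "f \<in> borel_measurable M" "integrable M w"
    and lim: "AE x in M. ((\<lambda>h. s h x) \<longlongrightarrow> f x) (at_right 0)"
    and dom: "\<And>h. 0 < h \<Longrightarrow> AE x in M. norm (s h x) \<le> w x"
  shows "((\<lambda>h. integral\<^sup>L M (s h)) \<longlongrightarrow> integral\<^sup>L M f) (at_right 0)"
  unfolding tendsto_at_iff_sequentially
proof (intro allI impI)
  fix X :: "nat \<Rightarrow> real" assume X: "\<forall>i. X i \<in> {0<..} - {0}" "X \<longlonglongrightarrow> 0"
  have "(\<lambda>i. integral\<^sup>L M (s (X i))) \<longlonglongrightarrow> integral\<^sup>L M f"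
  proof (rule integral_dominated_convergence[where w = w])
    show "AE x in M. (\<lambda>i. s (X i) x) \<longlonglongrightarrow> f x"
      using lim
    proof eventually_elim
      case (elim x)
      have "0 < X i" for i using X(1) by auto
      then have "\<forall>i. X i \<noteq> 0 \<and> 0 < X i" by (metis less_irrefl)
      then have "filterlim X (at_right 0) sequentially"
        using X(2) by (simp add: filterlim_at)
      with elim show ?case by (rule filterlim_compose)
    qed
  qed (use assms X in auto)
  then show "((\<lambda>h. integral\<^sup>L M (s h)) \<circ> X) \<longlonglongrightarrow> integral\<^sup>L M f" by (simp add: comp_def)
qed

lemma emeasure_PiM_ball_sq:
  assumes "finite I" "0 < \<sigma>"
  shows "emeasure (Pi\<^sub>M I (\<lambda>_. lborel)) {w \<in> space (Pi\<^sub>M I (\<lambda>_. lborel)). (\<Sum>i\<in>I. (w i)\<^sup>2) \<le> \<sigma>}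
    = ennreal (unit_ball_vol (real (card I)) * \<sigma> powr (real (card I) / 2))"
proof -
  have "{w \<in> space (Pi\<^sub>M I (\<lambda>_. lborel)). (\<Sum>i\<in>I. (w i)\<^sup>2) \<le> \<sigma>}
      = {w. sqrt (\<Sum>i\<in>I. (w i)\<^sup>2) \<le> sqrt \<sigma>} \<inter> space (Pi\<^sub>M I (\<lambda>_. lborel :: real measure))" by auto
  moreover have "sqrt \<sigma> ^ card I = \<sigma> powr (real (card I) / 2)"
    using assms(2) by (simp add: powr_half_sqrt[symmetric] powr_realpow[symmetric] powr_powr)
  ultimately show ?thesis using emeasure_cball_aux[OF assms(1), of "sqrt \<sigma>"] assms(2) by simp
qed

section \<open>Blow-up coordinates and integrals over the limit region\<close>

context touching_ball
begin

text \<open>The determinant of \<open>blowup h\<close>, up to sign, with the power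
  \<open>h^(N+1)\<close> taken out.\<close>

definition jacobian :: real where "jacobian = (\<Prod>i\<in>UNIV - {i0}. width i)"

lemma jacobian_pos: "0 < jacobian" unfolding jacobian_def using width_pos by (intro prod_pos) auto

lemma blowup_continuous [continuous_intros]: "continuous_on S (blowup h)"
  unfolding blowup_def by (intro continuous_intros)

lemma blowup_measurable [measurable]: "blowup h \<in> borel_measurable borel"
  by (intro borel_measurable_continuous_onI blowup_continuous)

text \<open>\<open>blowup h\<close> is a diagonal scaling followed by the isometry that sends the
  standard basis to the frame \<open>e\<close>.\<close>

lemma change_of_variables_nn:
  fixes f :: "real^'n \<Rightarrow> ennreal"
  assumes f [measurable]: "f \<in> borel_measurable borel" and h: "0 < h"
  shows "(\<integral>\<^sup>+ y. f y \<partial>lborel) = ennreal (h ^ (CARD('n) + 1) * jacobian) * (\<integral>\<^sup>+ u. f (z + blowup h u) \<partial>lborel)"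
proof -
  define Q :: "real^'n \<Rightarrow> real^'n" where "Q w = (\<Sum>i\<in>UNIV. w $ i *\<^sub>R e i)" for w
  define a where "a i = (if i = i0 then h\<^sup>2 else h * width i)" for i
  have a: "0 < a i" for i using h width_pos[of i] by (auto simp: a_def)
  have lin: "linear Q"
    unfolding Q_def by (rule linearI) (simp_all add: scaleR_add_left sum.distrib scaleR_sum_right)
  have nQ: "norm (Q w) = norm w" for w
  proof -
    have "Q w \<bullet> e i = w $ i" for i
      unfolding Q_def inner_sum_left inner_scaleR_left orth by (simp add: if_distrib cong: if_cong)
    then have "(norm (Q w))\<^sup>2 = (\<Sum>i\<in>UNIV. (w $ i)\<^sup>2)"
      using orthonormal_frame_norm[OF orth, of "Q w"] by simp
    also have "\<dots> = (norm w)\<^sup>2" by (simp add: norm_vec_def L2_set_def sum_nonneg)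
    finally have "(norm (Q w))\<^sup>2 = (norm w)\<^sup>2" .
    then show ?thesis by simp
  qed
  have QA: "Q (\<chi> i. a i * u $ i) = blowup h u" for u by (simp add: Q_def blowup_def a_def)
  have [measurable]: "Q \<in> borel_measurable borel"
    using lin by (intro borel_measurable_continuous_onI linear_continuous_on) (simp add: linear_conv_bounded_linear)
  have "(\<integral>\<^sup>+ y. f y \<partial>lborel) = (\<integral>\<^sup>+ y. f y \<partial>distr lborel borel ((+) z))" by (simp add: lborel_distr_plus)
  also have "\<dots> = (\<integral>\<^sup>+ y. f (z + y) \<partial>lborel)" by (subst nn_integral_distr) auto
  also have "\<dots> = (\<integral>\<^sup>+ y. f (z + Q y) \<partial>lborel)" by (rule nn_integral_isometry[OF lin nQ]) measurable
  also have "\<dots> = ennreal (\<Prod>i\<in>UNIV. \<bar>a i\<bar>) * (\<integral>\<^sup>+ u. f (z + Q (\<chi> i. a i * u $ i)) \<partial>lborel)"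
    by (rule nn_integral_diagonal) (use a in \<open>auto simp: less_imp_neq[symmetric]\<close>)
  also have "(\<Prod>i\<in>UNIV. \<bar>a i\<bar>) = a i0 * (\<Prod>i\<in>UNIV - {i0}. h * width i)"
    using a by (simp add: prod.remove[of UNIV i0] abs_of_pos) (simp add: a_def)
  also have "\<dots> = h ^ (CARD('n) + 1) * jacobian"
  proof -
    have "h\<^sup>2 * h ^ (CARD('n) - 1) = h ^ (CARD('n) + 1)"
      by (simp add: power_add[symmetric] Suc_diff_1 flip: power_Suc)
    then show ?thesis by (simp add: a_def prod.distrib jacobian_def card_Diff_singleton mult.assoc[symmetric])
  qed
  finally show ?thesis unfolding QA .
qed

lemma change_of_variables:
  fixes f :: "real^'n \<Rightarrow> real"
  assumes f: "f \<in> borel_measurable borel" and h: "0 < h"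
  shows "(\<integral>y. f y \<partial>lborel) = h ^ (CARD('n) + 1) * jacobian * (\<integral>u. f (z + blowup h u) \<partial>lborel)"
proof -
  let ?k = "h ^ (CARD('n) + 1) * jacobian"
  let ?T = "\<lambda>u. z + blowup h u"
  have k: "0 < ?k" using h jacobian_pos by simp
  \<comment> \<open>Nonnegative integrals of indicators identify \<open>lborel\<close> as an image
    measure with constant density; this carries over to Bochner integrals without a hypothesis of
    integrability.\<close>
  have "lborel = density (distr lborel borel ?T) (\<lambda>_. ennreal ?k)"
  proof (rule measure_eqI)
    fix S :: "(real^'n) set" assume "S \<in> sets lborel"
    then have S [measurable]: "S \<in> sets borel" by simp
    have "emeasure lborel S = (\<integral>\<^sup>+ y. indicator S y \<partial>lborel)" by simp
    also have "\<dots> = ennreal ?k * (\<integral>\<^sup>+ u. indicator S (?T u) \<partial>lborel)"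
      by (rule change_of_variables_nn[OF _ h]) measurable
    also have "(\<integral>\<^sup>+ u. indicator S (?T u) \<partial>lborel) = (\<integral>\<^sup>+ y. indicator S y \<partial>distr lborel borel ?T)"
      by (rule nn_integral_distr[symmetric]) measurable
    also have "ennreal ?k * (\<integral>\<^sup>+ y. indicator S y \<partial>distr lborel borel ?T)
        = emeasure (density (distr lborel borel ?T) (\<lambda>_. ennreal ?k)) S"
      by (simp add: emeasure_density nn_integral_cmult)
    finally show "emeasure lborel S = emeasure (density (distr lborel borel ?T) (\<lambda>_. ennreal ?k)) S" .
  qed simp
  then have "(\<integral>y. f y \<partial>lborel) = (\<integral>y. f y \<partial>density (distr lborel borel ?T) (\<lambda>_. ennreal ?k))" by simp
  also have "\<dots> = ?k * (\<integral>u. f (?T u) \<partial>lborel)"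
    using f k by (subst integral_density) (auto simp: integral_distr)
  finally show ?thesis .
qed

lemma rho_measurable [measurable]: "rho \<in> borel_measurable borel"
  unfolding rho_def[abs_def] by (intro borel_measurable_continuous_onI continuous_intros)

lemma curv_form_measurable [measurable]: "curv_form \<in> borel_measurable borel"
  unfolding curv_form_def[abs_def] by (intro borel_measurable_continuous_onI continuous_intros) auto

lemma height_measurable [measurable]: "height \<in> borel_measurable borel"
  unfolding height_def[abs_def]
  by (intro borel_measurable_diff curv_form_measurable borel_measurable_continuous_onI[of "\<lambda>u. u $ i0"] continuous_intros)

text \<open>A shear by \<open>curv_form\<close> in the normal direction turns \<open>height\<close>
  into the plain coordinate \<open>u $ i0\<close> and leaves \<open>rho\<close>, which sees only
  tangential coordinates, unchanged.\<close>

lemma nn_integral_rho_height: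
  fixes H :: "real \<Rightarrow> real \<Rightarrow> ennreal"
  assumes H [measurable]: "case_prod H \<in> borel_measurable borel"
  shows "(\<integral>\<^sup>+ u. H (rho u) (height u) \<partial>lborel)
    = (\<integral>\<^sup>+ w. (\<integral>\<^sup>+ s. H (\<Sum>i\<in>UNIV - {i0}. (w i)\<^sup>2) s \<partial>lborel) \<partial>Pi\<^sub>M (UNIV - {i0}) (\<lambda>_. lborel))"
proof -
  have m: "(\<lambda>u. H (rho u) (u $ i0)) \<in> borel_measurable borel"
  proof -
    have "(\<lambda>u. (rho u, u $ i0)) \<in> borel_measurable borel"
      by (intro borel_measurable_Pair rho_measurable borel_measurable_continuous_onI continuous_intros)
    from measurable_compose[OF this H] show ?thesis by simp
  qed
  have r: "rho (u + b *\<^sub>R axis i0 1) = rho u" for u b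
    unfolding rho_def by (rule sum.cong) (auto simp: axis_def)
  have "(\<integral>\<^sup>+ u. H (rho u) (height u) \<partial>lborel)
      = (\<integral>\<^sup>+ u. H (rho (u + (- curv_form u) *\<^sub>R axis i0 1)) ((u + (- curv_form u) *\<^sub>R axis i0 1) $ i0) \<partial>lborel)"
    unfolding r by (simp add: height_def)
  also have "\<dots> = (\<integral>\<^sup>+ u. H (rho u) (u $ i0) \<partial>lborel)"
  proof (rule nn_integral_shear[OF m])
    show "(\<lambda>u. - curv_form u) \<in> borel_measurable borel" by measurable
    show "- curv_form u = - curv_form w" if "\<And>j. j \<noteq> i0 \<Longrightarrow> u $ j = w $ j" for u w
      unfolding curv_form_def using that by (auto intro!: sum.cong)
  qed
  also have "\<dots> = (\<integral>\<^sup>+ w. (\<integral>\<^sup>+ s. H (rho (\<chi> j. (w(i0 := s)) j)) ((\<chi> j. (w(i0 := s)) j) $ i0) \<partial>lborel) \<partial>Pi\<^sub>M (UNIV - {i0}) (\<lambda>_. lborel))"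
    by (rule nn_integral_vec_fiber[OF m])
  also have "\<dots> = (\<integral>\<^sup>+ w. (\<integral>\<^sup>+ s. H (\<Sum>i\<in>UNIV - {i0}. (w i)\<^sup>2) s \<partial>lborel) \<partial>Pi\<^sub>M (UNIV - {i0}) (\<lambda>_. lborel))"
  proof -
    have "rho (\<chi> j. (w(i0 := s)) j) = (\<Sum>i\<in>UNIV - {i0}. (w i)\<^sup>2)" for w s
      unfolding rho_def by (rule sum.cong) auto
    moreover have "(\<chi> j. (w(i0 := s)) j) $ i0 = s" for w :: "'n \<Rightarrow> real" and s by simp
    ultimately show ?thesis by (simp only:)
  qed
  finally show ?thesis .
qed

text \<open>Spares a discussion of the limit on the edge of the limit region, where the behaviour of
  the barriers is not controlled.\<close>

lemma AE_rho_neq_height: "AE u in lborel. rho u \<noteq> height u"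
proof -
  define H :: "real \<Rightarrow> real \<Rightarrow> ennreal" where "H a b = indicator {(a, b). a = b} (a, b)" for a b
  have "closed {(a::real, b). a = b}" unfolding case_prod_beta by (intro closed_Collect_eq continuous_intros)
  then have "case_prod H \<in> borel_measurable borel"
    unfolding H_def by (simp add: case_prod_beta borel_measurable_indicator_iff)
  from nn_integral_rho_height[OF this]
  have "(\<integral>\<^sup>+ u. H (rho u) (height u) \<partial>lborel)
    = (\<integral>\<^sup>+ w. (\<integral>\<^sup>+ s. H (\<Sum>i\<in>UNIV - {i0}. (w i)\<^sup>2) s \<partial>lborel) \<partial>Pi\<^sub>M (UNIV - {i0}) (\<lambda>_. lborel))" .
  also have "\<dots> = 0"
  proof -
    have "(\<integral>\<^sup>+ s. H a s \<partial>lborel) = (\<integral>\<^sup>+ s. indicator {a} s \<partial>lborel)" for a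
      by (rule nn_integral_cong) (auto simp: H_def indicator_def)
    then show ?thesis by simp
  qed
  finally have "(\<integral>\<^sup>+ u. H (rho u) (height u) \<partial>lborel) = 0" .
  then have "(\<integral>\<^sup>+ u. indicator {u. rho u = height u} u \<partial>lborel) = 0"
    by (simp add: H_def indicator_def)
  moreover have "{u. rho u = height u} \<in> sets borel" by measurable
  ultimately have "{u. rho u = height u} \<in> null_sets lborel" by (simp add: null_sets_def)
  from AE_not_in[OF this] show ?thesis by simp
qed

text \<open>For fixed height \<open>s\<close> the tangential slice is a ball of radius
  \<open>sqrt s\<close> in dimension \<open>N - 1\<close>; its volume is the source of the weight
  \<open>\<sigma>^((N-1)/2)\<close> in the constant.\<close>

lemma nn_integral_region:
  fixes g :: "real \<Rightarrow> real"
  assumes g [measurable]: "g \<in> borel_measurable borel"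
  shows "(\<integral>\<^sup>+ u. ennreal (indicator {u. rho u < height u} u * g (height u)) \<partial>lborel)
    = (\<integral>\<^sup>+ s. ennreal (indicator {0<..} s * (unit_ball_vol (real (CARD('n) - 1)) * s powr (real (CARD('n) - 1) / 2) * g s)) \<partial>lborel)"
proof -
  let ?I = "UNIV - {i0}"
  let ?P = "Pi\<^sub>M ?I (\<lambda>_. lborel :: real measure)"
  let ?V = "unit_ball_vol (real (CARD('n) - 1))"
  interpret pf: product_sigma_finite "\<lambda>_::'n. lborel :: real measure" by standard
  interpret ps: pair_sigma_finite ?P "lborel :: real measure"
    by (intro pair_sigma_finite.intro pf.sigma_finite sigma_finite_lborel) simp
  define r where "r w = (\<Sum>i\<in>?I. (w i)\<^sup>2)" for w :: "'n \<Rightarrow> real"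
  have r [measurable]: "r \<in> borel_measurable ?P" unfolding r_def by measurable
  define H :: "real \<Rightarrow> real \<Rightarrow> ennreal" where "H a b = ennreal (indicator {p. fst p < snd p} (a, b) * g b)" for a b
  have "open {p::real \<times> real. fst p < snd p}" by (intro open_Collect_less continuous_intros)
  then have "{p::real \<times> real. fst p < snd p} \<in> sets borel" by (rule borel_open)
  then have i: "(indicator {p::real \<times> real. fst p < snd p} :: real \<times> real \<Rightarrow> real) \<in> borel_measurable borel"
    by (rule borel_measurable_indicator)
  have g2: "(\<lambda>p::real \<times> real. g (snd p)) \<in> borel_measurable borel"
    by (rule measurable_compose[OF _ g]) (intro borel_measurable_continuous_onI continuous_intros)
  have mH: "case_prod H \<in> borel_measurable borel"
    unfolding H_def case_prod_beta prod.collapse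
    by (intro measurable_compose[OF _ measurable_ennreal] borel_measurable_times i g2)
  have "(\<integral>\<^sup>+ u. ennreal (indicator {u. rho u < height u} u * g (height u)) \<partial>lborel) = (\<integral>\<^sup>+ u. H (rho u) (height u) \<partial>lborel)"
    by (rule nn_integral_cong) (simp add: H_def indicator_def)
  also have "\<dots> = (\<integral>\<^sup>+ w. (\<integral>\<^sup>+ s. H (r w) s \<partial>lborel) \<partial>?P)" unfolding r_def by (rule nn_integral_rho_height[OF mH])
  \<comment> \<open>Passing from \<open>r w < s\<close> to \<open>r w \<le> s\<close> changes the
    inner integrand only at the point \<open>s = r w\<close>; the slices become closed
    balls.\<close>
  also have "\<dots> = (\<integral>\<^sup>+ w. (\<integral>\<^sup>+ s. indicator {w \<in> space ?P. r w \<le> s} w * ennreal (g s) \<partial>lborel) \<partial>?P)"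
  proof (rule nn_integral_cong)
    fix w assume w: "w \<in> space ?P"
    show "(\<integral>\<^sup>+ s. H (r w) s \<partial>lborel) = (\<integral>\<^sup>+ s. indicator {w \<in> space ?P. r w \<le> s} w * ennreal (g s) \<partial>lborel)"
    proof (rule nn_integral_cong_AE)
      show "AE s in lborel. H (r w) s = indicator {w \<in> space ?P. r w \<le> s} w * ennreal (g s)"
        using AE_lborel_singleton[of "r w"] by eventually_elim (use w in \<open>auto simp: H_def indicator_def\<close>)
    qed
  qed
  also have "\<dots> = (\<integral>\<^sup>+ s. (\<integral>\<^sup>+ w. indicator {w \<in> space ?P. r w \<le> s} w * ennreal (g s) \<partial>?P) \<partial>lborel)"
  proof (rule ps.Fubini'[symmetric])
    have "(\<lambda>(w, s). indicator {p \<in> space (?P \<Otimes>\<^sub>M lborel). r (fst p) \<le> snd p} (w, s) * ennreal (g s)) \<in> borel_measurable (?P \<Otimes>\<^sub>M lborel)"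
      by measurable
    also have "?this \<longleftrightarrow> (\<lambda>(w, s). indicator {w \<in> space ?P. r w \<le> s} w * ennreal (g s)) \<in> borel_measurable (?P \<Otimes>\<^sub>M lborel)"
      by (rule measurable_cong) (auto simp: indicator_def space_pair_measure)
    finally show "(\<lambda>(w, s). indicator {w \<in> space ?P. r w \<le> s} w * ennreal (g s)) \<in> borel_measurable (?P \<Otimes>\<^sub>M lborel)" .
  qed
  also have "\<dots> = (\<integral>\<^sup>+ s. ennreal (indicator {0<..} s * (?V * s powr (real (CARD('n) - 1) / 2) * g s)) \<partial>lborel)"
  proof (rule nn_integral_cong_AE)
    show "AE s in lborel. (\<integral>\<^sup>+ w. indicator {w \<in> space ?P. r w \<le> s} w * ennreal (g s) \<partial>?P)
        = ennreal (indicator {0<..} s * (?V * s powr (real (CARD('n) - 1) / 2) * g s))"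
      using AE_lborel_singleton[of "0::real"]
    proof eventually_elim
      case (elim s)
      have "(\<integral>\<^sup>+ w. indicator {w \<in> space ?P. r w \<le> s} w * ennreal (g s) \<partial>?P)
          = emeasure ?P {w \<in> space ?P. r w \<le> s} * ennreal (g s)"
        by (simp add: nn_integral_multc)
      also have "\<dots> = ennreal (indicator {0<..} s * (?V * s powr (real (CARD('n) - 1) / 2) * g s))"
      proof (cases "0 < s")
        case True
        then show ?thesis unfolding r_def using emeasure_PiM_ball_sq[of ?I s]
          by (simp add: ennreal_mult' card_Diff_singleton)
      next
        case False
        have "0 \<le> r w" for w by (simp add: r_def sum_nonneg)
        then have emp: "{w \<in> space ?P. r w \<le> s} = {}" using False elim by (smt (verit) Collect_empty_eq)
        show ?thesis unfolding emp using False by simp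
      qed
      finally show ?case .
    qed
  qed
  finally show ?thesis .
qed

lemma integral_region:
  fixes g :: "real \<Rightarrow> real"
  assumes g [measurable]: "g \<in> borel_measurable borel" and g0: "\<And>s. 0 \<le> g s"
  shows "(\<integral>u. indicator {u. rho u < height u} u * g (height u) \<partial>lborel)
    = unit_ball_vol (real (CARD('n) - 1)) * (LINT s:{0<..}|lborel. g s * s powr (real (CARD('n) - 1) / 2))"
proof -
  have "(\<integral>u. indicator {u. rho u < height u} u * g (height u) \<partial>lborel)
      = enn2real (\<integral>\<^sup>+ u. ennreal (indicator {u. rho u < height u} u * g (height u)) \<partial>lborel)"
    by (rule integral_eq_nn_integral) (use g0 in \<open>auto intro!: AE_I2\<close>)
  also have "\<dots> = (\<integral>s. indicator {0<..} s * (unit_ball_vol (real (CARD('n) - 1)) * s powr (real (CARD('n) - 1) / 2) * g s) \<partial>lborel)"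
    unfolding nn_integral_region[OF g]
    by (rule integral_eq_nn_integral[symmetric]) (use g0 in \<open>auto intro!: AE_I2\<close>)
  also have "\<dots> = (\<integral>s. unit_ball_vol (real (CARD('n) - 1)) * (indicator {0<..} s *\<^sub>R (g s * s powr (real (CARD('n) - 1) / 2))) \<partial>lborel)"
    by (simp add: mult_ac)
  finally show ?thesis unfolding set_lebesgue_integral_def by simp
qed

text \<open>Integration over the slices leaves \<open>s^((N-1)/2) exp (- s)\<close>, whose integral
  is a value of Gamma. So an exponential in \<open>height\<close> is a sufficient majorant.\<close>

lemma integrable_region_exp: "integrable lborel (\<lambda>u. C * (indicator {u. rho u < height u} u * exp (- height u)))"
proof (rule integrable_mult_right, rule integrableI_nonneg)
  let ?V = "unit_ball_vol (real (CARD('n) - 1))"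
  let ?p = "real (CARD('n) - 1) / 2"
  show "(\<lambda>u. indicator {u. rho u < height u} u * exp (- height u)) \<in> borel_measurable lborel" by measurable
  show "AE u in lborel. 0 \<le> indicator {u. rho u < height u} u * exp (- height u)" by simp
  have "(\<integral>\<^sup>+ u. ennreal (indicator {u. rho u < height u} u * exp (- height u)) \<partial>lborel)
     = (\<integral>\<^sup>+ s. ennreal (indicator {0<..} s * (?V * s powr ?p * exp (- s))) \<partial>lborel)"
    by (rule nn_integral_region) measurable
  also have "\<dots> = (\<integral>\<^sup>+ s. ennreal ?V * ennreal (indicator {0..} s * (s powr (?p + 1 - 1) / exp s)) \<partial>lborel)"
  proof (rule nn_integral_cong_AE)
    show "AE s in lborel. ennreal (indicator {0<..} s * (?V * s powr ?p * exp (- s)))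
        = ennreal ?V * ennreal (indicator {0..} s * (s powr (?p + 1 - 1) / exp s))"
      using AE_lborel_singleton[of "0::real"]
    proof eventually_elim
      case (elim s)
      have "?V * s powr ?p * exp (- s) = ?V * (s powr (?p + 1 - 1) / exp s)"
        by (simp only: exp_minus divide_inverse add_diff_cancel_right' mult.assoc)
      moreover have "indicator {0..} s = (indicator {0<..} s :: real)" using elim by (simp add: indicator_def)
      ultimately show ?case
        by (simp add: indicator_def ennreal_mult'[symmetric] del: ennreal_mult')
    qed
  qed
  also have "\<dots> = ennreal ?V * (\<integral>\<^sup>+ s. ennreal (indicator {0..} s * (s powr (?p + 1 - 1) / exp s)) \<partial>lborel)"
    by (rule nn_integral_cmult) measurable
  also have "(\<integral>\<^sup>+ s. ennreal (indicator {0..} s * (s powr (?p + 1 - 1) / exp s)) \<partial>lborel) = ennreal (Gamma (?p + 1))"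
    by (rule nn_integral_has_integral_lebesgue[OF _ Gamma_integral_real]) (auto simp: add_nonneg_pos)
  also have "ennreal ?V * ennreal (Gamma (?p + 1)) < \<infinity>" by (simp add: ennreal_mult_less_top)
  finally show "(\<integral>\<^sup>+ u. ennreal (indicator {u. rho u < height u} u * exp (- height u)) \<partial>lborel) < \<infinity>" .
qed

lemma v_ball_range: "y \<in> ball x R \<Longrightarrow> 0 < t \<Longrightarrow> 0 \<le> v (y, t) \<and> v (y, t) \<le> 1"
  using v_range_interior[of y t] ball_sub by auto

lemma v_measurable_ball:
  assumes "0 < t"
  shows "(\<lambda>y. indicator (ball x R) y * v (y, t)) \<in> borel_measurable borel"
proof -
  have "continuous_on (ball x R) (\<lambda>y. v (y, t))"
  proof (rule continuous_on_compose2[of _ v])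
    show "continuous_on (closure \<Omega> \<times> {0<..}) v" by (rule v_continuous_on) simp
    show "continuous_on (ball x R) (\<lambda>y. (y, t))" by (intro continuous_intros)
    show "(\<lambda>y. (y, t)) ` ball x R \<subseteq> closure \<Omega> \<times> {0<..}"
      using ball_sub closure_subset[of \<Omega>] assms by auto
  qed
  from borel_measurable_continuous_on_indicator[OF _ this]
  show ?thesis by simp
qed

text \<open>The Gaussian bound is in terms of the distance to the tangent plane, but the majorant
  has to be a function of \<open>height\<close>. On the blown-up ball the two are comparable, and a
  Gaussian is dominated by an exponential.\<close>

lemma v_power_domination:
  assumes p: "0 < p"
  obtains C where "0 < C" "\<And>h u. 0 < h \<Longrightarrow> z + blowup h u \<in> ball x R \<Longrightarrow>
    v (z + blowup h u, h ^ 4) powr p \<le> C * (indicator {u. rho u < height u} u * exp (- height u))"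
proof -
  obtain C a where C: "0 < C" and a: "0 < a"
    and bnd: "\<And>y t. y \<in> ball x R \<Longrightarrow> 0 < t \<Longrightarrow> v (y, t) \<le> C * exp (- (a * ((y - z) \<bullet> e i0)\<^sup>2 / t))"
    using gaussian_domination by blast
  define M where "M = (\<Sum>i\<in>UNIV - {i0}. \<bar>k i\<bar>)"
  have M0: "0 \<le> M" unfolding M_def by (simp add: sum_nonneg)
  have kM: "- k i \<le> M" if "i \<noteq> i0" for i
  proof -
    have "\<bar>k i\<bar> \<le> M" unfolding M_def by (rule member_le_sum) (use that in auto)
    then show ?thesis by linarith
  qed
  \<comment> \<open>In the ball \<open>- curv_form u \<le> M * R * (rho u + curv_form u) \<le> M * R
    * u $ i0\<close>, hence \<open>height u \<le> B * u $ i0\<close>.\<close>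
  define B where "B = 1 + M * R"
  have B: "1 \<le> B" using M0 R by (simp add: B_def)
  define \<alpha> where "\<alpha> = a * p / B\<^sup>2"
  have \<alpha>: "0 < \<alpha>" using a p B by (simp add: \<alpha>_def)
  show thesis
  proof (rule that)
    show "0 < C powr p * exp (1 / (4 * \<alpha>))" using C by simp
    fix h u assume h: "0 < h" and inb: "z + blowup h u \<in> ball x R"
    define s where "s = u $ i0"
    have reg: "rho u < height u" using inb not_in_ball[of u h] h by blast
    have sg0: "0 < height u" using reg rho_nonneg[of u] by linarith
    have "- curv_form u \<le> M * (\<Sum>i\<in>UNIV - {i0}. (width i * u $ i)\<^sup>2) / 2"
    proof -
      have "- (\<Sum>i\<in>UNIV - {i0}. k i * (width i * u $ i)\<^sup>2) \<le> (\<Sum>i\<in>UNIV - {i0}. M * (width i * u $ i)\<^sup>2)"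
        unfolding sum_negf[symmetric] using kM
        by (intro sum_mono) (metis DiffE insertI1 mult_minus_left mult_right_mono zero_le_power2)
      then show ?thesis unfolding curv_form_def by (simp add: sum_distrib_left)
    qed
    also have "\<dots> = M * R * (rho u + curv_form u)" unfolding rho_curv_form using R by simp
    also have "\<dots> \<le> M * R * s" using reg M0 R by (intro mult_left_mono) (auto simp: height_def s_def)
    finally have sgB: "height u \<le> B * s" by (simp add: height_def s_def B_def algebra_simps)
    then have "height u / B \<le> s" using B by (simp add: field_simps)
    then have "(height u / B)\<^sup>2 \<le> s\<^sup>2" using sg0 B by (intro power_mono) auto
    then have "a * p * (height u / B)\<^sup>2 \<le> a * p * s\<^sup>2" using a p by (intro mult_left_mono) auto
    then have 1: "\<alpha> * (height u)\<^sup>2 \<le> a * p * s\<^sup>2" by (simp add: \<alpha>_def power_divide)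
    \<comment> \<open>Completing the square trades the quadratic exponent for a linear one.\<close>
    have 2: "height u \<le> \<alpha> * (height u)\<^sup>2 + 1 / (4 * \<alpha>)"
    proof -
      have "0 \<le> (2 * \<alpha> * height u - 1)\<^sup>2 / (4 * \<alpha>)" using \<alpha> by simp
      also have "\<dots> = \<alpha> * (height u)\<^sup>2 + 1 / (4 * \<alpha>) - height u"
        using \<alpha> by (simp add: field_simps power2_eq_square)
      finally show ?thesis by simp
    qed
    have vv: "v (z + blowup h u, h ^ 4) \<le> C * exp (- (a * s\<^sup>2))"
    proof -
      have "(z + blowup h u - z) \<bullet> e i0 = h\<^sup>2 * s" by (simp add: blowup_inner s_def)
      moreover have "a * (h\<^sup>2 * s)\<^sup>2 / h ^ 4 = a * s\<^sup>2" using h by (simp add: power_mult_distrib)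
      ultimately show ?thesis using bnd[OF inb, of "h ^ 4"] h by simp
    qed
    have "v (z + blowup h u, h ^ 4) powr p \<le> (C * exp (- (a * s\<^sup>2))) powr p"
      using vv v_ball_range[OF inb, of "h ^ 4"] h p by (intro powr_mono2) auto
    also have "\<dots> = C powr p * exp (- (a * p * s\<^sup>2))"
      using C by (simp add: powr_mult exp_powr_real mult_ac)
    also have "\<dots> \<le> C powr p * exp (1 / (4 * \<alpha>) - height u)"
      using 1 2 by (intro mult_left_mono) auto
    also have "\<dots> = C powr p * exp (1 / (4 * \<alpha>)) * (indicator {u. rho u < height u} u * exp (- height u))"
    proof -
      have ind: "indicator {u. rho u < height u} u = (1 :: real)" using reg by simp
      show ?thesis unfolding ind mult_1 mult.assoc exp_add[symmetric] by simp
    qed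
    finally show "v (z + blowup h u, h ^ 4) powr p \<le> C powr p * exp (1 / (4 * \<alpha>)) * (indicator {u. rho u < height u} u * exp (- height u))" .
  qed
qed

text \<open>The limit of the integral of \<open>v (y, h^4)^p\<close> over the ball, divided by
  \<open>h^(N+1)\<close>.\<close>

definition limit_mass :: "real \<Rightarrow> real" where
  "limit_mass p = jacobian * (\<integral>u. indicator {u. rho u < height u} u * Erfc (height u / (2 * sqrt l)) powr p \<partial>lborel)"

text \<open>\<open>m\<close> stands for the trial mean. It tends to 0 while \<open>v\<close>
  converges to the Erfc profile in blown-up coordinates, so the subtraction disappears in the limit;
  being nonnegative, it does not disturb the majorant either.\<close>

lemma upper_part_limit:
  assumes p: "0 < p" and m: "(m \<longlongrightarrow> 0) (at_right 0)" and m0: "\<And>h. 0 < h \<Longrightarrow> 0 \<le> m h"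
  shows "((\<lambda>h. (LINT y:ball x R|lborel. (max (v (y, h ^ 4) - m h) 0) powr p) / h ^ (CARD('n) + 1)) \<longlongrightarrow> limit_mass p) (at_right 0)"
proof -
  obtain C where C: "0 < C" and dom: "\<And>h u. 0 < h \<Longrightarrow> z + blowup h u \<in> ball x R \<Longrightarrow>
    v (z + blowup h u, h ^ 4) powr p \<le> C * (indicator {u. rho u < height u} u * exp (- height u))"
    using v_power_domination[OF p] by blast
  define f where "f h y = indicator (ball x R) y * (max (v (y, h ^ 4) - m h) 0) powr p" for h y
  have f_meas [measurable]: "f h \<in> borel_measurable borel" if "0 < h" for h
  proof -
    define w where "w y = indicator (ball x R) y * v (y, h ^ 4)" for y
      have [measurable]: "ball x R \<in> sets borel" by simp
      have [measurable]: "w \<in> borel_measurable borel"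
        unfolding w_def[abs_def] by (rule v_measurable_ball) (use that in simp)
    have "f h = (\<lambda>y. indicator (ball x R) y * (max (w y - m h) 0) powr p)"
      by (auto simp: f_def w_def indicator_def)
    also have "\<dots> \<in> borel_measurable borel"
      by measurable
    finally show ?thesis .
  qed
  have lim: "((\<lambda>h. \<integral>u. f h (z + blowup h u) \<partial>lborel) \<longlongrightarrow>
      (\<integral>u. indicator {u. rho u < height u} u * Erfc (height u / (2 * sqrt l)) powr p \<partial>lborel)) (at_right 0)"
  proof (rule dominated_convergence_at_right)
    show "(\<lambda>u. f h (z + blowup h u)) \<in> borel_measurable lborel" if "0 < h" for h
    proof -
      have "(\<lambda>u. z + blowup h u) \<in> borel_measurable borel" by measurable
      from measurable_compose[OF this f_meas[OF that]] show ?thesis by simp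
    qed
    have [measurable]: "Erfc \<in> borel_measurable borel"
      by (intro borel_measurable_continuous_onI continuous_on_Erfc continuous_on_id)
    show "(\<lambda>u. indicator {u. rho u < height u} u * Erfc (height u / (2 * sqrt l)) powr p) \<in> borel_measurable lborel"
      by measurable
    show "integrable lborel (\<lambda>u. C * (indicator {u. rho u < height u} u * exp (- height u)))"
      by (rule integrable_region_exp)
    show "AE u in lborel. norm (f h (z + blowup h u)) \<le> C * (indicator {u. rho u < height u} u * exp (- height u))" if h: "0 < h" for h
    proof (rule AE_I2)
      fix u
      show "norm (f h (z + blowup h u)) \<le> C * (indicator {u. rho u < height u} u * exp (- height u))"
      proof (cases "z + blowup h u \<in> ball x R")
        case True
        have "norm (f h (z + blowup h u)) = (max (v (z + blowup h u, h ^ 4) - m h) 0) powr p"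
          using True by (simp add: f_def)
        also have "\<dots> \<le> v (z + blowup h u, h ^ 4) powr p"
          using v_ball_range[OF True, of "h ^ 4"] m0[OF h] h p by (intro powr_mono2) auto
        also have "\<dots> \<le> C * (indicator {u. rho u < height u} u * exp (- height u))" by (rule dom[OF h True])
        finally show ?thesis .
      next
        case False
        then show ?thesis using C by (simp add: f_def)
      qed
    qed
    show "AE u in lborel. ((\<lambda>h. f h (z + blowup h u)) \<longlongrightarrow> indicator {u. rho u < height u} u * Erfc (height u / (2 * sqrt l)) powr p) (at_right 0)"
      using AE_rho_neq_height
    proof eventually_elim
      case (elim u)
      have pos: "eventually (\<lambda>h::real. 0 < h) (at_right 0)" by (simp add: eventually_at_right_less)
      show ?case
      proof (cases "rho u < height u")
        case True
        have "((\<lambda>h. max (v (z + blowup h u, h ^ 4) - m h) 0) \<longlongrightarrow> max (Erfc (height u / (2 * sqrt l)) - 0) 0) (at_right 0)"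
          by (intro tendsto_max tendsto_diff blowup_limit[OF True] m tendsto_const)
        then have "((\<lambda>h. max (v (z + blowup h u, h ^ 4) - m h) 0) \<longlongrightarrow> Erfc (height u / (2 * sqrt l))) (at_right 0)"
          using Erfc_nonneg[of "height u / (2 * sqrt l)"] by (simp add: max_def)
        then have "((\<lambda>h. max (v (z + blowup h u, h ^ 4) - m h) 0 powr p) \<longlongrightarrow> Erfc (height u / (2 * sqrt l)) powr p) (at_right 0)"
          by (rule tendsto_powr') (use p in auto)
        moreover have "eventually (\<lambda>h. max (v (z + blowup h u, h ^ 4) - m h) 0 powr p = f h (z + blowup h u)) (at_right 0)"
          using eventually_in_ball[OF True] by eventually_elim (simp add: f_def)
        ultimately have "((\<lambda>h. f h (z + blowup h u)) \<longlongrightarrow> Erfc (height u / (2 * sqrt l)) powr p) (at_right 0)"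
          by (rule Lim_transform_eventually)
        then show ?thesis using True by simp
      next
        case False
        have "eventually (\<lambda>h. 0 = f h (z + blowup h u)) (at_right 0)"
          using pos by eventually_elim (use not_in_ball[OF False] in \<open>simp add: f_def indicator_def\<close>)
        then have "((\<lambda>h. f h (z + blowup h u)) \<longlongrightarrow> 0) (at_right 0)"
          by (rule Lim_transform_eventually[OF tendsto_const])
        then show ?thesis using False by simp
      qed
    qed
  qed
  have "((\<lambda>h. jacobian * (\<integral>u. f h (z + blowup h u) \<partial>lborel)) \<longlongrightarrow> limit_mass p) (at_right 0)"
    unfolding limit_mass_def by (intro tendsto_mult lim tendsto_const)
  moreover have "eventually (\<lambda>h. jacobian * (\<integral>u. f h (z + blowup h u) \<partial>lborel)
      = (LINT y:ball x R|lborel. (max (v (y, h ^ 4) - m h) 0) powr p) / h ^ (CARD('n) + 1)) (at_right 0)"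
  proof -
    have "eventually (\<lambda>h::real. 0 < h) (at_right 0)" by (simp add: eventually_at_right_less)
    then show ?thesis
    proof eventually_elim
      case (elim h)
      have "(LINT y:ball x R|lborel. (max (v (y, h ^ 4) - m h) 0) powr p) = (\<integral>y. f h y \<partial>lborel)"
        by (simp add: set_lebesgue_integral_def f_def)
      also have "\<dots> = h ^ (CARD('n) + 1) * jacobian * (\<integral>u. f h (z + blowup h u) \<partial>lborel)"
        by (rule change_of_variables[OF f_meas[OF elim] elim])
      finally show ?case using elim by simp
    qed
  qed
  ultimately show ?thesis by (rule Lim_transform_eventually)
qed

lemma exp_decay_beats_powr:
  fixes b \<gamma> :: real
  assumes "0 < b"
  shows "((\<lambda>h. exp (- (b / h ^ 4)) / h powr \<gamma>) \<longlongrightarrow> 0) (at_right 0)"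
  using assms by real_asymp

text \<open>No blow-up here: at a fixed point of the ball \<open>v (y, h^4)\<close> is exponentially
  small and negligible against any power of \<open>h\<close>, so the trial level is felt on the
  whole ball. The exponent \<open>\<gamma>\<close> is chosen such that
  \<open>(h^\<gamma>)^p = h^(N+1)\<close>, the order of the upper part.\<close>

lemma lower_part_limit:
  assumes p: "0 < p" and \<beta>: "0 < \<beta>"
  defines "\<gamma> \<equiv> (real CARD('n) + 1) / p"
  shows "((\<lambda>h. (LINT y:ball x R|lborel. (max (\<beta> * h powr \<gamma> - v (y, h ^ 4)) 0) powr p) / h ^ (CARD('n) + 1))
    \<longlongrightarrow> \<beta> powr p * measure lborel (ball x R)) (at_right 0)"
proof -
  obtain C a where C: "0 < C" and a: "0 < a"
    and bnd: "\<And>y t. y \<in> ball x R \<Longrightarrow> 0 < t \<Longrightarrow> v (y, t) \<le> C * exp (- (a * ((y - z) \<bullet> e i0)\<^sup>2 / t))"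
    using gaussian_domination by blast
  define f where "f h y = indicator (ball x R) y * (max (\<beta> - v (y, h ^ 4) / h powr \<gamma>) 0) powr p" for h y
  have lim: "((\<lambda>h. \<integral>y. f h y \<partial>lborel) \<longlongrightarrow> (\<integral>y. indicator (ball x R) y * \<beta> powr p \<partial>lborel)) (at_right 0)"
  proof (rule dominated_convergence_at_right)
    show "f h \<in> borel_measurable lborel" if "0 < h" for h
    proof -
      define w where "w y = indicator (ball x R) y * v (y, h ^ 4)" for y
      have [measurable]: "ball x R \<in> sets borel" by simp
      have [measurable]: "w \<in> borel_measurable borel"
        unfolding w_def[abs_def] by (rule v_measurable_ball) (use that in simp)
      have "f h = (\<lambda>y. indicator (ball x R) y * (max (\<beta> - w y / h powr \<gamma>) 0) powr p)"
        by (auto simp: f_def w_def indicator_def)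
      also have "\<dots> \<in> borel_measurable borel"
        by measurable
      finally show ?thesis by simp
    qed
    show "(\<lambda>y. indicator (ball x R) y * \<beta> powr p) \<in> borel_measurable lborel"
      by (intro borel_measurable_times borel_measurable_indicator borel_measurable_const) simp
    show "integrable lborel (\<lambda>y. indicator (ball x R) y * \<beta> powr p)"
      by (intro integrable_mult_left integrable_real_indicator) (use emeasure_lborel_ball_finite[of x R] in auto)
    show "AE y in lborel. norm (f h y) \<le> indicator (ball x R) y * \<beta> powr p" if h: "0 < h" for h
    proof (rule AE_I2)
      fix y
      show "norm (f h y) \<le> indicator (ball x R) y * \<beta> powr p"
      proof (cases "y \<in> ball x R")
        case True
        have "max (\<beta> - v (y, h ^ 4) / h powr \<gamma>) 0 powr p \<le> \<beta> powr p"
          using v_ball_range[OF True, of "h ^ 4"] h p \<beta> by (intro powr_mono2) auto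
        then show ?thesis using True by (simp add: f_def)
      qed (simp add: f_def)
    qed
    show "AE y in lborel. ((\<lambda>h. f h y) \<longlongrightarrow> indicator (ball x R) y * \<beta> powr p) (at_right 0)"
    proof (rule AE_I2)
      fix y
      show "((\<lambda>h. f h y) \<longlongrightarrow> indicator (ball x R) y * \<beta> powr p) (at_right 0)"
      proof (cases "y \<in> ball x R")
        case True
        define b where "b = a * ((y - z) \<bullet> e i0)\<^sup>2"
        have b: "0 < b" using a ball_pos[OF True] by (simp add: b_def)
        have pos: "eventually (\<lambda>h::real. 0 < h) (at_right 0)" by (simp add: eventually_at_right_less)
        have up: "((\<lambda>h. C * (exp (- (b / h ^ 4)) / h powr \<gamma>)) \<longlongrightarrow> C * 0) (at_right 0)"
          by (intro tendsto_mult tendsto_const exp_decay_beats_powr b)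
        have "((\<lambda>h. v (y, h ^ 4) / h powr \<gamma>) \<longlongrightarrow> 0) (at_right 0)"
        proof (rule tendsto_sandwich[OF _ _ tendsto_const up[simplified]])
          show "eventually (\<lambda>h. 0 \<le> v (y, h ^ 4) / h powr \<gamma>) (at_right 0)"
            using pos by eventually_elim (use v_ball_range[OF True] in simp)
          show "eventually (\<lambda>h. v (y, h ^ 4) / h powr \<gamma> \<le> C * exp (- (b / h ^ 4)) / h powr \<gamma>) (at_right 0)"
            using pos
          proof eventually_elim
            case (elim h)
            have "v (y, h ^ 4) \<le> C * exp (- (b / h ^ 4))" using bnd[OF True, of "h ^ 4"] elim by (simp add: b_def)
            then show ?case by (intro divide_right_mono) auto
          qed
        qed
        then have "((\<lambda>h. max (\<beta> - v (y, h ^ 4) / h powr \<gamma>) 0) \<longlongrightarrow> max (\<beta> - 0) 0) (at_right 0)"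
          by (intro tendsto_max tendsto_diff tendsto_const)
        then have "((\<lambda>h. max (\<beta> - v (y, h ^ 4) / h powr \<gamma>) 0 powr p) \<longlongrightarrow> (max (\<beta> - 0) 0) powr p) (at_right 0)"
          by (rule tendsto_powr') (use p in auto)
        then show ?thesis using True \<beta> by (simp add: f_def)
      qed (simp add: f_def)
    qed
  qed
  have "(\<integral>y. indicator (ball x R) y * \<beta> powr p \<partial>lborel) = \<beta> powr p * measure lborel (ball x R)"
    by (simp add: mult.commute)
  from lim[unfolded this] have lim': "((\<lambda>h. \<integral>y. f h y \<partial>lborel) \<longlongrightarrow> \<beta> powr p * measure lborel (ball x R)) (at_right 0)" .
  moreover have "eventually (\<lambda>h. (\<integral>y. f h y \<partial>lborel) =
     (LINT y:ball x R|lborel. (max (\<beta> * h powr \<gamma> - v (y, h ^ 4)) 0) powr p) / h ^ (CARD('n) + 1)) (at_right 0)"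
  proof -
    have "eventually (\<lambda>h::real. 0 < h) (at_right 0)" by (simp add: eventually_at_right_less)
    then show ?thesis
    proof eventually_elim
      case (elim h)
      have hg: "(h powr \<gamma>) powr p = h ^ (CARD('n) + 1)"
      proof -
        have "(h powr \<gamma>) powr p = h powr (real (CARD('n) + 1))" using p by (simp add: powr_powr \<gamma>_def add.commute)
        then show ?thesis using elim by (simp only: powr_realpow)
      qed
      have "max (\<beta> * h powr \<gamma> - w) 0 powr p = h ^ (CARD('n) + 1) * max (\<beta> - w / h powr \<gamma>) 0 powr p" for w
      proof -
        have "max (\<beta> * h powr \<gamma> - w) 0 = h powr \<gamma> * max (\<beta> - w / h powr \<gamma>) 0"
        proof -
          have H: "0 < h powr \<gamma>" using elim by simp
          then have eq: "\<beta> * h powr \<gamma> - w = h powr \<gamma> * (\<beta> - w / h powr \<gamma>)" by (simp add: right_diff_distrib)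
          show ?thesis
          proof (cases "0 \<le> \<beta> - w / h powr \<gamma>")
            case True
            then have "0 \<le> h powr \<gamma> * (\<beta> - w / h powr \<gamma>)" using H by (intro mult_nonneg_nonneg) auto
            then show ?thesis unfolding eq using True by (simp only: max_absorb1)
          next
            case False
            then have "h powr \<gamma> * (\<beta> - w / h powr \<gamma>) \<le> 0" using H by (intro mult_nonneg_nonpos) auto
            then show ?thesis unfolding eq using False by (simp only: max_absorb2 not_le less_imp_le mult_zero_right)
          qed
        qed
        then show ?thesis unfolding hg[symmetric] by (simp add: powr_mult)
      qed
      then have "(LINT y:ball x R|lborel. (max (\<beta> * h powr \<gamma> - v (y, h ^ 4)) 0) powr p)
          = (\<integral>y. h ^ (CARD('n) + 1) * f h y \<partial>lborel)"
        by (simp add: set_lebesgue_integral_def f_def mult_ac)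
      then show ?case using elim by simp
    qed
  qed
  ultimately show ?thesis by (rule Lim_transform_eventually)
qed

end

subsection \<open>The constant\<close>

text \<open>The Legendre duplication formula at \<open>(N + 1) / 2\<close>, brought from complex to
  real arguments.\<close>

lemma Gamma_duplication_nat:
  "Gamma ((real N + 1) / 2) * Gamma (real N / 2 + 1) * 2 ^ N = sqrt pi * fact N"
proof -
  let ?z = "complex_of_real ((real N + 1) / 2)"
  have nn: "complex_of_real r \<notin> \<int>\<^sub>\<le>\<^sub>0" if "0 < r" for r
    using that nonpos_Ints_nonpos[of r] by (auto simp: of_real_in_nonpos_Ints_iff)
  have z2: "?z + 1 / 2 = complex_of_real (real N / 2 + 1)" by (simp add: field_simps)
  have "Gamma ?z * Gamma (?z + 1 / 2) = exp ((1 - 2 * ?z) * of_real (ln 2)) * of_real (sqrt pi) * Gamma (2 * ?z)"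
    by (rule Gamma_legendre_duplication) (unfold z2, (rule nn, simp)+)
  also have "(1 - 2 * ?z) * of_real (ln 2) = complex_of_real (- (real N * ln 2))" by (simp add: field_simps)
  also have "2 * ?z = complex_of_real (real N + 1)" by (simp add: field_simps)
  finally have "complex_of_real (Gamma ((real N + 1) / 2) * Gamma (real N / 2 + 1))
      = complex_of_real (exp (- (real N * ln 2)) * sqrt pi * Gamma (real N + 1))"
    unfolding z2 by (simp only: Gamma_complex_of_real exp_of_real of_real_mult)
  then have "Gamma ((real N + 1) / 2) * Gamma (real N / 2 + 1) = exp (- (real N * ln 2)) * sqrt pi * Gamma (real N + 1)"
    by (simp only: of_real_eq_iff)
  moreover have "exp (- (real N * ln 2)) * 2 ^ N = 1"
    by (simp add: exp_minus exp_of_nat_mult)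
  moreover have "Gamma (real N + 1) = fact N" using Gamma_fact[of N, where 'a = real] by (simp add: add.commute)
  moreover have "X * P = Y * S" if "X = E * Y * G" "E * P = 1" "G = S" for X P Y S E G :: real
  proof -
    have "X * P = (E * P) * (Y * G)" unfolding that(1) by (simp only: mult_ac)
    then show ?thesis using that by simp
  qed
  ultimately show ?thesis by blast
qed

text \<open>The source of the factorial in the constant: \<open>N - 1\<close> is the dimension of
  the slices and \<open>N\<close> that of the ball. The power of 2 collects
  \<open>(2 * R)^((N-1)/2)\<close> from the widths and \<open>(2 * sqrt l)^((N+1)/2)\<close> from
  the argument of Erfc.\<close>

lemma unit_ball_vol_quotient:
  assumes "1 \<le> N"
  shows "2 ^ N * unit_ball_vol (real (N - 1)) / unit_ball_vol (real N) = fact N / (Gamma ((real N + 1) / 2))\<^sup>2"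
proof -
  let ?g = "Gamma ((real N + 1) / 2)"
  have g: "0 < ?g" by (intro Gamma_real_pos) simp
  have g2: "0 < Gamma (real N / 2 + 1)" by (intro Gamma_real_pos) (simp add: add_nonneg_pos)
  have e: "real (N - 1) / 2 + 1 = (real N + 1) / 2" using assms by (simp add: field_simps of_nat_diff)
  have p: "pi powr (real (N - 1) / 2) * sqrt pi = pi powr (real N / 2)"
  proof -
    have "real (N - 1) / 2 + 1 / 2 = real N / 2" using assms by (simp add: of_nat_diff field_simps)
    moreover have "sqrt pi = pi powr (1 / 2)" by (simp add: powr_half_sqrt)
    ultimately show ?thesis by (metis powr_add)
  qed
  have "2 ^ N * unit_ball_vol (real (N - 1)) / unit_ball_vol (real N)
      = 2 ^ N * Gamma (real N / 2 + 1) * pi powr (real (N - 1) / 2) / (?g * pi powr (real N / 2))"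
    unfolding unit_ball_vol_def e by simp
  also have "\<dots> = 2 ^ N * Gamma (real N / 2 + 1) / (?g * sqrt pi)"
    unfolding p[symmetric] by simp
  also have "\<dots> = fact N / ?g\<^sup>2"
  proof -
    have "2 ^ N * Gamma (real N / 2 + 1) * ?g\<^sup>2 = (?g * Gamma (real N / 2 + 1) * 2 ^ N) * ?g" by (simp add: power2_eq_square)
    also have "\<dots> = fact N * (?g * sqrt pi)" unfolding Gamma_duplication_nat by simp
    finally have eq: "2 ^ N * Gamma (real N / 2 + 1) * ?g\<^sup>2 = fact N * (?g * sqrt pi)" .
    have gn: "?g \<noteq> 0" using g by (metis less_irrefl)
    have "?g * sqrt pi \<noteq> 0" by (intro no_zero_divisors gn) simp
    moreover have "?g\<^sup>2 \<noteq> 0" by (rule power_not_zero[OF gn])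
    ultimately show ?thesis using eq by (rule frac_eq_eq[THEN iffD2])
  qed
  finally show ?thesis .
qed

section \<open>Evaluation of the limit mass and convergence of the means\<close>

context touching_ball
begin

definition ball_vol :: real where "ball_vol = measure lborel (ball x R)"

lemma ball_vol_eq: "ball_vol = unit_ball_vol (real CARD('n)) * R ^ CARD('n)"
  unfolding ball_vol_def using content_ball[of R x] R by simp

lemma ball_vol_pos: "0 < ball_vol"
  unfolding ball_vol_eq using R by simp

definition curv_prod :: real where "curv_prod = (\<Prod>i\<in>UNIV - {i0}. 1 - R * k i)"

lemma curv_prod_factor: "i \<noteq> i0 \<Longrightarrow> 0 < 1 - R * k i"
  using k_less[of i] R by (simp add: field_simps)

lemma curv_prod_pos: "0 < curv_prod"
  unfolding curv_prod_def using curv_prod_factor by (intro prod_pos) auto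

lemma jacobian_eq: "jacobian = (2 * R) powr ((real CARD('n) - 1) / 2) * curv_prod powr (- 1 / 2)"
proof -
  have "width i = sqrt (2 * R) * inverse (sqrt (1 - R * k i))" if "i \<noteq> i0" for i
  proof -
    have "2 / (1 / R - k i) = 2 * R / (1 - R * k i)" using R by (simp add: field_simps)
    then have "width i = sqrt (2 * R) / sqrt (1 - R * k i)" unfolding width_def by (simp only: real_sqrt_divide)
    then show ?thesis by (simp only: divide_inverse)
  qed
  then have "jacobian = (\<Prod>i\<in>UNIV - {i0}. sqrt (2 * R) * inverse (sqrt (1 - R * k i)))"
    unfolding jacobian_def by (intro prod.cong) auto
  also have "\<dots> = sqrt (2 * R) ^ (CARD('n) - 1) * inverse (\<Prod>i\<in>UNIV - {i0}. sqrt (1 - R * k i))"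
    using prod_inversef[of "\<lambda>i. sqrt (1 - R * k i)" "UNIV - {i0}"]
    by (simp add: prod.distrib card_Diff_singleton comp_def)
  also have "sqrt (2 * R) ^ (CARD('n) - 1) = (2 * R) powr ((real CARD('n) - 1) / 2)"
  proof -
    have "sqrt (2 * R) ^ (CARD('n) - 1) = (sqrt (2 * R)) powr (real (CARD('n) - 1))" using R by (intro powr_realpow[symmetric]) simp
    also have "\<dots> = (2 * R) powr (1 / 2 * real (CARD('n) - 1))" using R by (simp add: powr_half_sqrt[symmetric] powr_powr)
    also have "1 / 2 * real (CARD('n) - 1) = (real CARD('n) - 1) / 2" by (simp add: of_nat_diff)
    finally show ?thesis .
  qed
  also have "inverse (\<Prod>i\<in>UNIV - {i0}. sqrt (1 - R * k i)) = curv_prod powr (- 1 / 2)"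
  proof -
    have "finite S \<Longrightarrow> (\<Prod>i\<in>S. sqrt (1 - R * k i)) = sqrt (\<Prod>i\<in>S. 1 - R * k i)" for S :: "'n set"
      by (induction S rule: finite_induct) (simp_all add: real_sqrt_mult)
    then have "(\<Prod>i\<in>UNIV - {i0}. sqrt (1 - R * k i)) = sqrt curv_prod" by (simp add: curv_prod_def)
    then show ?thesis using curv_prod_pos by (simp add: powr_minus powr_half_sqrt[symmetric])
  qed
  finally show ?thesis .
qed

definition erfc_moment :: "real \<Rightarrow> real" where
  "erfc_moment p = (LINT \<sigma>:{0<..}|lborel. Erfc \<sigma> powr p * \<sigma> powr ((real CARD('n) - 1) / 2))"

lemma erfc_moment_nonneg: "0 \<le> erfc_moment p"
  unfolding erfc_moment_def set_lebesgue_integral_def by (rule Bochner_Integration.integral_nonneg) simp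

text \<open>Integration over slices, followed by the substitution
  \<open>s = 2 * sqrt l * \<sigma>\<close>, which yields the power of \<open>l\<close>.\<close>

lemma limit_mass_eq: "limit_mass p = jacobian * (unit_ball_vol (real (CARD('n) - 1)) * ((2 * sqrt l) powr ((real CARD('n) + 1) / 2) * erfc_moment p))"
proof -
  let ?e = "(real CARD('n) - 1) / 2"
  let ?b = "2 * sqrt l"
  have b: "0 < ?b" using l0 by simp
  have e: "real (CARD('n) - 1) / 2 = ?e" by (simp add: of_nat_diff)
  have [measurable]: "Erfc \<in> borel_measurable borel"
    by (intro borel_measurable_continuous_onI continuous_on_Erfc continuous_on_id)
  have "(\<lambda>s. Erfc (s / ?b) powr p) \<in> borel_measurable borel" by measurable
  from integral_region[OF this]
  have "limit_mass p = jacobian * (unit_ball_vol (real (CARD('n) - 1)) * (LINT s:{0<..}|lborel. Erfc (s / ?b) powr p * s powr ?e))"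
    unfolding limit_mass_def e by simp
  also have "(LINT s:{0<..}|lborel. Erfc (s / ?b) powr p * s powr ?e)
      = \<bar>?b\<bar> * (\<integral>s. indicator {0<..} (0 + ?b * s) *\<^sub>R (Erfc ((0 + ?b * s) / ?b) powr p * (0 + ?b * s) powr ?e) \<partial>lborel)"
    unfolding set_lebesgue_integral_def
    using lborel_integral_real_affine[of ?b "\<lambda>s. indicator {0<..} s *\<^sub>R (Erfc (s / ?b) powr p * s powr ?e)" 0] b by simp
  also have "(\<lambda>s. indicator {0<..} (0 + ?b * s) *\<^sub>R (Erfc ((0 + ?b * s) / ?b) powr p * (0 + ?b * s) powr ?e))
      = (\<lambda>s. ?b powr ?e * (indicator {0<..} s *\<^sub>R (Erfc s powr p * s powr ?e)))"
  proof (rule ext)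
    fix s
    show "indicator {0<..} (0 + ?b * s) *\<^sub>R (Erfc ((0 + ?b * s) / ?b) powr p * (0 + ?b * s) powr ?e)
      = ?b powr ?e * (indicator {0<..} s *\<^sub>R (Erfc s powr p * s powr ?e))"
    proof (cases "0 < s")
      case True
      have "0 < ?b * s" using b True by simp
      moreover have "(?b * s) / ?b = s" using b by simp
      moreover have "(?b * s) powr ?e = ?b powr ?e * s powr ?e" using b True by (intro powr_mult)
      ultimately show ?thesis using True by (simp only: add_0 indicator_simps greaterThan_iff) simp
    next
      case False
      then have "\<not> 0 < ?b * s" using b by (simp add: zero_less_mult_iff)
      then show ?thesis using False by (simp only: add_0) (simp add: indicator_def)
    qed
  qed
  also have "\<bar>?b\<bar> * (\<integral>s. ?b powr ?e * (indicator {0<..} s *\<^sub>R (Erfc s powr p * s powr ?e)) \<partial>lborel)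
      = ?b powr ((real CARD('n) + 1) / 2) * erfc_moment p"
  proof -
    have "\<bar>?b\<bar> * ?b powr ?e = ?b powr (1 + ?e)" using b by (simp add: powr_add)
    also have "1 + ?e = (real CARD('n) + 1) / 2" by (simp add: field_simps)
    finally have *: "\<bar>?b\<bar> * ?b powr ?e = ?b powr ((real CARD('n) + 1) / 2)" .
    have "(\<integral>s. ?b powr ?e * (indicator {0<..} s *\<^sub>R (Erfc s powr p * s powr ?e)) \<partial>lborel) = ?b powr ?e * erfc_moment p"
      unfolding erfc_moment_def set_lebesgue_integral_def by (rule integral_mult_right_zero)
    then show ?thesis unfolding *[symmetric] by (simp only: mult.assoc)
  qed
  finally show ?thesis .
qed

lemma limit_mass_nonneg: "0 \<le> limit_mass p"
  unfolding limit_mass_eq using jacobian_pos erfc_moment_nonneg by (simp add: less_imp_le)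

text \<open>The extra power of \<open>R\<close> is \<open>(R^2)^((N+1)/4)\<close> from the
  normalization by \<open>R^2 / t\<close>. Together with the power of \<open>R\<close> in the widths
  it cancels the \<open>R^N\<close> of the volume of the ball.\<close>

lemma constant_identity:
  "R powr ((real CARD('n) + 1) / 2) * limit_mass p / ball_vol
    = fact CARD('n) * erfc_moment p / (Gamma ((real CARD('n) + 1) / 2))\<^sup>2
      * (curv_prod / l powr ((real CARD('n) + 1) / 2)) powr (- 1 / 2)"
proof -
  define N where "N = real CARD('n)"
  define V where "V = unit_ball_vol (real (CARD('n) - 1))"
  define W where "W = unit_ball_vol (real CARD('n))"
  have WN: "unit_ball_vol N = W" by (simp add: W_def N_def)
  have q: "2 ^ CARD('n) * V / W = fact CARD('n) / (Gamma ((N + 1) / 2))\<^sup>2"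
    unfolding V_def W_def N_def by (rule unit_ball_vol_quotient) simp
  have RN: "R powr ((N + 1) / 2) * R powr ((N - 1) / 2) = R ^ CARD('n)"
  proof -
    have "R powr ((N + 1) / 2) * R powr ((N - 1) / 2) = R powr ((N + 1) / 2 + (N - 1) / 2)" by (rule powr_add[symmetric])
    also have "(N + 1) / 2 + (N - 1) / 2 = N" by (simp add: field_simps)
    finally show ?thesis unfolding N_def using R by (simp add: powr_realpow)
  qed
  have 2: "2 powr ((N - 1) / 2) * 2 powr ((N + 1) / 2) = (2::real) ^ CARD('n)"
  proof -
    have "2 powr ((N - 1) / 2) * 2 powr ((N + 1) / 2) = (2::real) powr ((N - 1) / 2 + (N + 1) / 2)" by (rule powr_add[symmetric])
    also have "(N - 1) / 2 + (N + 1) / 2 = N" by (simp add: field_simps)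
    finally show ?thesis unfolding N_def by (simp add: powr_realpow)
  qed
  have m: "(2 * R) powr ((N - 1) / 2) = 2 powr ((N - 1) / 2) * R powr ((N - 1) / 2)" using R by (intro powr_mult)
  have s: "(2 * sqrt l) powr ((N + 1) / 2) = 2 powr ((N + 1) / 2) * (sqrt l) powr ((N + 1) / 2)" using l0 by (intro powr_mult)
  have d: "(curv_prod / l powr ((N + 1) / 2)) powr (- 1 / 2) = curv_prod powr (- 1 / 2) * (sqrt l) powr ((N + 1) / 2)"
  proof -
    have "(l powr ((N + 1) / 2)) powr (- 1 / 2) = inverse ((sqrt l) powr ((N + 1) / 2))"
    proof -
      have "(l powr ((N + 1) / 2)) powr (- 1 / 2) = l powr ((N + 1) / 2 * (- 1 / 2))" by (rule powr_powr)
      also have "(N + 1) / 2 * (- 1 / 2) = - (1 / 2 * ((N + 1) / 2))" by simp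
      also have "l powr (- (1 / 2 * ((N + 1) / 2))) = inverse (l powr (1 / 2 * ((N + 1) / 2)))" by (rule powr_minus)
      also have "l powr (1 / 2 * ((N + 1) / 2)) = (sqrt l) powr ((N + 1) / 2)"
        using l0 by (simp only: powr_powr[symmetric] powr_half_sqrt less_imp_le)
      finally show ?thesis .
    qed
    moreover have "(curv_prod / l powr ((N + 1) / 2)) powr (- 1 / 2)
        = curv_prod powr (- 1 / 2) / (l powr ((N + 1) / 2)) powr (- 1 / 2)" by (rule powr_divide)
    moreover have "a / inverse b = a * b" for a b :: real by (simp add: divide_inverse)
    ultimately show ?thesis by (simp only:)
  qed
  have "R powr ((N + 1) / 2) * limit_mass p / ball_vol
     = (R powr ((N + 1) / 2) * R powr ((N - 1) / 2)) * (2 powr ((N - 1) / 2) * 2 powr ((N + 1) / 2)) * V / (W * R ^ CARD('n))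
       * erfc_moment p * (curv_prod powr (- 1 / 2) * (sqrt l) powr ((N + 1) / 2))"
  proof -
    have "A * (T * B * c * (V * (U * S * I))) / (W * P) = (A * B) * (T * U) * V / (W * P) * I * (c * S)"
      for A B T U c S I P :: real by (simp add: divide_inverse mult_ac)
    then show ?thesis
      unfolding limit_mass_eq jacobian_eq ball_vol_eq N_def[symmetric] V_def[symmetric] WN m s .
  qed
  also have "\<dots> = 2 ^ CARD('n) * V / W * erfc_moment p * (curv_prod powr (- 1 / 2) * (sqrt l) powr ((N + 1) / 2))"
    unfolding RN 2 using R by simp
  also have "\<dots> = fact CARD('n) / (Gamma ((N + 1) / 2))\<^sup>2 * erfc_moment p * (curv_prod / l powr ((N + 1) / 2)) powr (- 1 / 2)"
    unfolding q d ..
  finally show ?thesis unfolding N_def by simp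
qed

text \<open>At the trial level \<open>\<beta> * h^\<gamma>\<close> the excess of \<open>v\<close>
  concentrates near \<open>z\<close> and the deficit fills the ball, and both are of order
  \<open>h^(N+1)\<close>. The limit changes sign exactly where
  \<open>\<beta>^p * ball_vol = limit_mass p\<close>.\<close>

lemma balance_limit:
  assumes p: "0 < p" and \<beta>: "0 < \<beta>"
  defines "\<gamma> \<equiv> (real CARD('n) + 1) / p"
  shows "((\<lambda>h. (LINT y:ball x R|lborel. signed_powr p (v (y, h ^ 4) - \<beta> * h powr \<gamma>)) / h ^ (CARD('n) + 1))
    \<longlongrightarrow> limit_mass p - \<beta> powr p * ball_vol) (at_right 0)"
proof -
  have \<gamma>0: "0 < \<gamma>" using p by (simp add: \<gamma>_def add_pos_pos)
  have m: "((\<lambda>h. \<beta> * h powr \<gamma>) \<longlongrightarrow> 0) (at_right 0)"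
  proof -
    have "((\<lambda>h::real. h powr \<gamma>) \<longlongrightarrow> 0 powr \<gamma>) (at_right 0)"
      by (rule tendsto_powr') (use \<gamma>0 in \<open>auto simp: eventually_at_right_less intro: eventually_mono[OF eventually_at_right_less]\<close>)
    then have "((\<lambda>h. \<beta> * h powr \<gamma>) \<longlongrightarrow> \<beta> * 0) (at_right 0)" by (intro tendsto_mult tendsto_const) simp
    then show ?thesis by simp
  qed
  have up: "((\<lambda>h. (LINT y:ball x R|lborel. (max (v (y, h ^ 4) - \<beta> * h powr \<gamma>) 0) powr p) / h ^ (CARD('n) + 1)) \<longlongrightarrow> limit_mass p) (at_right 0)"
    by (rule upper_part_limit[OF p m]) (use \<beta> in simp)
  have lo: "((\<lambda>h. (LINT y:ball x R|lborel. (max (\<beta> * h powr \<gamma> - v (y, h ^ 4)) 0) powr p) / h ^ (CARD('n) + 1)) \<longlongrightarrow> \<beta> powr p * ball_vol) (at_right 0)"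
    unfolding ball_vol_def \<gamma>_def by (rule lower_part_limit[OF p \<beta>])
  have "eventually (\<lambda>h::real. 0 < h) (at_right 0)" by (simp add: eventually_at_right_less)
  then have "eventually (\<lambda>h. (LINT y:ball x R|lborel. (max (v (y, h ^ 4) - \<beta> * h powr \<gamma>) 0) powr p) / h ^ (CARD('n) + 1)
       - (LINT y:ball x R|lborel. (max (\<beta> * h powr \<gamma> - v (y, h ^ 4)) 0) powr p) / h ^ (CARD('n) + 1)
     = (LINT y:ball x R|lborel. signed_powr p (v (y, h ^ 4) - \<beta> * h powr \<gamma>)) / h ^ (CARD('n) + 1)) (at_right 0)"
  proof eventually_elim
    case (elim h)
    define w where "w y = indicator (ball x R) y * v (y, h ^ 4)" for y
    define b where "b = \<beta> * h powr \<gamma>"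
    have b0: "0 \<le> b" using \<beta> by (simp add: b_def)
    have [measurable]: "ball x R \<in> sets borel" by simp
    have [measurable]: "w \<in> borel_measurable borel"
      unfolding w_def[abs_def] by (rule v_measurable_ball) (use elim in simp)
    have int: "set_integrable lborel (ball x R) f"
      if f: "\<And>y. y \<in> ball x R \<Longrightarrow> f y = g (w y)" and g: "g \<in> borel_measurable borel"
        and bd: "\<And>s. 0 \<le> s \<Longrightarrow> s \<le> 1 \<Longrightarrow> \<bar>g s\<bar> \<le> C" for f and g :: "real \<Rightarrow> real" and C
      unfolding set_integrable_def
    proof (rule Bochner_Integration.integrable_bound)
      show "integrable lborel (\<lambda>y. indicator (ball x R) y * C)"
        by (intro integrable_mult_left integrable_real_indicator) (use emeasure_lborel_ball_finite[of x R] in auto)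
      have "(\<lambda>y. indicator (ball x R) y *\<^sub>R f y) = (\<lambda>y. indicator (ball x R) y * g (w y))"
        using f by (auto simp: indicator_def)
      also have "\<dots> \<in> borel_measurable lborel"
        by (intro borel_measurable_times borel_measurable_indicator) (use g in simp_all)
      finally show "(\<lambda>y. indicator (ball x R) y *\<^sub>R f y) \<in> borel_measurable lborel" .
      show "AE y in lborel. norm (indicator (ball x R) y *\<^sub>R f y) \<le> norm (indicator (ball x R) y * C)"
      proof (rule AE_I2)
        fix y
        show "norm (indicator (ball x R) y *\<^sub>R f y) \<le> norm (indicator (ball x R) y * C)"
        proof (cases "y \<in> ball x R")
          case True
          have "\<bar>g (w y)\<bar> \<le> C" using v_ball_range[OF True, of "h ^ 4"] elim True by (intro bd) (auto simp: w_def)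
          then show ?thesis using True f by simp
        qed simp
      qed
    qed
    have 1: "set_integrable lborel (ball x R) (\<lambda>y. (max (v (y, h ^ 4) - b) 0) powr p)"
    proof (rule int[of _ "\<lambda>s. (max (s - b) 0) powr p" 1])
      show "\<bar>max (s - b) 0 powr p\<bar> \<le> 1" if "0 \<le> s" "s \<le> 1" for s
        using that b0 p powr_mono2[of p "max (s - b) 0" 1] by simp
    qed (auto simp: w_def)
    have 2: "set_integrable lborel (ball x R) (\<lambda>y. (max (b - v (y, h ^ 4)) 0) powr p)"
    proof (rule int[of _ "\<lambda>s. (max (b - s) 0) powr p" "b powr p"])
      show "\<bar>max (b - s) 0 powr p\<bar> \<le> b powr p" if "0 \<le> s" "s \<le> 1" for s
        using that b0 p powr_mono2[of p "max (b - s) 0" b] by simp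
    qed (auto simp: w_def)
    have "(LINT y:ball x R|lborel. signed_powr p (v (y, h ^ 4) - b))
       = (LINT y:ball x R|lborel. (max (v (y, h ^ 4) - b) 0) powr p - (max (b - v (y, h ^ 4)) 0) powr p)"
      by (simp add: signed_powr_eq)
    also have "\<dots> = (LINT y:ball x R|lborel. (max (v (y, h ^ 4) - b) 0) powr p) - (LINT y:ball x R|lborel. (max (b - v (y, h ^ 4)) 0) powr p)"
      by (rule set_integral_diff(2)[OF 1 2])
    finally show ?case unfolding b_def[symmetric] by (simp add: diff_divide_distrib)
  qed
  from Lim_transform_eventually[OF tendsto_diff[OF up lo] this] show ?thesis .
qed

text \<open>Every trial level strictly below or above the claimed limit has a definite sign of the
  balance for small \<open>h\<close>, which squeezes the rescaled mean.\<close>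

lemma q_mean_blowup_limit:
  assumes q: "1 < q"
  defines "\<gamma> \<equiv> (real CARD('n) + 1) / (q - 1)"
  shows "((\<lambda>h. q_mean (ereal q) (ball x R) (\<lambda>y. v (y, h ^ 4)) / h powr \<gamma>) \<longlongrightarrow> (limit_mass (q - 1) / ball_vol) powr (1 / (q - 1))) (at_right 0)"
proof -
  define p where "p = q - 1"
  have p: "0 < p" using q by (simp add: p_def)
  define Lm where "Lm = (limit_mass p / ball_vol) powr (1 / p)"
  have JL: "limit_mass p = Lm powr p * ball_vol"
  proof -
    have "0 \<le> limit_mass p / ball_vol" using limit_mass_nonneg ball_vol_pos by simp
    then have "(limit_mass p / ball_vol) powr 1 = limit_mass p / ball_vol" by (rule powr_one)
    moreover have "1 / p * p = 1" using p by simp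
    ultimately have "Lm powr p = limit_mass p / ball_vol" by (simp only: Lm_def powr_powr)
    then show ?thesis using ball_vol_pos by simp
  qed
  have L0: "0 \<le> Lm" by (simp add: Lm_def)
  have pos: "eventually (\<lambda>h::real. 0 < h) (at_right 0)" by (simp add: eventually_at_right_less)
  have fin: "ball x R \<in> sets borel" "emeasure lborel (ball x R) < \<infinity>" "0 < measure lborel (ball x R)"
    using emeasure_lborel_ball_finite[of x R] ball_vol_pos by (auto simp: ball_vol_def)
  have meas: "(\<lambda>y. v (y, h ^ 4)) \<in> borel_measurable (restrict_space lborel (ball x R))" if "0 < h" for h
  proof -
    have "(\<lambda>y. indicator (ball x R) y *\<^sub>R v (y, h ^ 4)) \<in> borel_measurable lborel"
      using v_measurable_ball[of "h ^ 4"] that by simp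
    then show ?thesis by (subst borel_measurable_restrict_space_iff) simp_all
  qed
  have ran: "0 \<le> v (y, h ^ 4) \<and> v (y, h ^ 4) \<le> 1" if "0 < h" "y \<in> ball x R" for h y
    using v_ball_range[OF that(2)] that(1) by simp
  let ?\<mu> = "\<lambda>h. q_mean (ereal q) (ball x R) (\<lambda>y. v (y, h ^ 4))"
  note qb = q_mean_bounds[OF fin meas ran q]
  have g: "\<gamma> = (real CARD('n) + 1) / p" by (simp add: \<gamma>_def p_def)
  have "((\<lambda>h. ?\<mu> h / h powr \<gamma>) \<longlongrightarrow> Lm) (at_right 0)"
  proof (rule order_tendstoI)
    fix a assume a: "a < Lm"
    show "eventually (\<lambda>h. a < ?\<mu> h / h powr \<gamma>) (at_right 0)"
    \<comment> \<open>\<open>balance_limit\<close> concerns positive levels only; for negative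
      \<open>a\<close> it is enough that the mean is nonnegative.\<close>
    proof (cases "a < 0")
      case True
      show ?thesis using pos
      proof eventually_elim
        case (elim h)
        have "0 \<le> ?\<mu> h" by (rule qb(1)) (use elim in auto)
        then have "0 \<le> ?\<mu> h / h powr \<gamma>" by simp
        then show ?case using True by linarith
      qed
    next
      case False
      \<comment> \<open>A level strictly between \<open>a\<close> and the limit, so that the weak
        bound on the mean becomes strict with respect to \<open>a\<close>.\<close>
      define \<beta> where "\<beta> = (a + Lm) / 2"
      have \<beta>: "0 < \<beta>" "a < \<beta>" "\<beta> < Lm" using a False by (auto simp: \<beta>_def)
      have "\<beta> powr p < Lm powr p" using \<beta> p by (intro powr_less_mono2) auto
      then have "0 < limit_mass p - \<beta> powr p * ball_vol" unfolding JL using ball_vol_pos by simp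
      from order_tendstoD(1)[OF balance_limit[OF p \<beta>(1), folded g] this] pos
      show ?thesis
      proof eventually_elim
        case (elim h)
        then have "0 < (LINT y:ball x R|lborel. signed_powr (q - 1) (v (y, h ^ 4) - \<beta> * h powr \<gamma>))"
          using zero_less_power[of h "CARD('n) + 1"] by (simp only: pos_less_divide_eq mult_zero_left p_def)
        then have "\<beta> * h powr \<gamma> \<le> ?\<mu> h" by (intro qb(2)) (use elim in auto)
        then have "\<beta> \<le> ?\<mu> h / h powr \<gamma>" using elim by (simp add: pos_le_divide_eq)
        then show ?case using \<beta> by linarith
      qed
    qed
  next
    fix a assume a: "Lm < a"
    define \<beta> where "\<beta> = (a + Lm) / 2"
    have \<beta>: "0 < \<beta>" "\<beta> < a" "Lm < \<beta>" using a L0 by (auto simp: \<beta>_def)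
    have "Lm powr p < \<beta> powr p" using \<beta> p L0 by (intro powr_less_mono2) auto
    then have "limit_mass p - \<beta> powr p * ball_vol < 0" unfolding JL using ball_vol_pos by simp
    from order_tendstoD(2)[OF balance_limit[OF p \<beta>(1), folded g] this] pos
    show "eventually (\<lambda>h. ?\<mu> h / h powr \<gamma> < a) (at_right 0)"
    proof eventually_elim
      case (elim h)
      then have "(LINT y:ball x R|lborel. signed_powr (q - 1) (v (y, h ^ 4) - \<beta> * h powr \<gamma>)) < 0"
        using zero_less_power[of h "CARD('n) + 1"] by (simp only: pos_divide_less_eq mult_zero_left p_def)
      then have "?\<mu> h \<le> \<beta> * h powr \<gamma>" by (intro qb(3)) (use elim in auto)
      then have "?\<mu> h / h powr \<gamma> \<le> \<beta>" using elim by (simp add: pos_divide_le_eq)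
      then show ?case using \<beta> by linarith
    qed
  qed
  then show ?thesis by (simp add: Lm_def p_def)
qed

text \<open>The substitution \<open>h = t^(1/4)\<close> in the blow-up limit, combined with
  \<open>constant_identity\<close>.\<close>

lemma q_mean_limit:
  assumes q: "1 < q"
  shows "((\<lambda>t. (R\<^sup>2 / t) powr ((real CARD('n) + 1) / (4 * (q - 1))) * q_mean (ereal q) (ball x R) (\<lambda>y. v (y, t)))
    \<longlongrightarrow> C_const CARD('n) q * (curv_prod / l powr ((real CARD('n) + 1) / 2)) powr (- 1 / (2 * (q - 1)))) (at_right 0)"
proof -
  define p where "p = q - 1"
  have p: "0 < p" using q by (simp add: p_def)
  let ?N = "real CARD('n)"
  let ?E = "(?N + 1) / (4 * p)"
  have fl: "filterlim (\<lambda>t::real. t powr (1 / 4)) (at_right 0) (at_right 0)"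
    unfolding filterlim_at
  proof
    have pos: "eventually (\<lambda>t::real. 0 < t) (at_right 0)" by (simp add: eventually_at_right_less)
    then show "eventually (\<lambda>t::real. t powr (1 / 4) \<in> {0<..} \<and> t powr (1 / 4) \<noteq> 0) (at_right 0)"
      by eventually_elim simp
    have "((\<lambda>t::real. t powr (1 / 4)) \<longlongrightarrow> 0 powr (1 / 4)) (at_right 0)"
      by (rule tendsto_powr') (use pos in \<open>auto elim: eventually_mono\<close>)
    then show "((\<lambda>t::real. t powr (1 / 4)) \<longlongrightarrow> 0) (at_right 0)" by simp
  qed
  from filterlim_compose[OF q_mean_blowup_limit[OF q] this]
  have "((\<lambda>t. (R\<^sup>2) powr ?E * (q_mean (ereal q) (ball x R) (\<lambda>y. v (y, (t powr (1 / 4)) ^ 4)) / (t powr (1 / 4)) powr ((?N + 1) / p)))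
     \<longlongrightarrow> (R\<^sup>2) powr ?E * (limit_mass p / ball_vol) powr (1 / p)) (at_right 0)"
    unfolding p_def by (intro tendsto_mult tendsto_const)
  moreover have "eventually (\<lambda>t::real. 0 < t) (at_right 0)" by (simp add: eventually_at_right_less)
  then have "eventually (\<lambda>t. (R\<^sup>2) powr ?E * (q_mean (ereal q) (ball x R) (\<lambda>y. v (y, (t powr (1 / 4)) ^ 4)) / (t powr (1 / 4)) powr ((?N + 1) / p))
     = (R\<^sup>2 / t) powr ?E * q_mean (ereal q) (ball x R) (\<lambda>y. v (y, t))) (at_right 0)"
  proof eventually_elim
    case (elim t)
    have "(t powr (1 / 4)) ^ 4 = (t powr (1 / 4)) powr (real 4)" using elim by (intro powr_realpow[symmetric]) simp
    also have "\<dots> = t" using elim by (simp add: powr_powr)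
    finally have t4: "(t powr (1 / 4)) ^ 4 = t" .
    have "(t powr (1 / 4)) powr ((?N + 1) / p) = t powr ?E" by (simp add: powr_powr)
    moreover have "(R\<^sup>2 / t) powr ?E = (R\<^sup>2) powr ?E / t powr ?E" by (rule powr_divide)
    ultimately show ?case unfolding t4 by simp
  qed
  ultimately have lim: "((\<lambda>t. (R\<^sup>2 / t) powr ?E * q_mean (ereal q) (ball x R) (\<lambda>y. v (y, t)))
     \<longlongrightarrow> (R\<^sup>2) powr ?E * (limit_mass p / ball_vol) powr (1 / p)) (at_right 0)"
    by (rule Lim_transform_eventually)
  have "(R\<^sup>2) powr ?E * (limit_mass p / ball_vol) powr (1 / p) = (R powr ((?N + 1) / 2) * limit_mass p / ball_vol) powr (1 / p)"
  proof -
    have "(R\<^sup>2) powr ?E = (R powr 2) powr ?E" using R by simp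
    also have "\<dots> = (R powr ((?N + 1) / 2)) powr (1 / p)"
    proof -
      have "2 * ?E = (?N + 1) / 2 * (1 / p)" using p by (simp add: field_simps)
      then show ?thesis unfolding powr_powr by (rule arg_cong)
    qed
    finally have "(R\<^sup>2) powr ?E * (limit_mass p / ball_vol) powr (1 / p) = (R powr ((?N + 1) / 2)) powr (1 / p) * (limit_mass p / ball_vol) powr (1 / p)" by simp
    also have "\<dots> = (R powr ((?N + 1) / 2) * (limit_mass p / ball_vol)) powr (1 / p)"
      by (rule powr_mult[symmetric])
    finally show ?thesis by simp
  qed
  also have "\<dots> = (fact CARD('n) * erfc_moment p / (Gamma ((?N + 1) / 2))\<^sup>2 * (curv_prod / l powr ((?N + 1) / 2)) powr (- 1 / 2)) powr (1 / p)"
    unfolding constant_identity ..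
  also have "\<dots> = (fact CARD('n) * erfc_moment p / (Gamma ((?N + 1) / 2))\<^sup>2) powr (1 / p) * ((curv_prod / l powr ((?N + 1) / 2)) powr (- 1 / 2)) powr (1 / p)"
    by (rule powr_mult)
  also have "(fact CARD('n) * erfc_moment p / (Gamma ((?N + 1) / 2))\<^sup>2) powr (1 / p) = C_const CARD('n) q"
    unfolding C_const_def erfc_moment_def p_def ..
  also have "((curv_prod / l powr ((?N + 1) / 2)) powr (- 1 / 2)) powr (1 / p) = (curv_prod / l powr ((?N + 1) / 2)) powr (- 1 / (2 * p))"
    by (simp add: powr_powr)
  finally show ?thesis using lim unfolding p_def by simp
qed

text \<open>The supremum over the ball is 1 at every positive time, because \<open>v\<close> is
  continuous up to the contact point and equals 1 there. The infimum is at most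
  \<open>v (x, t)\<close>, which tends to the initial value 0. No rate is involved.\<close>

lemma q_mean_infinity_limit:
  "((\<lambda>t. q_mean \<infinity> (ball x R) (\<lambda>y. v (y, t))) \<longlongrightarrow> 1 / 2) (at_right 0)"
proof -
  define low where "low t = Inf ((\<lambda>y. v (y, t)) ` ball x R)" for t
  have xb: "x \<in> ball x R" using R by simp
  have pos: "eventually (\<lambda>t::real. 0 < t) (at_right 0)" by (simp add: eventually_at_right_less)
  have lowb: "bdd_below ((\<lambda>y. v (y, t)) ` ball x R)" if "0 < t" for t
    using v_ball_range that by (intro bdd_belowI[of _ 0]) auto
  have low0: "0 \<le> low t" if "0 < t" for t
    unfolding low_def by (rule cInf_greatest) (use xb v_ball_range that in auto)
  have lowx: "low t \<le> v (x, t)" if "0 < t" for t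
    unfolding low_def by (rule cInf_lower[OF _ lowb[OF that]]) (use xb in auto)
  have zO: "z \<in> closure \<Omega>" "z \<notin> \<Omega>"
  proof -
    show "z \<notin> \<Omega>" using touch by blast
    have "z \<in> cball x R" using touch by blast
    then have "z \<in> closure (ball x R)" using R by (simp add: closure_ball)
    then show "z \<in> closure \<Omega>" using closure_mono[OF ball_sub] by blast
  qed
  have mean: "q_mean \<infinity> (ball x R) (\<lambda>y. v (y, t)) = (low t + 1) / 2" if t: "0 < t" for t
  proof (rule q_mean_infinity)
    show "open (ball x R)" by simp
    show "continuous_on (ball x R) (\<lambda>y. v (y, t))"
    proof (rule continuous_on_compose2[of "closure \<Omega> \<times> {0<..}" v])
      show "continuous_on (closure \<Omega> \<times> {0<..}) v" by (rule v_continuous_on) simp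
      show "continuous_on (ball x R) (\<lambda>y. (y, t))" by (intro continuous_intros)
      show "(\<lambda>y. (y, t)) ` ball x R \<subseteq> closure \<Omega> \<times> {0<..}"
        using ball_sub closure_subset[of \<Omega>] t by auto
    qed
    show "low t \<le> v (y, t) \<and> v (y, t) \<le> 1" if "y \<in> ball x R" for y
      using v_ball_range[OF that t] unfolding low_def by (auto intro!: cInf_lower lowb[OF t] imageI that)
    show "\<exists>y\<in>ball x R. v (y, t) < c" if "low t < c" for c
      using that xb cInf_less_iff[OF _ lowb[OF t], of c] unfolding low_def by auto
    show "\<exists>y\<in>ball x R. c < v (y, t)" if c: "c < 1" for c
    proof -
      have "continuous_on (closure \<Omega>) (\<lambda>y. v (y, t))"
      proof (rule continuous_on_compose2[of "closure \<Omega> \<times> {0<..}" v])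
        show "continuous_on (closure \<Omega> \<times> {0<..}) v" by (rule v_continuous_on) simp
        show "continuous_on (closure \<Omega>) (\<lambda>y. (y, t))" by (intro continuous_intros)
      qed (use t in auto)
      then have "((\<lambda>y. v (y, t)) \<longlongrightarrow> v (z, t)) (at z within closure \<Omega>)"
        using zO(1) by (simp add: continuous_on_def)
      moreover have "v (z, t) = 1" by (rule v_boundary[OF zO t])
      ultimately have "eventually (\<lambda>y. c < v (y, t)) (at z within closure \<Omega>)"
        using c by (intro order_tendstoD(1)) auto
      then obtain d where d: "0 < d" "\<And>y. y \<in> closure \<Omega> \<Longrightarrow> y \<noteq> z \<Longrightarrow> dist y z < d \<Longrightarrow> c < v (y, t)"
        unfolding eventually_at by auto
      \<comment> \<open>The normal segment from \<open>z\<close> towards the centre runs inside the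
        ball, so it approaches \<open>z\<close> through points of the ball.\<close>
      define s where "s = min (d / 2) R"
      have s: "0 < s" "s < d" "s \<le> R" using d R by (auto simp: s_def)
      have ip: "(s *\<^sub>R e i0) \<bullet> e i0 = s" using orth[of i0 i0] by simp
      have np: "norm (s *\<^sub>R e i0) = s" using s norm_e by simp
      have inb: "z + s *\<^sub>R e i0 \<in> ball x R"
      proof -
        have "s * s < 2 * R * s" using s R by (intro mult_strict_right_mono) auto
        then show ?thesis unfolding in_ball_iff ip np by (simp add: power2_eq_square)
      qed
      moreover have "c < v (z + s *\<^sub>R e i0, t)"
      proof (rule d(2))
        show "z + s *\<^sub>R e i0 \<in> closure \<Omega>" using inb ball_sub closure_subset[of \<Omega>] by blast
        show "z + s *\<^sub>R e i0 \<noteq> z" using np s by auto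
        show "dist (z + s *\<^sub>R e i0) z < d" using np s by (simp add: dist_norm)
      qed
      ultimately show ?thesis by blast
    qed
  qed
  have vx: "((\<lambda>t. v (x, t)) \<longlongrightarrow> 0) (at_right 0)"
  proof (rule tendstoI)
    fix \<epsilon> :: real assume \<epsilon>: "0 < \<epsilon>"
    have "compact {x}" "{x} \<subseteq> \<Omega>" using xb ball_sub by auto
    from v_small_initially[OF this, of "\<epsilon> / 2"] \<epsilon> obtain \<tau> where
      \<tau>: "0 < \<tau>" "\<And>y s. y \<in> {x} \<Longrightarrow> 0 \<le> s \<Longrightarrow> s \<le> \<tau> \<Longrightarrow> v (y, s) \<le> \<epsilon> / 2" by auto
    have "eventually (\<lambda>t. t < \<tau>) (at_right (0::real))"
      using \<tau>(1) by (auto simp: eventually_at_right_field)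
    with pos show "eventually (\<lambda>t. dist (v (x, t)) 0 < \<epsilon>) (at_right 0)"
    proof eventually_elim
      case (elim t)
      then show ?case using \<tau>(2)[of x t] v_ball_range[OF xb, of t] \<epsilon> by simp
    qed
  qed
  have "(low \<longlongrightarrow> 0) (at_right 0)"
  proof (rule tendsto_sandwich[OF _ _ tendsto_const vx])
    show "eventually (\<lambda>t. 0 \<le> low t) (at_right 0)" using pos by eventually_elim (rule low0)
    show "eventually (\<lambda>t. low t \<le> v (x, t)) (at_right 0)" using pos by eventually_elim (rule lowx)
  qed
  then have "((\<lambda>t. (low t + 1) / 2) \<longlongrightarrow> (0 + 1) / 2) (at_right 0)"
    by (intro tendsto_intros) auto
  then have "((\<lambda>t. (low t + 1) / 2) \<longlongrightarrow> 1 / 2) (at_right 0)" by simp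
  moreover have "eventually (\<lambda>t. (low t + 1) / 2 = q_mean \<infinity> (ball x R) (\<lambda>y. v (y, t))) (at_right 0)"
    using pos by eventually_elim (simp add: mean)
  ultimately show ?thesis by (rule Lim_transform_eventually)
qed

end

theorem theorem5p2:
  fixes \<Omega> :: "(real^'n) set" and x z :: "real^'n" and R lam Lam :: real
  assumes "CARD('n) \<ge> 2"
    and "0 < lam" and "lam \<le> Lam"
    and "C2_domain \<Omega>"
    and "x \<in> \<Omega>" and "R > 0" and "z \<in> frontier \<Omega>"
    and "ball x R \<subseteq> \<Omega>"
    and "cball x R \<inter> (- \<Omega>) = {z}"
    and "\<forall>k \<in># principal_curvatures \<Omega> z. k < 1 / R"
  shows
    "(\<forall>v. is_solution (pucci_minus lam Lam) \<Omega> v \<longrightarrow>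
        (\<forall>q::real. 1 < q \<longrightarrow>
          ((\<lambda>t. (R\<^sup>2 / t) powr ((real CARD('n) + 1) / (4 * (q - 1)))
                * q_mean (ereal q) (ball x R) (\<lambda>y. v (y, t)))
            \<longlongrightarrow> C_const CARD('n) q
                * (Pi0 R \<Omega> z / lam powr ((real CARD('n) + 1) / 2)) powr (- 1 / (2 * (q - 1))))
            (at_right 0)) \<and>
        ((\<lambda>t. q_mean \<infinity> (ball x R) (\<lambda>y. v (y, t))) \<longlongrightarrow> 1 / 2) (at_right 0)) \<and>
     (\<forall>v. is_solution (pucci_plus lam Lam) \<Omega> v \<longrightarrow>
        (\<forall>q::real. 1 < q \<longrightarrow>
          ((\<lambda>t. (R\<^sup>2 / t) powr ((real CARD('n) + 1) / (4 * (q - 1)))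
                * q_mean (ereal q) (ball x R) (\<lambda>y. v (y, t)))
            \<longlongrightarrow> C_const CARD('n) q
                * (Pi0 R \<Omega> z / Lam powr ((real CARD('n) + 1) / 2)) powr (- 1 / (2 * (q - 1))))
            (at_right 0)) \<and>
        ((\<lambda>t. q_mean \<infinity> (ball x R) (\<lambda>y. v (y, t))) \<longlongrightarrow> 1 / 2) (at_right 0))"
proof -
  note R = \<open>R > 0\<close> and touch = \<open>cball x R \<inter> (- \<Omega>) = {z}\<close>
  have op: "open \<Omega>" using \<open>C2_domain \<Omega>\<close> by (simp add: C2_domain_def)
  have zx: "dist x z = R"
  proof -
    have "z \<in> cball x R" "z \<notin> \<Omega>" using touch by auto
    then show ?thesis using \<open>ball x R \<subseteq> \<Omega>\<close> by force
  qed
  obtain e :: "'n \<Rightarrow> real^'n" and i0 k where orth: "\<And>i j. e i \<bullet> e j = (if i = j then 1 else 0)"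
    and e0: "e i0 = (1 / R) *\<^sub>R (x - z)"
    and curv: "principal_curvatures \<Omega> z = image_mset k (mset_set (UNIV - {i0}))"
    and expansion: "\<And>\<epsilon>. 0 < \<epsilon> \<Longrightarrow> \<exists>\<delta>>0. \<forall>u. norm u < \<delta> \<longrightarrow>
      (z + u \<in> closure \<Omega> \<longrightarrow> (\<Sum>i\<in>UNIV - {i0}. k i * (u \<bullet> e i)\<^sup>2) / 2 - \<epsilon> * ((norm u)\<^sup>2 + \<bar>u \<bullet> e i0\<bar>) \<le> u \<bullet> e i0) \<and>
      (z + u \<notin> \<Omega> \<longrightarrow> u \<bullet> e i0 \<le> (\<Sum>i\<in>UNIV - {i0}. k i * (u \<bullet> e i)\<^sup>2) / 2 + \<epsilon> * ((norm u)\<^sup>2 + \<bar>u \<bullet> e i0\<bar>))"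
    by (fact C2_domain_boundary_expansion[OF \<open>C2_domain \<Omega>\<close> \<open>z \<in> frontier \<Omega>\<close> R \<open>ball x R \<subseteq> \<Omega>\<close> zx])
  have k: "k i < 1 / R" if "i \<noteq> i0" for i
    using assms(10) that unfolding curv by simp
  have x_eq: "x = z + R *\<^sub>R e i0" using R by (simp add: e0)
  have Pi0: "Pi0 R \<Omega> z = (\<Prod>i\<in>UNIV - {i0}. 1 - R * k i)"
    unfolding Pi0_def curv by (simp add: prod_unfold_prod_mset multiset.map_comp comp_def)
  \<comment> \<open>Both operators give instances of \<open>pucci_solution\<close>, so the limits
    are established once, with \<open>l\<close> equal to \<open>lam\<close> or
    \<open>Lam\<close>.\<close>
  have tb: "touching_ball F \<Omega> v l L e i0 k x z R" if "pucci_solution F \<Omega> v l L" for F v l L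
    using that orth R x_eq \<open>ball x R \<subseteq> \<Omega>\<close> touch k expansion
    by (simp add: touching_ball_def touching_ball_axioms_def)
  have lim: "((\<lambda>t. (R\<^sup>2 / t) powr ((real CARD('n) + 1) / (4 * (q - 1))) * q_mean (ereal q) (ball x R) (\<lambda>y. v (y, t)))
      \<longlongrightarrow> C_const CARD('n) q * (Pi0 R \<Omega> z / l powr ((real CARD('n) + 1) / 2)) powr (- 1 / (2 * (q - 1)))) (at_right 0)"
    if "pucci_solution F \<Omega> v l L" "1 < q" for F v l L q
  proof -
    interpret touching_ball F \<Omega> v l L e i0 k x z R by (rule tb[OF that(1)])
    show ?thesis using q_mean_limit[OF that(2)] unfolding curv_prod_def Pi0 .
  qed
  have lim_inf: "((\<lambda>t. q_mean \<infinity> (ball x R) (\<lambda>y. v (y, t))) \<longlongrightarrow> 1 / 2) (at_right 0)"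
    if "pucci_solution F \<Omega> v l L" for F v l L
  proof -
    interpret touching_ball F \<Omega> v l L e i0 k x z R by (rule tb[OF that])
    show ?thesis by (rule q_mean_infinity_limit)
  qed
  show ?thesis
    using lim lim_inf pucci_minus_solution[OF _ op assms(2,3)] pucci_plus_solution[OF _ op assms(2,3)] by blast
qed

end
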